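(* Let $q=p^s$ be a power of a prime $p$, $n\ge1$, $k=\bar{\mathbb{F}}_p$, $G_n=GL_n(\mathbb{F}_q)$, $F:(a_{ij})\mapsto(a_{ij}^q)$ the Frobenius map on $GL_n$ over $k$. Let $$Q'=\{x=(x_i^{q^{j-1}})_{1\le i,j\le n}\in GL_n\mid x_1,\dots,x_n\in k,\ (-1)^{n-1}\det(x)^{q-1}=1\}.$$ Then one can define a map $f:Q'\to U^*/\rho(InU^* )$ by $x\mapsto\dot w_n^{-1}x^{-1}F(x)$; in fact $$\dot w_n^{-1}x^{-1}F(x)=\begin{pmatrix}1&0&\cdots&0&-c_{n,1}\\ 0&1&\cdots&0&-c_{n,2}\\ \vdots&&\ddots&&\vdots\\ 0&0&\cdots&1&-c_{n,n-1}\\ 0&0&\cdots&0&1\end{pmatrix},$$ where $c_{n,i}=c_{n,i}(x_1,\dots,x_n)$ is the Dickson element. This map induces isomorphisms $$G_n\backslash Q'\cong U^*/\rho(InU^* )\cong\mathrm{Spec}(k[c_{n,1},\dots,c_{n,n-1}])$$ (so that $Q'\cong\tilde X(\dot w_n)$), where $k[c_{n,1},\dots,c_{n,n-1}]$ is a polynomial algebra.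
   Context: $\dot w_n$ is the permutation matrix with entries $1$ in positions $(1,n)$ and $(i+1,i)$, $1\le i\le n-1$, and $0$ elsewhere; $U^*\subset GL_n$ is the group of upper triangular unipotent matrices; $\mathrm{ad}(a)u=aua^{-1}$; $InU^*=U^*\cap\mathrm{ad}(\dot w_n)U^*$. The group $InU^*$ acts on $U^*$ by $\rho(u)v=\mathrm{ad}(\dot w_n^{-1})(u)\,v\,F(u^{-1})$ for $u\in InU^*$, $v\in U^*$, and $U^*/\rho(InU^* )$ is the quotient by this action. $G_n$ acts on $Q'$ by left multiplication of matrices (equivalently linearly on the vector $(x_1,\dots,x_n)^t$). The Dickson elements are defined by $\sum_{i=0}^{n}c_{n,i}X^{q^i}=\prod_{(\lambda_1,\dots,\lambda_n)\in\mathbb{F}_q^n}(X+\lambda_1x_1+\cdots+\lambda_nx_n)$. The Deligne--Lusztig variety is $\tilde X(\dot w_n)=\{g\in GL_n\mid g^{-1}F(g)\in\dot w_nU^*\}/(U^*\cap\mathrm{ad}(\dot w_n)U^* )$ (quotient by right multiplication). *)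

theory Defs
  imports
    "Jordan_Normal_Form.Determinant"
    "Jordan_Normal_Form.Gauss_Jordan_Elimination"
    "HOL-Algebra.Group_Action"
    "HOL-Analysis.Abstract_Topology"
    "HOL-Library.Poly_Mapping"
begin

section \<open>Polynomials in several variables\<close>

text \<open>
  The type \<^typ>\<open>('v \<Rightarrow>\<^sub>0 nat) \<Rightarrow>\<^sub>0 'k\<close>, with the convolution product of the library, is the
  polynomial ring over \<open>'k\<close> in the variables \<open>'v\<close>: a monomial is a finitely supported
  exponent map.
\<close>

definition mpoly_vars :: "(('v \<Rightarrow>\<^sub>0 nat) \<Rightarrow>\<^sub>0 'k::zero) \<Rightarrow> 'v set" where
  "mpoly_vars P = (\<Union>m\<in>Poly_Mapping.keys P. Poly_Mapping.keys m)"

definition mpoly_eval :: "(('v \<Rightarrow>\<^sub>0 nat) \<Rightarrow>\<^sub>0 'k::comm_semiring_1) \<Rightarrow> ('v \<Rightarrow> 'k) \<Rightarrow> 'k" where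
  "mpoly_eval P a =
     (\<Sum>m\<in>Poly_Mapping.keys P. Poly_Mapping.lookup P m *
        (\<Prod>v\<in>Poly_Mapping.keys m. a v ^ Poly_Mapping.lookup m v))"


section \<open>Spaces with functions\<close>

text \<open>
  Varieties over the algebraically closed field \<open>'k\<close> are treated classically: a set of points, a
  topology on it, and for each open set \<open>U\<close> the \<open>'k\<close>-valued functions that are regular on \<open>U\<close>.
  Functions are total in HOL; \<open>regular X U f\<close> is only meaningful for \<open>U\<close> open and only
  depends on the values of \<open>f\<close> on \<open>U\<close>.
\<close>

record ('a, 'k) fspace =
  zariski :: "'a topology"
  regular :: "'a set \<Rightarrow> ('a \<Rightarrow> 'k) \<Rightarrow> bool"

text \<open>
  The structure defined on \<open>S\<close> by an algebra \<open>A\<close> of functions: the nonvanishing loci of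
  elements of \<open>A\<close> form a basis of the topology, and regular functions are those which are locally
  fractions of elements of \<open>A\<close>.
\<close>

definition fspace_of :: "'a set \<Rightarrow> ('a \<Rightarrow> 'k::field) set \<Rightarrow> ('a, 'k) fspace" where
  "fspace_of S A =
    (let T = topology_generated_by {{x \<in> S. a x \<noteq> 0} | a. a \<in> A} in
     \<lparr> zariski = T,
       regular = (\<lambda>U f. \<forall>x\<in>U. \<exists>V a b. openin T V \<and> x \<in> V \<and> V \<subseteq> U \<and> a \<in> A \<and> b \<in> A \<and>
                    (\<forall>y\<in>V. b y \<noteq> 0 \<and> f y = a y / b y)) \<rparr>)"

text \<open>
  The quotient along \<open>\<pi>\<close>: the points are the values of \<open>\<pi>\<close>, a set is open if its preimage is,
  and a function is regular if its composition with \<open>\<pi>\<close> is.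
\<close>

definition fspace_quotient :: "('a, 'k) fspace \<Rightarrow> ('a \<Rightarrow> 'b) \<Rightarrow> ('b, 'k) fspace" where
  "fspace_quotient X \<pi> =
    \<lparr> zariski = topology (\<lambda>U. U \<subseteq> \<pi> ` topspace (zariski X) \<and>
                    openin (zariski X) {x \<in> topspace (zariski X). \<pi> x \<in> U}),
      regular = (\<lambda>U f. regular X {x \<in> topspace (zariski X). \<pi> x \<in> U} (f \<circ> \<pi>)) \<rparr>"

lemma istopology_fspace_quotient:
  fixes \<pi> :: "'a \<Rightarrow> 'b"
  shows "istopology (\<lambda>U. U \<subseteq> \<pi> ` topspace T \<and> openin T {x \<in> topspace T. \<pi> x \<in> U})"
  unfolding istopology_def
proof (intro conjI allI impI)
  fix K :: "'b set set"
  assume K: "\<forall>U\<in>K. U \<subseteq> \<pi> ` topspace T \<and> openin T {x \<in> topspace T. \<pi> x \<in> U}"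
  show "\<Union>K \<subseteq> \<pi> ` topspace T"
    using K by blast
  have "{x \<in> topspace T. \<pi> x \<in> \<Union>K} = (\<Union>U\<in>K. {x \<in> topspace T. \<pi> x \<in> U})"
    by auto
  then show "openin T {x \<in> topspace T. \<pi> x \<in> \<Union>K}"
    using K by auto
next
  fix U V :: "'b set"
  assume U: "U \<subseteq> \<pi> ` topspace T \<and> openin T {x \<in> topspace T. \<pi> x \<in> U}"
    and V: "V \<subseteq> \<pi> ` topspace T \<and> openin T {x \<in> topspace T. \<pi> x \<in> V}"
  show "U \<inter> V \<subseteq> \<pi> ` topspace T"
    using U by blast
  have "{x \<in> topspace T. \<pi> x \<in> U \<inter> V} =
        {x \<in> topspace T. \<pi> x \<in> U} \<inter> {x \<in> topspace T. \<pi> x \<in> V}"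
    by auto
  then show "openin T {x \<in> topspace T. \<pi> x \<in> U \<inter> V}"
    using U V by auto
qed

definition fspace_iso :: "('a \<Rightarrow> 'b) \<Rightarrow> ('a, 'k) fspace \<Rightarrow> ('b, 'k) fspace \<Rightarrow> bool" where
  "fspace_iso \<phi> X Y \<longleftrightarrow>
     homeomorphic_map (zariski X) (zariski Y) \<phi> \<and>
     (\<forall>U f. openin (zariski Y) U \<longrightarrow>
        (regular Y U f \<longleftrightarrow> regular X {x \<in> topspace (zariski X). \<phi> x \<in> U} (f \<circ> \<phi>)))"

text \<open>
  \<open>fspace_spec D A\<close> is the variety of closed points of \<open>Spec A\<close>, where \<open>A\<close> is a finitely
  generated algebra of functions on \<open>D\<close> (extensional outside \<open>D\<close>): since \<open>'k\<close> is
  algebraically closed, a closed point is the same as an algebra homomorphism \<open>\<chi>\<close> from \<open>A\<close> to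
  \<open>'k\<close>, and the value of \<open>a\<close> at \<open>\<chi>\<close> is \<open>\<chi> a\<close>.
\<close>

definition algebra_points :: "'a set \<Rightarrow> ('a \<Rightarrow> 'k::field) set \<Rightarrow> (('a \<Rightarrow> 'k) \<Rightarrow> 'k) set" where
  "algebra_points D A =
    {\<chi> \<in> extensional A.
       (\<forall>t. \<chi> (\<lambda>x\<in>D. t) = t) \<and>
       (\<forall>a\<in>A. \<forall>b\<in>A. \<chi> (\<lambda>x\<in>D. a x + b x) = \<chi> a + \<chi> b) \<and>
       (\<forall>a\<in>A. \<forall>b\<in>A. \<chi> (\<lambda>x\<in>D. a x * b x) = \<chi> a * \<chi> b)}"

definition fspace_spec :: "'a set \<Rightarrow> ('a \<Rightarrow> 'k::field) set \<Rightarrow> (('a \<Rightarrow> 'k) \<Rightarrow> 'k, 'k) fspace" where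
  "fspace_spec D A = fspace_of (algebra_points D A) ((\<lambda>a \<chi>. \<chi> a) ` A)"


section \<open>Sets and groups of matrices\<close>

text \<open>Rows and columns are numbered from \<open>0\<close>, as in the matrix library.\<close>

definition matrix_fspace :: "nat \<Rightarrow> 'k::field mat set \<Rightarrow> ('k mat, 'k) fspace" where
  "matrix_fspace n S =
     fspace_of S {(\<lambda>A. mpoly_eval P (\<lambda>ij. A $$ ij)) | P. mpoly_vars P \<subseteq> {..<n} \<times> {..<n}}"

definition matrix_group :: "nat \<Rightarrow> 'k::field mat set \<Rightarrow> 'k mat monoid" where
  "matrix_group n H = \<lparr> carrier = H, mult = (*), one = 1\<^sub>m n \<rparr>"

definition minv :: "'k::field mat \<Rightarrow> 'k mat" where
  "minv A = the (mat_inverse A)"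

definition GL :: "nat \<Rightarrow> 'k::field mat set" where
  "GL n = {A \<in> carrier_mat n n. invertible_mat A}"

definition frob :: "nat \<Rightarrow> 'k::field mat \<Rightarrow> 'k mat" where
  "frob q A = map_mat (\<lambda>a. a ^ q) A"

text \<open>
  When \<open>q\<close> is a power of the characteristic of the algebraically closed field \<open>'k\<close>, this is its
  unique subfield with \<open>q\<close> elements.
\<close>

definition Fq :: "nat \<Rightarrow> 'k::field set" where
  "Fq q = {a. a ^ q = a}"

definition GL_Fq :: "nat \<Rightarrow> nat \<Rightarrow> 'k::field mat set" where
  "GL_Fq q n = {A \<in> GL n. elements_mat A \<subseteq> Fq q}"

definition wdot :: "nat \<Rightarrow> 'k::field mat" where
  "wdot n = mat n n (\<lambda>(i, j). if (i = 0 \<and> j = n - 1) \<or> i = j + 1 then 1 else 0)"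

definition ad :: "'k::field mat \<Rightarrow> 'k mat \<Rightarrow> 'k mat" where
  "ad a u = a * u * minv a"

definition Ustar :: "nat \<Rightarrow> 'k::field mat set" where
  "Ustar n = {A \<in> carrier_mat n n. upper_triangular A \<and> (\<forall>i<n. A $$ (i, i) = 1)}"

definition InU :: "nat \<Rightarrow> 'k::field mat set" where
  "InU n = Ustar n \<inter> ad (wdot n) ` Ustar n"

definition rho :: "nat \<Rightarrow> nat \<Rightarrow> 'k::field mat \<Rightarrow> 'k mat \<Rightarrow> 'k mat" where
  "rho q n u v = ad (minv (wdot n)) u * v * frob q (minv u)"

definition rho_orbit :: "nat \<Rightarrow> nat \<Rightarrow> 'k::field mat \<Rightarrow> 'k mat set" where
  "rho_orbit q n = orbit (matrix_group n (InU n)) (rho q n)"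

definition Ustar_mod_rho :: "nat \<Rightarrow> nat \<Rightarrow> ('k::field mat set, 'k) fspace" where
  "Ustar_mod_rho q n = fspace_quotient (matrix_fspace n (Ustar n)) (rho_orbit q n)"

text \<open>
  The orbits for right multiplication, that is, the cosets \<open>g (InU n)\<close>.
\<close>

definition InU_coset :: "nat \<Rightarrow> 'k::field mat \<Rightarrow> 'k mat set" where
  "InU_coset n = orbit (matrix_group n (InU n)) (\<lambda>u g. g * u)"

definition DL_variety :: "nat \<Rightarrow> nat \<Rightarrow> ('k::field mat set, 'k) fspace" where
  "DL_variety q n =
     fspace_quotient
       (matrix_fspace n {g \<in> GL n. minv g * frob q g \<in> (\<lambda>u. wdot n * u) ` Ustar n})
       (InU_coset n)"


section \<open>The variety \<open>Q'\<close> and the Dickson elements\<close>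

definition moore :: "nat \<Rightarrow> 'k::field vec \<Rightarrow> 'k mat" where
  "moore q x = mat (dim_vec x) (dim_vec x) (\<lambda>(i, j). x $ i ^ (q ^ j))"

definition Qprime :: "nat \<Rightarrow> nat \<Rightarrow> 'k::field mat set" where
  "Qprime q n = {A \<in> GL n. (\<exists>x\<in>carrier_vec n. A = moore q x) \<and> (-1) ^ (n - 1) * det A ^ (q - 1) = 1}"

definition Qprime_orbit :: "nat \<Rightarrow> nat \<Rightarrow> 'k::field mat \<Rightarrow> 'k mat set" where
  "Qprime_orbit q n = orbit (matrix_group n (GL_Fq q n)) (*)"

definition G_mod_Qprime :: "nat \<Rightarrow> nat \<Rightarrow> ('k::field mat set, 'k) fspace" where
  "G_mod_Qprime q n = fspace_quotient (matrix_fspace n (Qprime q n)) (Qprime_orbit q n)"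

text \<open>
  The product of the \<open>X + \<lambda>\<^sub>1 x\<^sub>1 + \<cdots> + \<lambda>\<^sub>n x\<^sub>n\<close> over all \<open>\<lambda>\<close> in \<open>\<F>\<^sub>q\<^sup>n\<close> only involves the powers
  \<open>X\<^bsup>q^i\<^esup>\<close>, and \<open>c\<^bsub>n,i\<^esub>(x)\<close> is the coefficient of \<open>X\<^bsup>q^i\<^esup>\<close>.
\<close>

definition dickson :: "nat \<Rightarrow> nat \<Rightarrow> nat \<Rightarrow> 'k::field vec \<Rightarrow> 'k" where
  "dickson q n i x =
     poly.coeff (\<Prod>l\<in>{l \<in> carrier_vec n. \<forall>r<n. l $ r \<in> Fq q}. [:l \<bullet> x, 1:]) (q ^ i)"

text \<open>
  Substitution of \<open>c\<^bsub>n,i\<^esub>\<close> for the \<open>i\<close>-th variable of \<open>P\<close>, as a function on \<open>Q'\<close>; the point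
  \<open>(x\<^sub>1, \<dots>, x\<^sub>n)\<close> is the first column of the matrix.
\<close>

definition dickson_subst :: "nat \<Rightarrow> nat \<Rightarrow> ((nat \<Rightarrow>\<^sub>0 nat) \<Rightarrow>\<^sub>0 'k::field) \<Rightarrow> 'k mat \<Rightarrow> 'k" where
  "dickson_subst q n P = (\<lambda>A\<in>Qprime q n. mpoly_eval P (\<lambda>i. dickson q n i (col A 0)))"

definition dickson_algebra :: "nat \<Rightarrow> nat \<Rightarrow> ('k::field mat \<Rightarrow> 'k) set" where
  "dickson_algebra q n = dickson_subst q n ` {P. mpoly_vars P \<subseteq> {1..n - 1}}"

definition lang :: "nat \<Rightarrow> nat \<Rightarrow> 'k::field mat \<Rightarrow> 'k mat" where
  "lang q n x = minv (wdot n) * minv x * frob q x"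

end

theory Submission
  imports Defs
begin

text \<open>
  If the rows of the Moore matrix \<open>x = (x\<^sub>i\<^bsup>q^j\<^esup>)\<close> are given by elements \<open>x\<^sub>i\<close> which are linearly independent
  over \<open>\<F>\<^sub>q\<close>, then \<open>x\<^bsup>-1\<^esup> F(x)\<close> is a companion matrix, and by counting roots its last column consists of the
  coefficients of the product of the \<open>X + \<lambda> \<cdot> x\<close>. Hence the Lang map sends \<open>Q'\<close> to the matrices which differ from
  the identity only in the last column. All of these occur, since the polynomial with prescribed
  \<open>c\<^sub>1, \<dots>, c\<^sub>n\<^sub>-\<^sub>1\<close> and \<open>c\<^sub>0 = -1\<close> is additive and separable, and the fibres are the orbits of \<open>G\<^sub>n\<close>, because
  \<open>x\<^bsup>-1\<^esup> F(x) = y\<^bsup>-1\<^esup> F(y)\<close> makes \<open>y x\<^bsup>-1\<^esup>\<close> invariant under \<open>F\<close>.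

  The same matrices are a section of \<open>U\<^sup>*\<close> modulo \<open>\<rho>\<close>: the element of \<open>InU\<^sup>*\<close> that moves a given \<open>v\<close> into it is
  unique and is found recursively, polynomially in the entries of \<open>v\<close>. So \<open>U\<^sup>*\<close> retracts onto an
  affine space, and the quotient is that space. In the same way \<open>Q'\<close> is a section of the set
  defining the Deligne--Lusztig variety modulo \<open>InU\<^sup>*\<close>; the inverse matrix is polynomial there, since
  \<open>det\<^bsup>q-1\<^esup> = \<plusminus>1\<close>.

  It remains to see that the affine space has the structure of the quotient of \<open>Q'\<close> by \<open>G\<^sub>n\<close>, which inseparability
  could spoil. As the group acts freely, an invariant fraction \<open>a / b\<close> equals \<open>Tr(m a) / Tr(m b)\<close> with \<open>m\<close>
  vanishing at all points of a fibre but one, so it is enough that the trace, i.e. the sum over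
  the fibre, is a polynomial in the \<open>c\<^sub>i\<close>. Since \<open>\<plusminus>det\<^bsup>q-1\<^esup>\<close> is the indicator function of independence,
  the trace is a sum over all \<open>n\<close>-tuples of roots, and for a monomial this is a product of power sums
  of the roots.
\<close>

section \<open>Spaces with functions\<close>

text \<open>Products make the system of nonvanishing loci closed under finite intersections, which
  is what turns it into a basis. The identities are only required on \<open>S\<close>, because those
  for \<open>salg\<close> hold at characters and not at arbitrary maps.\<close>

definition mult_stable :: "'a set \<Rightarrow> ('a \<Rightarrow> 'k::field) set \<Rightarrow> bool" where
  "mult_stable S A \<longleftrightarrow> (\<exists>c\<in>A. \<forall>x\<in>S. c x = 1) \<and>
     (\<forall>a\<in>A. \<forall>b\<in>A. \<exists>c\<in>A. \<forall>x\<in>S. c x = a x * b x)"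

lemma mult_stable_mult:
  assumes "mult_stable S A" "a \<in> A" "b \<in> A"
  obtains c where "c \<in> A" "\<And>x. x \<in> S \<Longrightarrow> c x = a x * b x"
  using assms unfolding mult_stable_def by blast

text \<open>The generated topology arises by finite intersections and unions. The intersection of
  two loci is the locus of the product, so every open set is already a union of basic ones.\<close>

lemma openin_fspace_of:
  assumes A: "mult_stable S A"
  shows "openin (zariski (fspace_of S A)) U \<longleftrightarrow>
    U \<subseteq> S \<and> (\<forall>x\<in>U. \<exists>a\<in>A. a x \<noteq> 0 \<and> {y\<in>S. a y \<noteq> 0} \<subseteq> U)"
proof -
  let ?B = "{{x \<in> S. a x \<noteq> 0} |a. a \<in> A}"
  have z: "openin (zariski (fspace_of S A)) U \<longleftrightarrow> generate_topology_on ?B U" for U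
    by (simp add: fspace_of_def Let_def openin_topology_generated_by_iff)
  have "U \<subseteq> S \<and> (\<forall>x\<in>U. \<exists>a\<in>A. a x \<noteq> 0 \<and> {y\<in>S. a y \<noteq> 0} \<subseteq> U)"
    if "generate_topology_on ?B U" for U
    using that
  proof induct
    case Empty
    then show ?case by simp
  next
    case (Int U V)
    have "\<exists>c\<in>A. c x \<noteq> 0 \<and> {y\<in>S. c y \<noteq> 0} \<subseteq> U \<inter> V" if x: "x \<in> U \<inter> V" for x
    proof -
      obtain a b where a: "a \<in> A" "a x \<noteq> 0" "{y\<in>S. a y \<noteq> 0} \<subseteq> U"
        and b: "b \<in> A" "b x \<noteq> 0" "{y\<in>S. b y \<noteq> 0} \<subseteq> V"
        using Int x by blast
      obtain c where "c \<in> A" "\<And>x. x \<in> S \<Longrightarrow> c x = a x * b x"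
        using mult_stable_mult[OF A a(1) b(1)] by blast
      then show ?thesis using a b x Int by (intro bexI[of _ c]) auto
    qed
    then show ?case using Int by blast
  next
    case (UN K)
    have "\<exists>a\<in>A. a x \<noteq> 0 \<and> {y\<in>S. a y \<noteq> 0} \<subseteq> \<Union>K" if "k \<in> K" "x \<in> k" for x k
      using UN(2)[OF that(1)] that by (meson Sup_upper subset_trans)
    then show ?case using UN(2) by blast
  next
    case (Basis s)
    then show ?case by auto
  qed
  moreover have "generate_topology_on ?B U"
    if U: "U \<subseteq> S \<and> (\<forall>x\<in>U. \<exists>a\<in>A. a x \<noteq> 0 \<and> {y\<in>S. a y \<noteq> 0} \<subseteq> U)"
  proof -
    have "U = \<Union>{W \<in> ?B. W \<subseteq> U}"
    proof
      show "U \<subseteq> \<Union>{W \<in> ?B. W \<subseteq> U}"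
      proof
        fix x assume x: "x \<in> U"
        then obtain a where a: "a \<in> A" "a x \<noteq> 0" "{y\<in>S. a y \<noteq> 0} \<subseteq> U" using U by blast
        moreover have "x \<in> {y\<in>S. a y \<noteq> 0}" using a x U by blast
        ultimately show "x \<in> \<Union>{W \<in> ?B. W \<subseteq> U}" by blast
      qed
    qed blast
    moreover have "generate_topology_on ?B (\<Union>{W \<in> ?B. W \<subseteq> U})"
      by (rule generate_topology_on.UN) (auto intro: generate_topology_on.Basis)
    ultimately show ?thesis by simp
  qed
  ultimately show ?thesis unfolding z by (rule iffI)
qed

lemma topspace_fspace_of:
  assumes "mult_stable S A"
  shows "topspace (zariski (fspace_of S A)) = S"
proof -
  obtain c where "c \<in> A" "\<forall>x\<in>S. c x = 1" using assms unfolding mult_stable_def by blast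
  then have "openin (zariski (fspace_of S A)) S"
    unfolding openin_fspace_of[OF assms] by (auto intro!: bexI[of _ c])
  moreover have "topspace (zariski (fspace_of S A)) \<subseteq> S"
    using openin_topspace[of "zariski (fspace_of S A)"] unfolding openin_fspace_of[OF assms] by blast
  ultimately show ?thesis using openin_subset by blast
qed

text \<open>The neighbourhood in the definition can be taken to be the locus of the denominator
  itself: multiply numerator and denominator by some \<open>d\<close> whose locus contains the point
  and lies in the neighbourhood.\<close>

lemma regular_fspace_of:
  assumes A: "mult_stable S A"
  shows "regular (fspace_of S A) U f \<longleftrightarrow>
    U \<subseteq> S \<and> (\<forall>x\<in>U. \<exists>a\<in>A. \<exists>b\<in>A. b x \<noteq> 0 \<and> {y\<in>S. b y \<noteq> 0} \<subseteq> U \<and>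
       (\<forall>y\<in>S. b y \<noteq> 0 \<longrightarrow> f y = a y / b y))" (is "?L = ?R")
proof -
  note o = openin_fspace_of[OF A]
  have r: "regular (fspace_of S A) U f \<longleftrightarrow>
     (\<forall>x\<in>U. \<exists>V a b. openin (zariski (fspace_of S A)) V \<and> x \<in> V \<and> V \<subseteq> U \<and> a \<in> A \<and> b \<in> A \<and>
                    (\<forall>y\<in>V. b y \<noteq> 0 \<and> f y = a y / b y))"
    by (simp add: fspace_of_def Let_def)
  show ?thesis
  proof
    assume L: ?L
    have "x \<in> S \<and> (\<exists>a\<in>A. \<exists>b\<in>A. b x \<noteq> 0 \<and> {y\<in>S. b y \<noteq> 0} \<subseteq> U \<and>
       (\<forall>y\<in>S. b y \<noteq> 0 \<longrightarrow> f y = a y / b y))" if x: "x \<in> U" for x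
    proof -
      obtain V a b where V: "openin (zariski (fspace_of S A)) V" "x \<in> V" "V \<subseteq> U" "a \<in> A" "b \<in> A"
        "\<And>y. y \<in> V \<Longrightarrow> b y \<noteq> 0 \<and> f y = a y / b y" using L x unfolding r by meson
      then obtain d where d: "d \<in> A" "d x \<noteq> 0" "{y\<in>S. d y \<noteq> 0} \<subseteq> V" unfolding o by blast
      obtain a' where a': "a' \<in> A" "\<And>x. x \<in> S \<Longrightarrow> a' x = a x * d x"
        using mult_stable_mult[OF A V(4) d(1)] by blast
      obtain b' where b': "b' \<in> A" "\<And>x. x \<in> S \<Longrightarrow> b' x = b x * d x"
        using mult_stable_mult[OF A V(5) d(1)] by blast
      have xS: "x \<in> S" using V(1,2) unfolding o by blast
      have "b' x \<noteq> 0" using b' V d xS by simp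
      moreover have "{y\<in>S. b' y \<noteq> 0} \<subseteq> U" using d V b' by auto
      moreover have "f y = a' y / b' y" if "y \<in> S" "b' y \<noteq> 0" for y
      proof -
        have "d y \<noteq> 0" using that b' by auto
        then show ?thesis using d(3) V(6)[of y] a' b' that by auto
      qed
      ultimately show ?thesis using a' b' xS by blast
    qed
    then show ?R by blast
  next
    assume R: ?R
    show ?L unfolding r
    proof
      fix x assume x: "x \<in> U"
      then obtain a b where ab: "a \<in> A" "b \<in> A" "b x \<noteq> 0" "{y\<in>S. b y \<noteq> 0} \<subseteq> U"
        "\<forall>y\<in>S. b y \<noteq> 0 \<longrightarrow> f y = a y / b y" using R by blast
      then show "\<exists>V a b. openin (zariski (fspace_of S A)) V \<and> x \<in> V \<and> V \<subseteq> U \<and> a \<in> A \<and> b \<in> A \<and>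
                    (\<forall>y\<in>V. b y \<noteq> 0 \<and> f y = a y / b y)"
        using x R by (intro exI[of _ "{y\<in>S. b y \<noteq> 0}"] exI[of _ a] exI[of _ b]) (auto simp: o)
    qed
  qed
qed

text \<open>The record \<open>fspace\<close> does not force regularity on \<open>U\<close> to depend
  only on the values on \<open>U\<close>. This property is used whenever a function is transported
  through a map that is inverted only on the points of a space.\<close>

definition fspace_local :: "('a, 'k) fspace \<Rightarrow> bool" where
  "fspace_local X \<longleftrightarrow> (\<forall>U f g. U \<subseteq> topspace (zariski X) \<longrightarrow> (\<forall>x\<in>U. f x = g x) \<longrightarrow>
     regular X U f \<longrightarrow> regular X U g)"

lemma fspace_local_of:
  assumes "mult_stable S A"
  shows "fspace_local (fspace_of S A)"
  unfolding fspace_local_def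
proof (intro allI impI)
  fix U and f g :: "'a \<Rightarrow> 'b"
  assume fg: "\<forall>x\<in>U. f x = g x" and r: "regular (fspace_of S A) U f"
  have U: "U \<subseteq> S" using r unfolding regular_fspace_of[OF assms] by blast
  have "\<exists>a\<in>A. \<exists>b\<in>A. b x \<noteq> 0 \<and> {y\<in>S. b y \<noteq> 0} \<subseteq> U \<and>
       (\<forall>y\<in>S. b y \<noteq> 0 \<longrightarrow> g y = a y / b y)" if x: "x \<in> U" for x
  proof -
    obtain a b where ab: "a \<in> A" "b \<in> A" "b x \<noteq> 0" "{y\<in>S. b y \<noteq> 0} \<subseteq> U"
      "\<forall>y\<in>S. b y \<noteq> 0 \<longrightarrow> f y = a y / b y"
      using r x unfolding regular_fspace_of[OF assms] by blast
    have "g y = a y / b y" if "y \<in> S" "b y \<noteq> 0" for y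
    proof -
      have "y \<in> U" using ab(4) that by blast
      then show ?thesis using ab(5) fg that by metis
    qed
    then show ?thesis using ab by blast
  qed
  then show "regular (fspace_of S A) U g"
    unfolding regular_fspace_of[OF assms] using U by blast
qed

section \<open>Quotients and isomorphisms of spaces with functions\<close>

lemma openin_fspace_quotient:
  "openin (zariski (fspace_quotient X \<pi>)) U \<longleftrightarrow>
    U \<subseteq> \<pi> ` topspace (zariski X) \<and> openin (zariski X) {x \<in> topspace (zariski X). \<pi> x \<in> U}"
  by (simp add: fspace_quotient_def istopology_fspace_quotient)

lemma topspace_fspace_quotient:
  "topspace (zariski (fspace_quotient X \<pi>)) = \<pi> ` topspace (zariski X)"
proof
  have "{x \<in> topspace (zariski X). \<pi> x \<in> \<pi> ` topspace (zariski X)} = topspace (zariski X)" by auto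
  then have "openin (zariski (fspace_quotient X \<pi>)) (\<pi> ` topspace (zariski X))"
    unfolding openin_fspace_quotient by simp
  then show "\<pi> ` topspace (zariski X) \<subseteq> topspace (zariski (fspace_quotient X \<pi>))"
    by (rule openin_subset)
  show "topspace (zariski (fspace_quotient X \<pi>)) \<subseteq> \<pi> ` topspace (zariski X)"
    using openin_topspace[of "zariski (fspace_quotient X \<pi>)"] unfolding openin_fspace_quotient by blast
qed

lemma regular_fspace_quotient:
  "regular (fspace_quotient X \<pi>) U f \<longleftrightarrow> regular X {x \<in> topspace (zariski X). \<pi> x \<in> U} (f \<circ> \<pi>)"
  by (simp add: fspace_quotient_def)

lemma fspace_local_quotient:
  assumes "fspace_local X"
  shows "fspace_local (fspace_quotient X \<pi>)"
  unfolding fspace_local_def regular_fspace_quotient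
proof (intro allI impI)
  fix U f g
  assume "\<forall>x\<in>U. f x = g x" "regular X {x \<in> topspace (zariski X). \<pi> x \<in> U} (f \<circ> \<pi>)"
  then show "regular X {x \<in> topspace (zariski X). \<pi> x \<in> U} (g \<circ> \<pi>)"
    using assms[unfolded fspace_local_def, rule_format,
      of "{x \<in> topspace (zariski X). \<pi> x \<in> U}" "f \<circ> \<pi>" "g \<circ> \<pi>"] by auto
qed

lemma homeomorphic_map_iff_openin:
  "homeomorphic_map X Y f \<longleftrightarrow> bij_betw f (topspace X) (topspace Y) \<and>
     (\<forall>U. U \<subseteq> topspace Y \<longrightarrow> (openin X {x \<in> topspace X. f x \<in> U} \<longleftrightarrow> openin Y U))"
  unfolding homeomorphic_map_def quotient_map_def bij_betw_def by blast

lemma fspace_iso_id: "fspace_iso id X X"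
  unfolding fspace_iso_def homeomorphic_map_iff_openin
proof (intro conjI allI impI)
  fix U f assume U: "openin (zariski X) U"
  then have "{x \<in> topspace (zariski X). id x \<in> U} = U" using openin_subset by fastforce
  then show "regular X U f = regular X {x \<in> topspace (zariski X). id x \<in> U} (f \<circ> id)" by simp
next
  fix U assume "U \<subseteq> topspace (zariski X)"
  then have "{x \<in> topspace (zariski X). id x \<in> U} = U" by auto
  then show "openin (zariski X) {x \<in> topspace (zariski X). id x \<in> U} = openin (zariski X) U" by simp
qed simp

text \<open>Both spaces are compared with a common model \<open>Z\<close>: on points
  \<open>f\<close> is \<open>b\<close> followed by the inverse of \<open>a\<close>, and open sets
  and regular functions are carried over through \<open>Z\<close>. This gives isomorphisms between
  quotients that are identified with the same space.\<close>

lemma fspace_iso_cancel: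
  assumes a: "fspace_iso a X Z" and b: "fspace_iso b W Z"
    and X: "fspace_local X" and W: "fspace_local W"
    and maps: "\<And>w. w \<in> topspace (zariski W) \<Longrightarrow> f w \<in> topspace (zariski X) \<and> a (f w) = b w"
  shows "fspace_iso f W X"
proof -
  let ?X = "topspace (zariski X)" and ?W = "topspace (zariski W)" and ?Z = "topspace (zariski Z)"
  have ba: "bij_betw a ?X ?Z" and bb: "bij_betw b ?W ?Z"
    using a b unfolding fspace_iso_def homeomorphic_map_iff_openin by auto
  have oa: "\<And>U. U \<subseteq> ?Z \<Longrightarrow> openin (zariski X) {x \<in> ?X. a x \<in> U} = openin (zariski Z) U"
    and ob: "\<And>U. U \<subseteq> ?Z \<Longrightarrow> openin (zariski W) {x \<in> ?W. b x \<in> U} = openin (zariski Z) U"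
    using a b unfolding fspace_iso_def homeomorphic_map_iff_openin by auto
  have inj: "x = y" if "x \<in> ?X" "y \<in> ?X" "a x = a y" for x y
    using ba that unfolding bij_betw_def inj_on_def by blast
  have bf: "bij_betw f ?W ?X"
    unfolding bij_betw_def
  proof
    show "inj_on f ?W" using maps bb unfolding inj_on_def bij_betw_def by metis
    have "x \<in> f ` ?W" if x: "x \<in> ?X" for x
    proof -
      have "a x \<in> b ` ?W" using ba bb x unfolding bij_betw_def by blast
      then obtain w where "w \<in> ?W" "a x = b w" by blast
      then show ?thesis using maps[of w] inj[OF x, of "f w"] by (metis imageI)
    qed
    then show "f ` ?W = ?X" using maps by blast
  qed
  have pre: "{x \<in> ?X. a x \<in> a ` U} = U" "{w \<in> ?W. b w \<in> a ` U} = {w \<in> ?W. f w \<in> U}"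
    "a ` U \<subseteq> ?Z" if U: "U \<subseteq> ?X" for U
  proof -
    show 1: "{x \<in> ?X. a x \<in> a ` U} = U" using U inj by blast
    show "{w \<in> ?W. b w \<in> a ` U} = {w \<in> ?W. f w \<in> U}"
    proof (intro Collect_cong conj_cong refl)
      fix w assume w: "w \<in> ?W"
      have "b w \<in> a ` U \<longleftrightarrow> f w \<in> {x \<in> ?X. a x \<in> a ` U}" using maps[OF w] by simp
      then show "b w \<in> a ` U \<longleftrightarrow> f w \<in> U" unfolding 1 .
    qed
    show "a ` U \<subseteq> ?Z" using ba U unfolding bij_betw_def by blast
  qed
  have o: "openin (zariski W) {x \<in> ?W. f x \<in> U} = openin (zariski X) U" if U: "U \<subseteq> ?X" for U
    using oa[of "a ` U"] ob[of "a ` U"] pre[OF U] by simp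
  have "regular X U h \<longleftrightarrow> regular W {x \<in> ?W. f x \<in> U} (h \<circ> f)" if U: "openin (zariski X) U" for U h
  proof -
    have US: "U \<subseteq> ?X" using U openin_subset by blast
    \<comment> \<open>The function \<open>h\<close> is carried to \<open>Z\<close> by the inverse of
      \<open>a\<close>. It agrees with \<open>g \<circ> a\<close> only on the points of
      \<open>X\<close>, which is where locality enters.\<close>
    define g where "g = h \<circ> inv_into ?X a"
    have g: "g (a x) = h x" if "x \<in> ?X" for x
      using ba that by (simp add: g_def bij_betw_def)
    have oZ: "openin (zariski Z) (a ` U)" using oa[of "a ` U"] pre[OF US] U by simp
    have "regular X U h \<longleftrightarrow> regular X U (g \<circ> a)"
      using X US g unfolding fspace_local_def by (metis comp_apply subsetD)
    also have "\<dots> \<longleftrightarrow> regular Z (a ` U) g"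
      using a oZ pre[OF US] unfolding fspace_iso_def by simp
    also have "\<dots> \<longleftrightarrow> regular W {x \<in> ?W. f x \<in> U} (g \<circ> b)"
      using b oZ pre[OF US] unfolding fspace_iso_def by simp
    also have "\<dots> \<longleftrightarrow> regular W {x \<in> ?W. f x \<in> U} (h \<circ> f)"
    proof -
      have e: "\<forall>x\<in>{x \<in> ?W. f x \<in> U}. (g \<circ> b) x = (h \<circ> f) x" using maps g by (metis comp_apply mem_Collect_eq)
      show ?thesis using W e unfolding fspace_local_def by (metis (no_types, lifting) mem_Collect_eq subsetI)
    qed
    finally show ?thesis .
  qed
  then show ?thesis using bf o unfolding fspace_iso_def homeomorphic_map_iff_openin by blast
qed

section \<open>Descent of functions along a map\<close>

lemma factor_through:
  assumes "\<And>x y. x \<in> S \<Longrightarrow> y \<in> S \<Longrightarrow> \<pi> x = \<pi> y \<Longrightarrow> r x = r y"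
  obtains \<rho> where "\<And>x. x \<in> S \<Longrightarrow> \<rho> (\<pi> x) = r x"
proof
  fix x assume "x \<in> S"
  then show "(r \<circ> inv_into S \<pi>) (\<pi> x) = r x"
    using assms[of "inv_into S \<pi> (\<pi> x)" x] by (simp add: inv_into_into f_inv_into_f)
qed

text \<open>
  Here \<open>h\<close> is the common value of \<open>a / b\<close> along a fibre of \<open>r\<close>. The relation is written without division, as
  \<open>b\<close> may vanish at some points of the fibre.
\<close>

definition descends :: "'a set \<Rightarrow> ('a \<Rightarrow> 'k::field) set \<Rightarrow> 'b set \<Rightarrow> ('b \<Rightarrow> 'k) set \<Rightarrow>
    ('a \<Rightarrow> 'b) \<Rightarrow> 'a \<Rightarrow> 'b \<Rightarrow> bool" where
  "descends S A S' A' r x y \<longleftrightarrow> (\<forall>a\<in>A. \<forall>b\<in>A. b x \<noteq> 0 \<longrightarrow>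
      (\<exists>a'\<in>A'. \<exists>b'\<in>A'. b' y \<noteq> 0 \<and> (\<forall>y'\<in>S'. b' y' \<noteq> 0 \<longrightarrow> (\<exists>z\<in>S. r z = y' \<and> b z \<noteq> 0)) \<and>
        (\<forall>y'\<in>S'. \<forall>h. (\<forall>z\<in>S. r z = y' \<longrightarrow> a z = h * b z) \<longrightarrow> a' y' = h * b' y')))"

lemma descendsE:
  assumes "descends S A S' A' r x y" "a \<in> A" "b \<in> A" "b x \<noteq> 0"
  obtains a' b' where "a' \<in> A'" "b' \<in> A'" "b' y \<noteq> 0"
    "\<And>y'. y' \<in> S' \<Longrightarrow> b' y' \<noteq> 0 \<Longrightarrow> \<exists>z\<in>S. r z = y' \<and> b z \<noteq> 0"
    "\<And>y' h. y' \<in> S' \<Longrightarrow> (\<And>z. z \<in> S \<Longrightarrow> r z = y' \<Longrightarrow> a z = h * b z) \<Longrightarrow> a' y' = h * b' y'"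
proof -
  from assms(1)[unfolded descends_def, rule_format, OF assms(2-4)]
  obtain a' b' where "a' \<in> A'" "b' \<in> A'" "b' y \<noteq> 0"
    and 1: "\<forall>y'\<in>S'. b' y' \<noteq> 0 \<longrightarrow> (\<exists>z\<in>S. r z = y' \<and> b z \<noteq> 0)"
    and 2: "\<forall>y'\<in>S'. \<forall>h. (\<forall>z\<in>S. r z = y' \<longrightarrow> a z = h * b z) \<longrightarrow> a' y' = h * b' y'"
    by (elim bexE conjE)
  show thesis
  proof (rule that[of a' b'])
    fix y' h assume "y' \<in> S'" "\<And>z. z \<in> S \<Longrightarrow> r z = y' \<Longrightarrow> a z = h * b z"
    then show "a' y' = h * b' y'" by (intro 2[rule_format])
  qed (use \<open>a' \<in> A'\<close> \<open>b' \<in> A'\<close> \<open>b' y \<noteq> 0\<close> 1 in blast)+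
qed

text \<open>Bijectivity holds because \<open>\<pi>\<close> and \<open>r\<close> have the same
  fibres. The assumption \<open>pull\<close> makes \<open>r\<close> a morphism;
  \<open>descends\<close>, demanded at one point of each fibre, gives the converse for open sets
  that are unions of fibres and for functions constant on fibres.\<close>

lemma fspace_quotient_iso:
  assumes A: "mult_stable S A" and A': "mult_stable S' A'"
    and r: "r ` S = S'"
    and pull: "\<And>a'. a' \<in> A' \<Longrightarrow> \<exists>a\<in>A. \<forall>x\<in>S. a x = a' (r x)"
    and \<pi>: "\<And>x y. x \<in> S \<Longrightarrow> y \<in> S \<Longrightarrow> \<pi> x = \<pi> y \<longleftrightarrow> r x = r y"
    and \<rho>: "\<And>x. x \<in> S \<Longrightarrow> \<rho> (\<pi> x) = r x"
    and desc: "\<And>y. y \<in> S' \<Longrightarrow> \<exists>x\<in>S. r x = y \<and> descends S A S' A' r x y"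
  shows "fspace_iso \<rho> (fspace_quotient (fspace_of S A) \<pi>) (fspace_of S' A')"
proof -
  note to = topspace_fspace_of[OF A] topspace_fspace_of[OF A'] topspace_fspace_quotient
  have bij: "bij_betw \<rho> (\<pi> ` S) S'"
    unfolding bij_betw_def inj_on_def using r \<rho> \<pi> by (force simp: image_image)
  have pre: "{x \<in> S. \<pi> x \<in> {w \<in> \<pi> ` S. \<rho> w \<in> U}} = {x \<in> S. r x \<in> U}" for U
    using \<pi> \<rho> r by (force simp: image_iff)
  have op: "openin (zariski (fspace_of S A)) {x \<in> S. r x \<in> U} \<longleftrightarrow> openin (zariski (fspace_of S' A')) U"
    if U: "U \<subseteq> S'" for U
  proof
    assume L: "openin (zariski (fspace_of S A)) {x \<in> S. r x \<in> U}"
    have "\<exists>b'\<in>A'. b' y \<noteq> 0 \<and> {y\<in>S'. b' y \<noteq> 0} \<subseteq> U" if y: "y \<in> U" for y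
    proof -
      obtain x where x: "x \<in> S" "r x = y" and d: "descends S A S' A' r x y"
        using desc[of y] y U by blast
      obtain b where b: "b \<in> A" "b x \<noteq> 0" "{y\<in>S. b y \<noteq> 0} \<subseteq> {x \<in> S. r x \<in> U}"
        using L x y unfolding openin_fspace_of[OF A] by blast
      obtain b' where b': "b'\<in>A'" "b' y \<noteq> 0"
        "\<And>y'. y' \<in> S' \<Longrightarrow> b' y' \<noteq> 0 \<Longrightarrow> \<exists>z\<in>S. r z = y' \<and> b z \<noteq> 0"
        using descendsE[OF d b(1,1,2)] by metis
      then have "{y\<in>S'. b' y \<noteq> 0} \<subseteq> U" using b by blast
      then show ?thesis using b' by blast
    qed
    then show "openin (zariski (fspace_of S' A')) U" unfolding openin_fspace_of[OF A'] using U by blast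
  next
    assume R: "openin (zariski (fspace_of S' A')) U"
    have "\<exists>a\<in>A. a x \<noteq> 0 \<and> {y\<in>S. a y \<noteq> 0} \<subseteq> {x \<in> S. r x \<in> U}" if x: "x \<in> S" "r x \<in> U" for x
    proof -
      obtain a' where a': "a' \<in> A'" "a' (r x) \<noteq> 0" "{y\<in>S'. a' y \<noteq> 0} \<subseteq> U"
        using R x unfolding openin_fspace_of[OF A'] by blast
      then obtain a where "a \<in> A" "\<forall>x\<in>S. a x = a' (r x)" using pull by blast
      then show ?thesis using a' x r by (intro bexI[of _ a]) auto
    qed
    then show "openin (zariski (fspace_of S A)) {x \<in> S. r x \<in> U}"
      unfolding openin_fspace_of[OF A] by blast
  qed
  have hom: "homeomorphic_map (zariski (fspace_quotient (fspace_of S A) \<pi>)) (zariski (fspace_of S' A')) \<rho>"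
    unfolding homeomorphic_map_iff_openin to
  proof (intro conjI bij allI impI)
    fix U assume U: "U \<subseteq> S'"
    show "openin (zariski (fspace_quotient (fspace_of S A) \<pi>)) {w \<in> \<pi> ` S. \<rho> w \<in> U} =
         openin (zariski (fspace_of S' A')) U"
      unfolding openin_fspace_quotient to pre op[OF U] by blast
  qed
  have "regular (fspace_of S' A') U f \<longleftrightarrow> regular (fspace_of S A) {x \<in> S. r x \<in> U} (f \<circ> \<rho> \<circ> \<pi>)"
    if Uo: "openin (zariski (fspace_of S' A')) U" for U f
  proof -
    have U: "U \<subseteq> S'" using Uo unfolding openin_fspace_of[OF A'] by blast
    have "regular (fspace_of S A) {x \<in> S. r x \<in> U} (f \<circ> \<rho> \<circ> \<pi>) \<longleftrightarrow>
          regular (fspace_of S A) {x \<in> S. r x \<in> U} (f \<circ> r)"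
      using fspace_local_of[OF A] \<rho> unfolding fspace_local_def to
      by (smt (verit) comp_apply mem_Collect_eq subsetI)
    moreover have "regular (fspace_of S' A') U f"
      if L: "regular (fspace_of S A) {x \<in> S. r x \<in> U} (f \<circ> r)"
    proof -
      have "\<exists>a'\<in>A'. \<exists>b'\<in>A'. b' y \<noteq> 0 \<and> {y\<in>S'. b' y \<noteq> 0} \<subseteq> U \<and>
        (\<forall>y\<in>S'. b' y \<noteq> 0 \<longrightarrow> f y = a' y / b' y)" if y: "y \<in> U" for y
      proof -
        obtain x where x: "x \<in> S" "r x = y" and d: "descends S A S' A' r x y"
          using desc[of y] y U by blast
        obtain a b where ab: "a \<in> A" "b \<in> A" "b x \<noteq> 0" "{y\<in>S. b y \<noteq> 0} \<subseteq> {x \<in> S. r x \<in> U}"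
          "\<forall>y\<in>S. b y \<noteq> 0 \<longrightarrow> f (r y) = a y / b y"
          using L x y unfolding regular_fspace_of[OF A] by auto
        \<comment> \<open>The fraction \<open>a / b\<close> is rewritten as
          \<open>(a b) / (b b)\<close>. Then numerator equals \<open>f\<close> times denominator at
          every point of the fibre, including those where \<open>b\<close> vanishes, as
          \<open>descends\<close> requires.\<close>
        obtain c where c: "c \<in> A" "\<And>x. x \<in> S \<Longrightarrow> c x = a x * b x"
          using mult_stable_mult[OF A ab(1,2)] by blast
        obtain e where e: "e \<in> A" "\<And>x. x \<in> S \<Longrightarrow> e x = b x * b x"
          using mult_stable_mult[OF A ab(2,2)] by blast
        have "e x \<noteq> 0" using e x ab by simp
        then obtain a' b' where b': "a' \<in> A'" "b'\<in>A'" "b' y \<noteq> 0"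
          "\<And>y'. y' \<in> S' \<Longrightarrow> b' y' \<noteq> 0 \<Longrightarrow> \<exists>z\<in>S. r z = y' \<and> e z \<noteq> 0"
          "\<And>y' h. y' \<in> S' \<Longrightarrow> (\<And>z. z \<in> S \<Longrightarrow> r z = y' \<Longrightarrow> c z = h * e z) \<Longrightarrow> a' y' = h * b' y'"
          using descendsE[OF d c(1) e(1)] by metis
        have "{y\<in>S'. b' y \<noteq> 0} \<subseteq> U" using b' ab e by fastforce
        moreover have "f y' = a' y' / b' y'" if y': "y' \<in> S'" "b' y' \<noteq> 0" for y'
        proof -
          have "c z = f y' * e z" if "z \<in> S" "r z = y'" for z
            using that c e ab(5) by (cases "b z = 0") (auto simp: field_simps)
          then have "a' y' = f y' * b' y'" using b'(5) y' by blast
          then show ?thesis using y' by simp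
        qed
        ultimately show ?thesis using b' by blast
      qed
      then show ?thesis unfolding regular_fspace_of[OF A'] using U by blast
    qed
    moreover have "regular (fspace_of S A) {x \<in> S. r x \<in> U} (f \<circ> r)"
      if R: "regular (fspace_of S' A') U f"
    proof -
      have "\<exists>a\<in>A. \<exists>b\<in>A. b x \<noteq> 0 \<and> {y\<in>S. b y \<noteq> 0} \<subseteq> {x \<in> S. r x \<in> U} \<and>
        (\<forall>y\<in>S. b y \<noteq> 0 \<longrightarrow> (f \<circ> r) y = a y / b y)" if x: "x \<in> S" "r x \<in> U" for x
      proof -
        obtain a' b' where ab: "a' \<in> A'" "b' \<in> A'" "b' (r x) \<noteq> 0" "{y\<in>S'. b' y \<noteq> 0} \<subseteq> U"
          "\<forall>y\<in>S'. b' y \<noteq> 0 \<longrightarrow> f y = a' y / b' y"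
          using R x unfolding regular_fspace_of[OF A'] by blast
        obtain a where "a \<in> A" "\<forall>x\<in>S. a x = a' (r x)" using pull ab by blast
        moreover obtain b where "b \<in> A" "\<forall>x\<in>S. b x = b' (r x)" using pull ab by blast
        ultimately show ?thesis using ab x r by (intro bexI[of _ a] bexI[of _ b]) auto
      qed
      then show ?thesis unfolding regular_fspace_of[OF A] by auto
    qed
    ultimately show ?thesis by blast
  qed
  then show ?thesis
    using hom unfolding fspace_iso_def regular_fspace_quotient to pre by (simp add: comp_assoc)
qed

section \<open>Polynomials and polynomial functions\<close>

lemma mpoly_eval_superset:
  assumes "finite K" "Poly_Mapping.keys P \<subseteq> K"
  shows "mpoly_eval P a = (\<Sum>m\<in>K. Poly_Mapping.lookup P m *
     (\<Prod>v\<in>Poly_Mapping.keys m. a v ^ Poly_Mapping.lookup m v))"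
  unfolding mpoly_eval_def using assms
  by (intro sum.mono_neutral_left) (auto simp: in_keys_iff)

lemma mpoly_eval_add: "mpoly_eval (P + Q) a = mpoly_eval P a + mpoly_eval Q a"
proof -
  let ?K = "Poly_Mapping.keys P \<union> Poly_Mapping.keys Q"
  have k: "Poly_Mapping.keys (P + Q) \<subseteq> ?K" by (rule keys_add)
  show ?thesis
    by (simp add: mpoly_eval_superset[of ?K] k lookup_add algebra_simps sum.distrib)
qed

lemma mpoly_eval_single:
  "mpoly_eval (Poly_Mapping.single m c) a =
     c * (\<Prod>v\<in>Poly_Mapping.keys m. a v ^ Poly_Mapping.lookup m v)"
  by (simp add: mpoly_eval_def)

lemma monomial_eval_superset:
  fixes a :: "'v \<Rightarrow> 'k::comm_semiring_1"
  assumes "finite K" "Poly_Mapping.keys m \<subseteq> K"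
  shows "(\<Prod>v\<in>Poly_Mapping.keys m. a v ^ Poly_Mapping.lookup m v) =
    (\<Prod>v\<in>K. a v ^ Poly_Mapping.lookup m v)"
  using assms by (intro prod.mono_neutral_left) (auto simp: in_keys_iff)

lemma monomial_eval_add:
  fixes a :: "'v \<Rightarrow> 'k::comm_semiring_1"
  shows "(\<Prod>v\<in>Poly_Mapping.keys (m + m'). a v ^ Poly_Mapping.lookup (m + m') v) =
    (\<Prod>v\<in>Poly_Mapping.keys m. a v ^ Poly_Mapping.lookup m v) *
    (\<Prod>v\<in>Poly_Mapping.keys m'. a v ^ Poly_Mapping.lookup m' v)"
proof -
  let ?K = "Poly_Mapping.keys m \<union> Poly_Mapping.keys m'"
  have k: "Poly_Mapping.keys (m + m') \<subseteq> ?K" by (rule keys_add)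
  show ?thesis
    unfolding monomial_eval_superset[OF _ k, simplified]
      monomial_eval_superset[of ?K m a, simplified] monomial_eval_superset[of ?K m' a, simplified]
    by (simp add: lookup_add power_add prod.distrib)
qed

text \<open>Setting a coefficient that was zero amounts to adding a single term, so this is
  induction on the terms. The set \<open>K\<close> of admissible monomials lets a restriction on the
  variables pass to every term.\<close>

lemma mpoly_induct [consumes 1, case_names monomial zero add]:
  fixes P :: "'m \<Rightarrow>\<^sub>0 'k::comm_monoid_add"
  assumes "Poly_Mapping.keys P \<subseteq> K"
    and mono: "\<And>m c. m \<in> K \<Longrightarrow> R (Poly_Mapping.single m c)" and zero: "R 0"
    and add: "\<And>P Q. R P \<Longrightarrow> R Q \<Longrightarrow> R (P + Q)"
  shows "R P"
  using assms(1)
proof (induct P rule: update_induct)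
  case const
  then show ?case using zero by simp
next
  case (update P m c)
  have e: "Poly_Mapping.update m c P = P + Poly_Mapping.single m c"
    using update(1)
    by (intro poly_mapping_eqI) (auto simp: lookup_update lookup_add lookup_single in_keys_iff when_def)
  show ?case
  proof (cases "c = 0")
    case True
    then show ?thesis using update e by simp
  next
    case False
    have "Poly_Mapping.keys (Poly_Mapping.update m c P) = insert m (Poly_Mapping.keys P)"
      using False by (simp add: keys_update)
    then show ?thesis using update mono add e by auto
  qed
qed

lemma mpoly_eval_zero [simp]: "mpoly_eval 0 a = 0"
  by (simp add: mpoly_eval_def)

text \<open>Both sides are additive in \<open>P\<close> and in \<open>Q\<close>, which reduces the
  claim to a product of two terms.\<close>

lemma mpoly_eval_mult:
  fixes P Q :: "('v \<Rightarrow>\<^sub>0 nat) \<Rightarrow>\<^sub>0 'k::comm_semiring_1"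
  shows "mpoly_eval (P * Q) a = mpoly_eval P a * mpoly_eval Q a"
proof -
  have single: "mpoly_eval (Poly_Mapping.single m c * Q) a = mpoly_eval (Poly_Mapping.single m c) a * mpoly_eval Q a" for m c
    using subset_UNIV[of "Poly_Mapping.keys Q"]
  proof (induct Q rule: mpoly_induct)
    case (monomial m' d)
    then show ?case by (simp add: mult_single mpoly_eval_single monomial_eval_add algebra_simps)
  qed (simp_all add: distrib_left mpoly_eval_add)
  show ?thesis
    using subset_UNIV[of "Poly_Mapping.keys P"]
    by (induct P rule: mpoly_induct) (simp_all add: single distrib_right mpoly_eval_add)
qed

section \<open>Variables, constants and polynomial functions\<close>

definition mpoly_var :: "'v \<Rightarrow> ('v \<Rightarrow>\<^sub>0 nat) \<Rightarrow>\<^sub>0 'k::comm_semiring_1" where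
  "mpoly_var v = Poly_Mapping.single (Poly_Mapping.single v 1) 1"

definition mpoly_const :: "'k \<Rightarrow> ('v \<Rightarrow>\<^sub>0 nat) \<Rightarrow>\<^sub>0 'k::comm_semiring_1" where
  "mpoly_const c = Poly_Mapping.single 0 c"

lemma mpoly_eval_var [simp]: "mpoly_eval (mpoly_var v) a = a v"
  by (simp add: mpoly_var_def mpoly_eval_single)

lemma mpoly_eval_const [simp]: "mpoly_eval (mpoly_const c) a = c"
  by (simp add: mpoly_const_def mpoly_eval_single)

lemma mpoly_vars_var: "mpoly_vars (mpoly_var v) \<subseteq> {v}"
  by (auto simp: mpoly_vars_def mpoly_var_def split: if_splits)

lemma mpoly_vars_const [simp]: "mpoly_vars (mpoly_const c) = {}"
  by (auto simp: mpoly_vars_def mpoly_const_def)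

lemma mpoly_vars_add: "mpoly_vars (P + Q) \<subseteq> mpoly_vars P \<union> mpoly_vars Q"
  using keys_add[of P Q] unfolding mpoly_vars_def by blast

lemma mpoly_vars_mult:
  fixes P Q :: "('v \<Rightarrow>\<^sub>0 nat) \<Rightarrow>\<^sub>0 'k::comm_semiring_1"
  shows "mpoly_vars (P * Q) \<subseteq> mpoly_vars P \<union> mpoly_vars Q"
proof
  fix v assume "v \<in> mpoly_vars (P * Q)"
  then obtain m where m: "m \<in> Poly_Mapping.keys (P * Q)" "v \<in> Poly_Mapping.keys m"
    unfolding mpoly_vars_def by blast
  then obtain a b where "m = a + b" "a \<in> Poly_Mapping.keys P" "b \<in> Poly_Mapping.keys Q"
    using keys_mult[of P Q] by blast
  then show "v \<in> mpoly_vars P \<union> mpoly_vars Q"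
    using m keys_add[of a b] unfolding mpoly_vars_def by blast
qed

lemma mpoly_eval_cong:
  assumes "mpoly_vars P \<subseteq> I" "\<And>i. i \<in> I \<Longrightarrow> a i = b i"
  shows "mpoly_eval P a = mpoly_eval P b"
  unfolding mpoly_eval_def
proof (intro sum.cong refl arg_cong2[where f = "(*)"] prod.cong)
  fix m v assume "m \<in> Poly_Mapping.keys P" "v \<in> Poly_Mapping.keys m"
  then have "v \<in> I" using assms(1) unfolding mpoly_vars_def by blast
  then show "a v ^ Poly_Mapping.lookup m v = b v ^ Poly_Mapping.lookup m v" using assms(2) by simp
qed

text \<open>The family \<open>X\<close> plays the role of a coordinate system: the entries of a
  matrix, or the parameters \<open>c\<close> of a normal form. Closure properties of this set of
  functions take the place of explicit polynomials.\<close>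

definition polyfun :: "'a set \<Rightarrow> ('a \<Rightarrow> 'v \<Rightarrow> 'k::comm_ring_1) \<Rightarrow> 'v set \<Rightarrow> ('a \<Rightarrow> 'k) set" where
  "polyfun S X I = {f. \<exists>P. mpoly_vars P \<subseteq> I \<and> (\<forall>x\<in>S. f x = mpoly_eval P (X x))}"

lemma polyfunI: "mpoly_vars P \<subseteq> I \<Longrightarrow> (\<And>x. x \<in> S \<Longrightarrow> f x = mpoly_eval P (X x)) \<Longrightarrow> f \<in> polyfun S X I"
  unfolding polyfun_def by blast

lemma polyfunE:
  assumes "f \<in> polyfun S X I"
  obtains P where "mpoly_vars P \<subseteq> I" "\<forall>x\<in>S. f x = mpoly_eval P (X x)"
  using assms unfolding polyfun_def by blast

lemma polyfun_cong: "f \<in> polyfun S X I \<Longrightarrow> (\<And>x. x \<in> S \<Longrightarrow> g x = f x) \<Longrightarrow> g \<in> polyfun S X I"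
  unfolding polyfun_def by auto

lemma polyfun_const: "(\<lambda>x. c) \<in> polyfun S X I"
  by (rule polyfunI[of "mpoly_const c"]) auto

lemma polyfun_coord: "i \<in> I \<Longrightarrow> (\<lambda>x. X x i) \<in> polyfun S X I"
  using mpoly_vars_var[of i] by (intro polyfunI[of "mpoly_var i"]) auto

lemma polyfun_add:
  assumes "f \<in> polyfun S X I" "g \<in> polyfun S X I"
  shows "(\<lambda>x. f x + g x) \<in> polyfun S X I"
proof -
  obtain P where "mpoly_vars P \<subseteq> I" "\<forall>x\<in>S. f x = mpoly_eval P (X x)"
    using assms(1) by (rule polyfunE)
  moreover obtain Q where "mpoly_vars Q \<subseteq> I" "\<forall>x\<in>S. g x = mpoly_eval Q (X x)"
    using assms(2) by (rule polyfunE)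
  ultimately show ?thesis
    using mpoly_vars_add[of P Q] by (intro polyfunI[of "P + Q"]) (auto simp: mpoly_eval_add)
qed

lemma polyfun_mult:
  assumes "f \<in> polyfun S X I" "g \<in> polyfun S X I"
  shows "(\<lambda>x. f x * g x) \<in> polyfun S X I"
proof -
  obtain P where "mpoly_vars P \<subseteq> I" "\<forall>x\<in>S. f x = mpoly_eval P (X x)"
    using assms(1) by (rule polyfunE)
  moreover obtain Q where "mpoly_vars Q \<subseteq> I" "\<forall>x\<in>S. g x = mpoly_eval Q (X x)"
    using assms(2) by (rule polyfunE)
  ultimately show ?thesis
    using mpoly_vars_mult[of P Q] by (intro polyfunI[of "P * Q"]) (auto simp: mpoly_eval_mult)
qed

lemma polyfun_diff:
  assumes "f \<in> polyfun S X I" "g \<in> polyfun S X I"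
  shows "(\<lambda>x. f x - g x) \<in> polyfun S X I"
  using polyfun_add[OF assms(1) polyfun_mult[OF polyfun_const[of "-1"] assms(2)]] by simp

lemma polyfun_uminus: "f \<in> polyfun S X I \<Longrightarrow> (\<lambda>x. - f x) \<in> polyfun S X I"
  using polyfun_mult[OF polyfun_const[of "-1"]] by fastforce

lemma polyfun_sum: "(\<And>j. j \<in> J \<Longrightarrow> f j \<in> polyfun S X I) \<Longrightarrow> (\<lambda>x. \<Sum>j\<in>J. f j x) \<in> polyfun S X I"
  by (induct J rule: infinite_finite_induct) (simp_all add: polyfun_const polyfun_add)

lemma polyfun_prod: "(\<And>j. j \<in> J \<Longrightarrow> f j \<in> polyfun S X I) \<Longrightarrow> (\<lambda>x. \<Prod>j\<in>J. f j x) \<in> polyfun S X I"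
  by (induct J rule: infinite_finite_induct) (simp_all add: polyfun_const polyfun_mult)

lemma polyfun_power: "f \<in> polyfun S X I \<Longrightarrow> (\<lambda>x. f x ^ k) \<in> polyfun S X I"
  by (induct k) (simp_all add: polyfun_const polyfun_mult)

lemma polyfun_eval:
  assumes "mpoly_vars P \<subseteq> J" "\<And>j. j \<in> J \<Longrightarrow> (\<lambda>x. Y x j) \<in> polyfun S X I"
  shows "(\<lambda>x. mpoly_eval P (Y x)) \<in> polyfun S X I"
  unfolding mpoly_eval_def
  using assms unfolding mpoly_vars_def
  by (intro polyfun_sum polyfun_mult polyfun_const polyfun_prod polyfun_power) blast

text \<open>A map \<open>r\<close> counts as a morphism as soon as its coordinates are polynomial
  functions; this is the pullback along it.\<close>

lemma polyfun_comp:
  assumes "f \<in> polyfun T Y J" "\<And>x. x \<in> S \<Longrightarrow> r x \<in> T"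
    "\<And>j. j \<in> J \<Longrightarrow> (\<lambda>x. Y (r x) j) \<in> polyfun S X I"
  shows "(\<lambda>x. f (r x)) \<in> polyfun S X I"
proof -
  obtain P where P: "mpoly_vars P \<subseteq> J" "\<forall>x\<in>T. f x = mpoly_eval P (Y x)"
    using assms(1) by (rule polyfunE)
  show ?thesis
    by (rule polyfun_cong[OF polyfun_eval[OF P(1), of "\<lambda>x. Y (r x)"]]) (use assms P in auto)
qed

text \<open>Kronecker substitution \<open>x\<^sub>i = t\<^bsup>N^i\<^esup>\<close> with \<open>N\<close> larger than all exponents separates the monomials.\<close>

lemma base_digits_inj:
  fixes f g :: "nat \<Rightarrow> nat"
  assumes "\<And>i. i < r \<Longrightarrow> f i < N" "\<And>i. i < r \<Longrightarrow> g i < N"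
    "(\<Sum>i<r. f i * N ^ i) = (\<Sum>i<r. g i * N ^ i)" "i < r"
  shows "f i = g i"
  using assms
proof (induct r arbitrary: f g i)
  case (Suc r)
  have s: "(\<Sum>i<Suc r. h i * N ^ i) = h 0 + N * (\<Sum>i<r. h (Suc i) * N ^ i)" for h
    by (simp add: sum.lessThan_Suc_shift sum_distrib_left algebra_simps del: sum.lessThan_Suc)
  have e: "f 0 + N * (\<Sum>i<r. f (Suc i) * N ^ i) = g 0 + N * (\<Sum>i<r. g (Suc i) * N ^ i)"
    using Suc(4) unfolding s .
  have N: "f 0 < N" "g 0 < N" using Suc by auto
  have "f 0 = g 0" using arg_cong[OF e, of "\<lambda>x. x mod N"] N by simp
  moreover have "(\<Sum>i<r. f (Suc i) * N ^ i) = (\<Sum>i<r. g (Suc i) * N ^ i)"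
    using e N \<open>f 0 = g 0\<close> by simp
  then have "f (Suc j) = g (Suc j)" if "j < r" for j
    using Suc(1)[of "\<lambda>i. f (Suc i)" "\<lambda>i. g (Suc i)" j] Suc(2,3) that by simp
  ultimately show ?case using Suc(5) by (cases i) auto
qed simp

lemma mpoly_eval_eq_0_imp:
  fixes P :: "(nat \<Rightarrow>\<^sub>0 nat) \<Rightarrow>\<^sub>0 'k::field"
  assumes inf: "infinite (UNIV :: 'k set)" and z: "\<And>a. mpoly_eval P a = 0"
  shows "P = 0"
proof (rule ccontr)
  assume "P \<noteq> 0"
  then obtain m0 where m0: "m0 \<in> Poly_Mapping.keys P"
    by (metis lookup_zero in_keys_iff poly_mapping_eqI)
  let ?K = "Poly_Mapping.keys P"
  have "finite (\<Union>m\<in>?K. Poly_Mapping.keys m)" by simp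
  then obtain r where r: "\<And>m v. m \<in> ?K \<Longrightarrow> v \<in> Poly_Mapping.keys m \<Longrightarrow> v < r"
    unfolding finite_nat_set_iff_bounded by blast
  have "finite (\<Union>m\<in>?K. Poly_Mapping.lookup m ` Poly_Mapping.keys m)" by simp
  then obtain N0 where N0: "\<And>m v. m \<in> ?K \<Longrightarrow> v \<in> Poly_Mapping.keys m \<Longrightarrow> Poly_Mapping.lookup m v < N0"
    unfolding finite_nat_set_iff_bounded by blast
  \<comment> \<open>The successor makes \<open>N\<close> positive, so that the bound is strict also
    for the exponent 0 of a variable that does not occur.\<close>
  define N where "N = Suc N0"
  have N: "Poly_Mapping.lookup m v < N" if "m \<in> ?K" for m v
    using N0[OF that, of v] by (cases "v \<in> Poly_Mapping.keys m") (auto simp: N_def in_keys_iff)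
  define w where "w m = (\<Sum>i<r. Poly_Mapping.lookup m i * N ^ i)" for m
  have w: "inj_on w ?K"
  proof
    fix m m' assume mm: "m \<in> ?K" "m' \<in> ?K" "w m = w m'"
    have "Poly_Mapping.lookup m i = Poly_Mapping.lookup m' i" for i
    proof (cases "i < r")
      case True
      then show ?thesis using base_digits_inj[of r "Poly_Mapping.lookup m" N "Poly_Mapping.lookup m'" i]
        N mm unfolding w_def by blast
    next
      case False
      then show ?thesis using r mm by (metis in_keys_iff)
    qed
    then show "m = m'" by (intro poly_mapping_eqI) auto
  qed
  \<comment> \<open>This is the polynomial in one variable that results from the substitution. Since
    \<open>w\<close> is injective on the monomials of \<open>P\<close>, no two terms merge.\<close>
  define Q where "Q = (\<Sum>m\<in>?K. Polynomial.monom (Poly_Mapping.lookup P m) (w m))"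
  have "poly Q t = 0" for t
  proof -
    have "(\<Prod>v\<in>Poly_Mapping.keys m. (t ^ (N ^ v)) ^ Poly_Mapping.lookup m v) = t ^ w m" if "m \<in> ?K" for m
    proof -
      have "(\<Prod>v\<in>Poly_Mapping.keys m. (t ^ (N ^ v)) ^ Poly_Mapping.lookup m v)
        = (\<Prod>v<r. (t ^ (N ^ v)) ^ Poly_Mapping.lookup m v)"
        using r that by (intro monomial_eval_superset) auto
      then show ?thesis by (simp add: w_def power_sum mult.commute flip: power_mult)
    qed
    then have "poly Q t = mpoly_eval P (\<lambda>v. t ^ (N ^ v))"
      by (simp add: Q_def poly_sum poly_monom mpoly_eval_def)
    then show ?thesis using z by simp
  qed
  then have "{t. poly Q t = 0} = UNIV" by auto
  then have "Q = 0" using inf poly_roots_finite[of Q] by metis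
  moreover have "coeff Q (w m0) = Poly_Mapping.lookup P m0"
  proof -
    have "coeff Q (w m0) = (\<Sum>m\<in>?K. if m = m0 then Poly_Mapping.lookup P m else 0)"
      unfolding Q_def coeff_sum
    proof (intro sum.cong refl)
      fix m assume "m \<in> ?K"
      then have "w m = w m0 \<longleftrightarrow> m = m0" using w m0 by (simp add: inj_on_eq_iff)
      then show "coeff (Polynomial.monom (Poly_Mapping.lookup P m) (w m)) (w m0) =
          (if m = m0 then Poly_Mapping.lookup P m else 0)" by simp
    qed
    then show ?thesis using m0 by simp
  qed
  ultimately show False using m0 by (simp add: in_keys_iff)
qed

lemma mpoly_eq_iff_eval:
  fixes P Q :: "(nat \<Rightarrow>\<^sub>0 nat) \<Rightarrow>\<^sub>0 'k::field"
  assumes inf: "infinite (UNIV :: 'k set)" and z: "\<And>a. mpoly_eval P a = mpoly_eval Q a"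
  shows "P = Q"
proof -
  have "mpoly_eval (P + mpoly_const (-1) * Q) a = 0" for a
    using z by (simp add: mpoly_eval_add mpoly_eval_mult)
  then have "P + mpoly_const (-1) * Q = 0" by (rule mpoly_eval_eq_0_imp[OF inf])
  moreover have "mpoly_const (-1) * Q = - Q"
    by (metis (no_types) mpoly_const_def mult_minus_left mult_1 single_one single_uminus)
  ultimately show ?thesis by simp
qed

section \<open>Roots of separable additive polynomials\<close>

text \<open>All roots are simple, so splitting off \<open>X - x\<close> removes exactly one root.
  The hypothesis passes to the cofactor \<open>r\<close>, because at a root \<open>a\<close> of
  \<open>r\<close> the derivative of \<open>p\<close> is \<open>(a - x)\<close> times that of
  \<open>r\<close>.\<close>

lemma card_roots_coprime_pderiv:
  fixes p :: "'k::alg_closed_field poly"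
  assumes "p \<noteq> 0" "\<And>a. poly p a = 0 \<Longrightarrow> poly (pderiv p) a \<noteq> 0"
  shows "card {x. poly p x = 0} = degree p"
  using assms
proof (induct "degree p" arbitrary: p)
  case 0
  then show ?case by (auto elim!: degree_eq_zeroE)
next
  case (Suc d p)
  obtain x where x: "poly p x = 0"
    using alg_closed_imp_poly_has_root[of p] Suc(2) by auto
  then obtain r where p: "p = [:-x, 1:] * r"
    by (metis dvd_def poly_eq_0_iff_dvd)
  have r0: "r \<noteq> 0" using Suc(3) p by auto
  have deg: "degree p = Suc (degree r)"
    unfolding p by (subst degree_mult_eq) (use r0 in auto)
  have pd: "poly (pderiv p) a = (a - x) * poly (pderiv r) a + poly r a" for a
    unfolding p pderiv_mult by (simp add: pderiv_pCons algebra_simps)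
  have rx: "poly r x \<noteq> 0" using Suc(4)[OF x] pd[of x] by simp
  have "card {x. poly r x = 0} = degree r"
  proof (rule Suc(1))
    fix a assume a: "poly r a = 0"
    then have "poly p a = 0" by (simp add: p)
    then show "poly (pderiv r) a \<noteq> 0" using Suc(4)[of a] pd[of a] a by auto
  qed (use Suc(2) deg r0 in auto)
  moreover have "{a. poly p a = 0} = insert x {a. poly r a = 0}" by (auto simp: p)
  moreover have "finite {a. poly r a = 0}" using poly_roots_finite[OF r0] by simp
  ultimately show ?case using rx deg by simp
qed

text \<open>The difference of the two monic polynomials has degree below \<open>card S\<close> but
  vanishes on \<open>S\<close>.\<close>

lemma monic_eq_prod_roots:
  fixes p :: "'k::idom poly"
  assumes "finite S" "degree p = card S" "lead_coeff p = 1" "\<And>s. s \<in> S \<Longrightarrow> poly p s = 0"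
  shows "p = (\<Prod>s\<in>S. [:-s, 1:])"
proof (rule ccontr)
  let ?r = "\<Prod>s\<in>S. [:-s, 1:]"
  assume ne: "p \<noteq> ?r"
  have dr: "degree ?r = card S" using degree_prod_eq_sum_degree[of S "\<lambda>s. [:-s, 1:]"] by simp
  have lr: "lead_coeff ?r = 1" by (simp add: lead_coeff_prod)
  have pos: "S \<noteq> {}"
  proof
    assume "S = {}"
    then show False using ne assms(2,3) by (auto elim!: degree_eq_zeroE)
  qed
  have "coeff (p - ?r) (card S) = 0" using dr lr assms by simp
  moreover have "degree (p - ?r) \<le> card S" using dr assms by (intro degree_diff_le) auto
  ultimately have dlt: "degree (p - ?r) < card S"
    using pos assms(1) ne by (metis card_gt_0_iff coeff_0_degree_minus_1 degree_0 diff_is_0_eq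
        eq_iff_diff_eq_0 le_neq_implies_less leading_coeff_0_iff)
  have "S \<subseteq> {x. poly (p - ?r) x = 0}" using assms by (auto simp: poly_prod)
  then have "card S \<le> card {x. poly (p - ?r) x = 0}"
    using ne by (intro card_mono poly_roots_finite) auto
  also have "\<dots> \<le> degree (p - ?r)" using ne by (intro card_poly_roots_bound) auto
  finally show False using dlt by simp
qed

text \<open>This is Lagrange interpolation of \<open>f\<close> at the roots of \<open>p\<close>.\<close>

lemma sum_over_roots:
  fixes p :: "'k::idom poly"
  assumes "finite S" "p = (\<Prod>s\<in>S. [:-s, 1:])" "pderiv p = [:-1:]" "degree f < card S"
  shows "(\<Sum>s\<in>S. poly f s) = - coeff f (card S - 1)"
proof -
  define e where "e s = (\<Prod>u\<in>S - {s}. [:-u, 1:])" for s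
  \<comment> \<open>The value of \<open>e s\<close> at \<open>s\<close> is that of the derivative of
    \<open>p\<close>, namely -1. Hence \<open>g\<close> interpolates \<open>- f\<close> and not
    \<open>f\<close>, which explains the sign in the result.\<close>
  define g where "g = (\<Sum>s\<in>S. smult (poly f s) (e s))"
  have pe: "p = [:-s, 1:] * e s" if "s \<in> S" for s
    unfolding assms(2) e_def using assms(1) that by (rule prod.remove)
  have de: "degree (e s) = card S - 1" if "s \<in> S" for s
    unfolding e_def using degree_prod_eq_sum_degree[of "S - {s}" "\<lambda>s. [:-s, 1:]"] that assms(1) by simp
  have le: "coeff (e s) (card S - 1) = 1" if "s \<in> S" for s
    using de[OF that] lead_coeff_prod[of "\<lambda>s. [:-s, 1:]" "S - {s}"] unfolding e_def by simp
  have es: "poly (e s) s = -1" if "s \<in> S" for s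
  proof -
    have "pderiv p = e s + [:-s, 1:] * pderiv (e s)"
      unfolding pe[OF that] pderiv_mult by (simp add: pderiv_pCons)
    then have "poly (pderiv p) s = poly (e s) s" by simp
    then show ?thesis using assms(3) by simp
  qed
  have eu: "poly (e s) u = 0" if "u \<in> S" "u \<noteq> s" for s u
    unfolding e_def using that assms(1) by (auto simp: poly_prod)
  have "poly g u = - poly f u" if "u \<in> S" for u
  proof -
    have "poly g u = (\<Sum>s\<in>S. if s = u then - poly f u else 0)"
      unfolding g_def poly_sum using es eu that by (intro sum.cong) auto
    then show ?thesis using that assms(1) by simp
  qed
  then have sub: "S \<subseteq> {x. poly (f + g) x = 0}" by auto
  have "degree g \<le> card S - 1"
    unfolding g_def using de by (intro degree_sum_le assms(1)) (auto intro: order_trans[OF degree_smult_le])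
  then have d: "degree (f + g) < card S" using assms(4) degree_add_less[of f "card S" g] by linarith
  have "f + g = 0"
  proof (rule ccontr)
    assume ne: "f + g \<noteq> 0"
    have "card S \<le> card {x. poly (f + g) x = 0}"
      using ne sub by (intro card_mono poly_roots_finite) auto
    also have "\<dots> \<le> degree (f + g)" using ne by (intro card_poly_roots_bound) auto
    finally show False using d by simp
  qed
  then have "coeff f (card S - 1) + coeff g (card S - 1) = 0" by (metis coeff_0 coeff_add)
  moreover have "coeff g (card S - 1) = (\<Sum>s\<in>S. poly f s)"
    unfolding g_def coeff_sum using le by simp
  ultimately show ?thesis by (simp add: eq_neg_iff_add_eq_0 add.commute)
qed

text \<open>What remains of \<open>q\<close> being a power of the characteristic: the
  \<open>q\<close>-th power map is additive, and monomials with exponent \<open>q ^ j\<close>,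
  \<open>j \<ge> 1\<close>, have derivative zero.\<close>

locale frob_field =
  fixes q n :: nat and K :: "'k::alg_closed_field itself"
  assumes q: "q \<ge> 2" and n: "n \<ge> 1"
    and qadd: "\<And>a b :: 'k. (a + b) ^ q = a ^ q + b ^ q"
    and q0: "of_nat q = (0 :: 'k)"
begin

lemma qpow_add: "(a + b :: 'k) ^ (q ^ j) = a ^ (q ^ j) + b ^ (q ^ j)"
  by (induct j) (simp_all add: power_mult qadd mult.commute[of q])

lemma zero_qpow [simp]: "(0 :: 'k) ^ (q ^ j) = 0"
  using q by (simp add: zero_power)

lemma qpow_sum: "(\<Sum>i\<in>I. f i :: 'k) ^ (q ^ j) = (\<Sum>i\<in>I. f i ^ (q ^ j))"
  by (induct I rule: infinite_finite_induct) (simp_all add: qpow_add)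

lemma qpow_uminus: "(- a :: 'k) ^ (q ^ j) = - (a ^ (q ^ j))"
proof -
  have "(- a) ^ (q ^ j) + a ^ (q ^ j) = 0" unfolding qpow_add[symmetric] by simp
  then show ?thesis by (simp add: eq_neg_iff_add_eq_0)
qed

lemma qpow_diff: "(a - b :: 'k) ^ (q ^ j) = a ^ (q ^ j) - b ^ (q ^ j)"
  using qpow_add[of a "-b" j] by (simp add: qpow_uminus)

sublocale frob: comm_ring_hom "\<lambda>a :: 'k. a ^ q"
  using q by unfold_locales (simp_all add: qadd power_mult_distrib zero_power)

definition F :: "'k set" where "F = Fq q"

lemma F_zero: "0 \<in> F"
  and F_diff: "a \<in> F \<Longrightarrow> b \<in> F \<Longrightarrow> a - b \<in> F"
  and F_uminus: "a \<in> F \<Longrightarrow> - a \<in> F"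
  and F_divide: "a \<in> F \<Longrightarrow> b \<in> F \<Longrightarrow> a / b \<in> F"
  using qpow_diff[of a b 1] qpow_uminus[of a 1] by (auto simp: F_def Fq_def power_divide)

lemma F_qpow: "a \<in> F \<Longrightarrow> a ^ (q ^ j) = a"
  by (induct j) (simp_all add: F_def Fq_def power_mult)

text \<open>The sign is chosen so that a root \<open>t\<close> satisfies
  \<open>t ^ (q ^ m) = (\<Sum>j<m. v j * t ^ (q ^ j))\<close>; thus \<open>v\<close> is the last
  column of a companion matrix.\<close>

definition addpoly :: "nat \<Rightarrow> (nat \<Rightarrow> 'k) \<Rightarrow> 'k poly" where
  "addpoly m v = Polynomial.monom 1 (q ^ m) - (\<Sum>j<m. Polynomial.monom (v j) (q ^ j))"

lemma poly_addpoly: "poly (addpoly m v) t = t ^ (q ^ m) - (\<Sum>j<m. v j * t ^ (q ^ j))"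
  by (simp add: addpoly_def poly_monom poly_sum)

lemma qpow_less: "i < j \<Longrightarrow> q ^ i < q ^ j"
  using q by (intro power_strict_increasing) auto

lemma qpow_eq: "q ^ i = q ^ j \<longleftrightarrow> i = j"
  using q by (intro power_inject_exp) auto

lemma coeff_addpoly_top: "coeff (addpoly m v) (q ^ m) = 1"
  by (auto simp: addpoly_def coeff_sum qpow_eq intro!: sum.neutral)

lemma coeff_addpoly: "i < m \<Longrightarrow> coeff (addpoly m v) (q ^ i) = - v i"
  by (simp add: addpoly_def coeff_sum qpow_eq)

lemma degree_addpoly: "degree (addpoly m v) = q ^ m"
proof (rule antisym)
  show "degree (addpoly m v) \<le> q ^ m"
    unfolding addpoly_def
    by (intro degree_diff_le degree_sum_le degree_monom_le)
       (auto intro!: order_trans[OF degree_monom_le] less_imp_le[OF qpow_less])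
  show "q ^ m \<le> degree (addpoly m v)" by (rule le_degree) (simp add: coeff_addpoly_top)
qed

lemma pderiv_addpoly:
  assumes "m \<ge> 1"
  shows "pderiv (addpoly m v) = [:- v 0:]"
proof -
  have z: "of_nat (q ^ j) = (0 :: 'k)" if "j \<ge> 1" for j
    using that by (simp add: q0 zero_power)
  have "pderiv (\<Sum>j<m. Polynomial.monom (v j) (q ^ j)) =
      (\<Sum>j<m. if j = 0 then [:v 0:] else 0)"
    unfolding higher_pderiv_sum[of 1, simplified] using z by (intro sum.cong) (auto simp: pderiv_monom monom_0)
  then show ?thesis
    using assms z[OF assms] by (simp add: addpoly_def pderiv_diff pderiv_monom power_0_left)
qed

text \<open>The derivative is the constant \<open>- v 0\<close>. If this is nonzero, the polynomial
  is separable and has as many roots as its degree.\<close>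

lemma finite_card_roots_addpoly:
  assumes "m \<ge> 1" "v 0 \<noteq> 0"
  shows "finite {t. poly (addpoly m v) t = 0}" "card {t. poly (addpoly m v) t = 0} = q ^ m"
proof -
  have ne: "addpoly m v \<noteq> 0" using coeff_addpoly_top[of m v] by auto
  show "finite {t. poly (addpoly m v) t = 0}" by (rule poly_roots_finite[OF ne])
  show "card {t. poly (addpoly m v) t = 0} = q ^ m"
    using card_roots_coprime_pderiv[OF ne] assms by (simp add: pderiv_addpoly degree_addpoly)
qed

lemma finite_F: "finite F" and card_F: "card F = q"
proof -
  have "F = {t. poly (addpoly 1 (\<lambda>_. 1)) t = 0}"
    by (auto simp: F_def Fq_def poly_addpoly)
  then show "finite F" "card F = q" using finite_card_roots_addpoly[of 1 "\<lambda>_. 1"] by auto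
qed

text \<open>A field with \<open>N\<close> elements cannot contain the \<open>q ^ (N + 1)\<close>
  roots of a separable additive polynomial of that degree.\<close>

lemma infinite_field: "infinite (UNIV :: 'k set)"
proof
  assume fin: "finite (UNIV :: 'k set)"
  let ?N = "card (UNIV :: 'k set)"
  have "card {t. poly (addpoly (Suc ?N) (\<lambda>_. 1)) t = 0} \<le> ?N" by (rule card_mono[OF fin subset_UNIV])
  then have "q ^ Suc ?N \<le> ?N"
    using finite_card_roots_addpoly(2)[of "Suc ?N" "\<lambda>_. 1"] by simp
  moreover have "Suc ?N < q ^ Suc ?N" using q by (intro power_gt_expt) auto
  ultimately show False by simp
qed

section \<open>Linear combinations over the finite field and bases of the root space\<close>

definition lin :: "nat \<Rightarrow> (nat \<Rightarrow> 'k) \<Rightarrow> (nat \<Rightarrow> 'k) \<Rightarrow> 'k" where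
  "lin m x l = (\<Sum>i<m. l i * x i)"

text \<open>The coefficient tuples are extensional, so that there are exactly \<open>q ^ m\<close>
  of them and injectivity of \<open>lin m x\<close> on this set expresses linear independence over
  \<open>F\<close>.\<close>

definition scalars :: "nat \<Rightarrow> (nat \<Rightarrow> 'k) set" where
  "scalars m = {..<m} \<rightarrow>\<^sub>E F"

lemma finite_scalars: "finite (scalars m)" and card_scalars: "card (scalars m) = q ^ m"
  unfolding scalars_def by (auto simp: finite_F card_F card_PiE intro!: finite_PiE)

lemma scalarsD: "l \<in> scalars m \<Longrightarrow> i < m \<Longrightarrow> l i \<in> F"
  unfolding scalars_def by (rule PiE_mem[of l "{..<m}" "\<lambda>_. F"]) auto

lemma restrict_scalars: "(\<And>i. i < m \<Longrightarrow> l i \<in> F) \<Longrightarrow> restrict l {..<m} \<in> scalars m"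
  unfolding scalars_def by simp

lemma lin_qpow:
  assumes "l \<in> scalars m"
  shows "lin m x l ^ (q ^ j) = lin m (\<lambda>i. x i ^ (q ^ j)) l"
  unfolding lin_def qpow_sum
proof (intro sum.cong refl)
  fix i assume "i \<in> {..<m}"
  then have "l i ^ (q ^ j) = l i" using scalarsD[OF assms] by (intro F_qpow) simp
  then show "(l i * x i) ^ (q ^ j) = l i * x i ^ (q ^ j)" by (simp add: power_mult_distrib)
qed

lemma lin_diff: "lin m x l - lin m x l' = lin m x (\<lambda>i. l i - l' i)"
  by (simp add: lin_def algebra_simps sum_subtractf)

lemma lin_restrict: "lin m x (restrict l {..<m}) = lin m x l"
  by (simp add: lin_def)

lemma lin_combine:
  "(\<Sum>j\<in>J. v j * lin m (X j) l) = lin m (\<lambda>i. \<Sum>j\<in>J. v j * X j i) l"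
  unfolding lin_def sum_distrib_left by (subst sum.swap) (simp add: mult_ac sum_distrib_left)

text \<open>Coefficients in \<open>F\<close> are fixed by Frobenius, so evaluating an additive
  polynomial is \<open>F\<close>-linear and its roots are closed under \<open>lin\<close>.\<close>

lemma poly_addpoly_lin:
  assumes "l \<in> scalars m"
  shows "poly (addpoly k v) (lin m x l) = lin m (\<lambda>i. poly (addpoly k v) (x i)) l"
  unfolding poly_addpoly lin_qpow[OF assms] lin_combine
  by (simp add: lin_def algebra_simps sum_subtractf)

lemma inj_linI:
  assumes "\<And>l. l \<in> scalars m \<Longrightarrow> lin m x l = 0 \<Longrightarrow> \<forall>i<m. l i = 0"
  shows "inj_on (lin m x) (scalars m)"
proof
  fix l l' assume l: "l \<in> scalars m" "l' \<in> scalars m" "lin m x l = lin m x l'"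
  have "restrict (\<lambda>i. l i - l' i) {..<m} \<in> scalars m"
    using scalarsD[OF l(1)] scalarsD[OF l(2)] by (intro restrict_scalars F_diff)
  moreover have "lin m x (restrict (\<lambda>i. l i - l' i) {..<m}) = 0"
    using l lin_diff[of m x l l'] by (simp add: lin_restrict)
  ultimately have "\<forall>i<m. restrict (\<lambda>i. l i - l' i) {..<m} i = 0" by (rule assms)
  then show "l = l'" by (intro PiE_ext[OF l(1,2)[unfolded scalars_def]]) simp
qed

text \<open>The condition on the determinant in \<open>Q'\<close> means that the Dickson element \<open>c\<^bsub>n,0\<^esub>\<close> is \<open>-1\<close>, whence the
  special role of the index \<open>0\<close>.\<close>

definition vc :: "(nat \<Rightarrow> 'k) \<Rightarrow> nat \<Rightarrow> 'k" where
  "vc c i = (if i = 0 then 1 else - c i)"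

definition V :: "(nat \<Rightarrow> 'k) \<Rightarrow> 'k set" where
  "V c = {t. poly (addpoly n (vc c)) t = 0}"

lemma finite_V: "finite (V c)" and card_V: "card (V c) = q ^ n"
  unfolding V_def using finite_card_roots_addpoly[of n "vc c"] n by (auto simp: vc_def)

text \<open>While \<open>m < n\<close>, the span of the vectors found so far has only
  \<open>q ^ m\<close> elements, fewer than the \<open>q ^ n\<close> roots, so a root outside the
  span is left to extend the family.\<close>

lemma V_basis: "m \<le> n \<Longrightarrow> \<exists>x. (\<forall>i<m. x i \<in> V c) \<and> inj_on (lin m x) (scalars m)"
proof (induct m)
  case 0
  then show ?case by (auto simp: scalars_def)
next
  case (Suc m)
  then obtain x where x: "\<forall>i<m. x i \<in> V c" "inj_on (lin m x) (scalars m)" by auto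
  have "card (lin m x ` scalars m) = q ^ m" using x card_image card_scalars by metis
  then have "card (lin m x ` scalars m) < card (V c)" using Suc qpow_less card_V by simp
  then obtain t where t: "t \<in> V c" "t \<notin> lin m x ` scalars m"
    by (metis card_mono finite_imageI finite_scalars leD subsetI)
  define x' where "x' = x(m := t)"
  have lin': "lin (Suc m) x' l = lin m x l + l m * t" for l
    by (simp add: lin_def x'_def)
  have "inj_on (lin (Suc m) x') (scalars (Suc m))"
  proof (rule inj_linI)
    fix l assume l: "l \<in> scalars (Suc m)" "lin (Suc m) x' l = 0"
    have lF: "l i \<in> F" if "i < Suc m" for i using scalarsD[OF l(1) that] .
    have "l m = 0"
    proof (rule ccontr)
      assume lm: "l m \<noteq> 0"
      have "t = lin m x (\<lambda>i. - l i / l m)"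
        using l(2)[unfolded lin'] lm unfolding lin_def
        by (simp add: sum_negf sum_divide_distrib[symmetric] eq_neg_iff_add_eq_0 field_simps)
      moreover have "restrict (\<lambda>i. - l i / l m) {..<m} \<in> scalars m"
        using lF by (intro restrict_scalars F_divide F_uminus) simp_all
      ultimately show False using t(2) by (metis image_eqI lin_restrict)
    qed
    moreover have "restrict l {..<m} \<in> scalars m" "restrict (\<lambda>_. 0) {..<m} \<in> scalars m"
      using lF F_zero by (auto intro!: restrict_scalars)
    moreover have "lin m x (restrict l {..<m}) = lin m x (restrict (\<lambda>_. 0) {..<m})"
      using l(2) \<open>l m = 0\<close> unfolding lin' lin_restrict by (simp add: lin_def)
    ultimately have "restrict l {..<m} = restrict (\<lambda>_. 0) {..<m}" using x(2) by (meson inj_onD)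
    then show "\<forall>i<Suc m. l i = 0"
      using \<open>l m = 0\<close> by (metis less_Suc_eq lessThan_iff restrict_apply')
  qed
  moreover have "\<forall>i<Suc m. x' i \<in> V c" using x t by (simp add: x'_def less_Suc_eq)
  ultimately show ?case by blast
qed

section \<open>Power sums of the roots\<close>

definition psum :: "(nat \<Rightarrow> 'k) \<Rightarrow> nat \<Rightarrow> 'k" where
  "psum c j = (\<Sum>t\<in>V c. t ^ j)"

text \<open>For \<open>j < q ^ n\<close> the power sum is constant in \<open>c\<close> by
  \<open>sum_over_roots\<close>, since the derivative is -1. For larger \<open>j\<close> the
  equation of the roots lowers the exponent; its coefficients are 1 and \<open>- c i\<close> with
  \<open>1 \<le> i < n\<close>.\<close>

lemma psum_polyfun: "(\<lambda>c. psum c j) \<in> polyfun UNIV (\<lambda>c. c) {1..n - 1}"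
proof (induct j rule: less_induct)
  case (less j)
  show ?case
  proof (cases "j < q ^ n")
    case True
    have "psum c j = - coeff (Polynomial.monom 1 j) (q ^ n - 1)" for c
    proof -
      have "addpoly n (vc c) = (\<Prod>s\<in>V c. [:-s, 1:])"
        by (rule monic_eq_prod_roots)
           (simp_all add: finite_V card_V degree_addpoly coeff_addpoly_top, simp add: V_def)
      moreover have "pderiv (addpoly n (vc c)) = [:-1:]" using n by (simp add: pderiv_addpoly vc_def)
      ultimately have "(\<Sum>s\<in>V c. poly (Polynomial.monom 1 j) s) = - coeff (Polynomial.monom 1 j) (card (V c) - 1)"
        using True by (intro sum_over_roots[OF finite_V]) (simp_all add: degree_monom_eq card_V)
      then show ?thesis by (simp add: psum_def poly_monom card_V)
    qed
    then show ?thesis by (simp add: polyfun_const)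
  next
    case False
    define d where "d = j - q ^ n"
    have j: "j = d + q ^ n" using False by (simp add: d_def)
    have "psum c j = (\<Sum>i<n. vc c i * psum c (d + q ^ i))" for c
    proof -
      have "t ^ j = (\<Sum>i<n. vc c i * t ^ (d + q ^ i))" if "t \<in> V c" for t
      proof -
        have "t ^ (q ^ n) = (\<Sum>i<n. vc c i * t ^ (q ^ i))"
          using that by (simp add: V_def poly_addpoly)
        then show ?thesis by (simp add: j power_add sum_distrib_left mult_ac)
      qed
      then have "psum c j = (\<Sum>t\<in>V c. \<Sum>i<n. vc c i * t ^ (d + q ^ i))"
        unfolding psum_def by (intro sum.cong) auto
      then show ?thesis by (subst (asm) sum.swap) (simp add: psum_def sum_distrib_left)
    qed
    moreover have "(\<lambda>c. \<Sum>i<n. vc c i * psum c (d + q ^ i)) \<in> polyfun UNIV (\<lambda>c. c) {1..n - 1}"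
    proof (intro polyfun_sum polyfun_mult)
      fix i assume i: "i \<in> {..<n}"
      then show "(\<lambda>c. psum c (d + q ^ i)) \<in> polyfun UNIV (\<lambda>c. c) {1..n - 1}"
        using less[of "d + q ^ i"] qpow_less[of i n] j by simp
      show "(\<lambda>c. vc c i) \<in> polyfun UNIV (\<lambda>c. c) {1..n - 1}"
        using i unfolding vc_def
        by (cases "i = 0") (auto intro!: polyfun_const polyfun_uminus polyfun_coord)
    qed
    ultimately show ?thesis by simp
  qed
qed

text \<open>A monomial in the entries \<open>x i ^ (q ^ j)\<close> is a product of powers of the
  individual \<open>x i\<close>. Summed over all tuples, it factors into one power sum for each row
  \<open>i\<close>.\<close>

lemma sum_tuples_polyfun:
  assumes "mpoly_vars P \<subseteq> {..<n} \<times> {..<n}"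
  shows "(\<lambda>c. \<Sum>x\<in>{..<n} \<rightarrow>\<^sub>E V c. mpoly_eval P (\<lambda>(i, j). x i ^ (q ^ j)))
    \<in> polyfun UNIV (\<lambda>c. c) {1..n - 1}"
proof -
  have mono: "(\<Prod>v\<in>Poly_Mapping.keys m. (case v of (i, j) \<Rightarrow> x i ^ q ^ j) ^ Poly_Mapping.lookup m v)
     = (\<Prod>i<n. x i ^ (\<Sum>j<n. q ^ j * Poly_Mapping.lookup m (i, j)))"
    if "m \<in> Poly_Mapping.keys P" for m and x :: "nat \<Rightarrow> 'k"
  proof -
    have k: "Poly_Mapping.keys m \<subseteq> {..<n} \<times> {..<n}"
      using that assms unfolding mpoly_vars_def by blast
    have "(\<Prod>v\<in>Poly_Mapping.keys m. (case v of (i, j) \<Rightarrow> x i ^ q ^ j) ^ Poly_Mapping.lookup m v)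
      = (\<Prod>v\<in>{..<n} \<times> {..<n}. (case v of (i, j) \<Rightarrow> x i ^ q ^ j) ^ Poly_Mapping.lookup m v)"
      using k by (intro monomial_eval_superset) auto
    also have "\<dots> = (\<Prod>i<n. \<Prod>j<n. x i ^ (q ^ j * Poly_Mapping.lookup m (i, j)))"
      by (simp add: prod.cartesian_product power_mult case_prod_unfold)
    finally show ?thesis by (simp add: power_sum)
  qed
  have "(\<Sum>x\<in>{..<n} \<rightarrow>\<^sub>E V c. mpoly_eval P (\<lambda>(i, j). x i ^ (q ^ j))) =
    (\<Sum>m\<in>Poly_Mapping.keys P. Poly_Mapping.lookup P m *
       (\<Prod>i<n. psum c (\<Sum>j<n. q ^ j * Poly_Mapping.lookup m (i, j))))" for c
  proof -
    have "(\<Sum>x\<in>{..<n} \<rightarrow>\<^sub>E V c. mpoly_eval P (\<lambda>(i, j). x i ^ (q ^ j))) =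
      (\<Sum>x\<in>{..<n} \<rightarrow>\<^sub>E V c. \<Sum>m\<in>Poly_Mapping.keys P. Poly_Mapping.lookup P m *
         (\<Prod>i<n. x i ^ (\<Sum>j<n. q ^ j * Poly_Mapping.lookup m (i, j))))"
      unfolding mpoly_eval_def using mono by (intro sum.cong refl) simp
    also have "\<dots> = (\<Sum>m\<in>Poly_Mapping.keys P. Poly_Mapping.lookup P m *
      (\<Sum>x\<in>{..<n} \<rightarrow>\<^sub>E V c. \<Prod>i<n. x i ^ (\<Sum>j<n. q ^ j * Poly_Mapping.lookup m (i, j))))"
      by (subst sum.swap) (simp add: sum_distrib_left)
    also have "\<dots> = (\<Sum>m\<in>Poly_Mapping.keys P. Poly_Mapping.lookup P m *
       (\<Prod>i<n. psum c (\<Sum>j<n. q ^ j * Poly_Mapping.lookup m (i, j))))"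
      unfolding psum_def by (subst prod_sum_PiE) (simp_all add: finite_V)
    finally show ?thesis .
  qed
  then show ?thesis
    by (simp only:) (intro polyfun_sum polyfun_mult polyfun_const polyfun_prod psum_polyfun)
qed

end

section \<open>Matrices\<close>

lemma mat_mult_index:
  assumes "A \<in> carrier_mat n m" "B \<in> carrier_mat m r" "i < n" "j < r"
  shows "(A * B) $$ (i, j) = (\<Sum>k\<in>{0..<m}. A $$ (i, k) * B $$ (k, j))"
  using assms(3,4) carrier_matD[OF assms(1)] carrier_matD[OF assms(2)] by (simp add: scalar_prod_def)

lemma mult_carrier_sq [simp]: "A \<in> carrier_mat n n \<Longrightarrow> B \<in> carrier_mat n n \<Longrightarrow> A * B \<in> carrier_mat n n"
  by (rule mult_carrier_mat)

lemma
  assumes A: "A \<in> carrier_mat n n" and d: "det A \<noteq> 0"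
  shows minv_carrier: "minv A \<in> carrier_mat n n"
    and minv_right: "A * minv A = 1\<^sub>m n" and minv_left: "minv A * A = 1\<^sub>m n"
proof -
  obtain B where "mat_inverse A = Some B"
    using mat_inverse(1)[OF A, where b = "()"] det_non_zero_imp_unit[OF A d, where b = "()"] by (cases "mat_inverse A") auto
  then show "minv A \<in> carrier_mat n n" "A * minv A = 1\<^sub>m n" "minv A * A = 1\<^sub>m n"
    using mat_inverse(2)[OF A] by (simp_all add: minv_def)
qed

lemma det_nz_of_mult_id:
  assumes "A \<in> carrier_mat n n" "B \<in> carrier_mat n n" "A * B = 1\<^sub>m n"
  shows "det (A :: 'k::field mat) \<noteq> 0" "det B \<noteq> 0"
  using det_mult[OF assms(1,2)] assms(3) by auto

lemma minv_eqI:
  assumes A: "A \<in> carrier_mat n n" and B: "B \<in> carrier_mat n n" and AB: "A * B = 1\<^sub>m n"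
  shows "minv A = (B :: 'k::field mat)"
proof -
  note d = det_nz_of_mult_id(1)[OF assms]
  have "minv A = minv A * (A * B)" using AB minv_carrier[OF A d] by simp
  also have "\<dots> = B"
    using assoc_mult_mat[OF minv_carrier[OF A d] A B] minv_left[OF A d] B by simp
  finally show ?thesis .
qed

lemma minv_mult:
  assumes A: "A \<in> carrier_mat n n" "det A \<noteq> 0" and B: "B \<in> carrier_mat n n" "det B \<noteq> 0"
  shows "minv (A * B) = minv B * minv (A :: 'k::field mat)"
proof (rule minv_eqI)
  note mA = minv_carrier[OF A] and mB = minv_carrier[OF B]
  have "A * B * (minv B * minv A) = A * (B * minv B) * minv A"
    using A(1) B(1) mA mB by (simp add: assoc_mult_mat[of _ n n _ n _ n])
  then show "A * B * (minv B * minv A) = 1\<^sub>m n" using minv_right[OF A] minv_right[OF B] A by simp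
qed (use A B minv_carrier[OF A] minv_carrier[OF B] in auto)

lemma minv_minv:
  assumes A: "A \<in> carrier_mat n n" "det A \<noteq> 0"
  shows "minv (minv A) = A"
  using minv_eqI[OF minv_carrier[OF A] A(1) minv_left[OF A]] .

lemma minv_one: "minv (1\<^sub>m n :: 'k::field mat) = 1\<^sub>m n"
  by (rule minv_eqI[of _ n]) auto

lemma det_minv_nz:
  assumes A: "A \<in> carrier_mat n n" "det A \<noteq> 0"
  shows "det (minv A) \<noteq> 0"
  using det_nz_of_mult_id(2)[OF A(1) minv_carrier[OF A] minv_right[OF A]] .

section \<open>Invertible and upper unitriangular matrices\<close>

lemma GL_iff: "A \<in> GL n \<longleftrightarrow> A \<in> carrier_mat n n \<and> det (A :: 'k::field mat) \<noteq> 0"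
proof
  assume "A \<in> GL n"
  then obtain B where A: "A \<in> carrier_mat n n" and B: "A * B = 1\<^sub>m n" "B * A = 1\<^sub>m (dim_row B)"
    unfolding GL_def invertible_mat_def inverts_mat_def by auto
  have "B \<in> carrier_mat n n"
  proof
    show "dim_col B = n" using arg_cong[OF B(1), of dim_col] by simp
    show "dim_row B = n" using arg_cong[OF B(2), of dim_col] A by simp
  qed
  then show "A \<in> carrier_mat n n \<and> det A \<noteq> 0" using det_nz_of_mult_id[OF A _ B(1)] A by blast
next
  assume A: "A \<in> carrier_mat n n \<and> det A \<noteq> 0"
  then show "A \<in> GL n"
    unfolding GL_def invertible_mat_def inverts_mat_def square_mat.simps
    using minv_carrier[of A n] minv_left[of A n] minv_right[of A n] by auto
qed

lemma GL_minv: "A \<in> GL n \<Longrightarrow> minv A \<in> GL n"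
  and GL_mult: "A \<in> GL n \<Longrightarrow> B \<in> GL n \<Longrightarrow> A * B \<in> GL n"
  unfolding GL_iff using minv_carrier det_minv_nz by (auto simp: det_mult[of A n B])

lemma mult_minv_cancel:
  assumes "A \<in> carrier_mat n n" "det A \<noteq> 0" "B \<in> carrier_mat n m"
  shows "A * (minv A * B) = B" "minv A * (A * B) = (B :: 'k::field mat)"
  using assms minv_carrier[OF assms(1,2)] minv_left[OF assms(1,2)] minv_right[OF assms(1,2)]
  by (simp_all add: assoc_mult_mat[symmetric, of _ n n _ n _ m])

lemma Ustar_det:
  assumes "A \<in> Ustar n"
  shows "det A = 1"
proof -
  have A: "A \<in> carrier_mat n n" "upper_triangular A" "\<And>i. i < n \<Longrightarrow> A $$ (i, i) = 1"
    using assms by (auto simp: Ustar_def)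
  have "diag_mat A = map (\<lambda>_. 1) [0..<n]"
    unfolding diag_mat_def using A by (intro map_cong) auto
  then have "prod_list (diag_mat A) = 1" by (simp add: map_replicate_const)
  then show ?thesis using det_upper_triangular[OF A(2,1)] by simp
qed

lemma Ustar_iff: "A \<in> Ustar n \<longleftrightarrow> A \<in> carrier_mat n n \<and>
    (\<forall>i<n. \<forall>j<i. A $$ (i, j) = 0) \<and> (\<forall>i<n. A $$ (i, i) = 1)"
  by (auto simp: Ustar_def)

lemma Ustar_mult:
  assumes A: "A \<in> Ustar n" and B: "B \<in> Ustar n"
  shows "A * B \<in> Ustar n"
proof -
  have ab: "(A * B) $$ (i, j) = (\<Sum>k\<in>{0..<n}. A $$ (i, k) * B $$ (k, j))" if "i < n" "j < n" for i j
    using that A B by (intro mat_mult_index) (auto simp: Ustar_iff)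
  have "(A * B) $$ (i, j) = 0" if ij: "i < n" "j < i" for i j
    unfolding ab[OF ij(1) less_trans[OF ij(2,1)]]
  proof (intro sum.neutral ballI)
    fix k assume "k \<in> {0..<n}"
    then show "A $$ (i, k) * B $$ (k, j) = 0"
      using A B ij by (cases "k < i") (auto simp: Ustar_iff)
  qed
  moreover have "(A * B) $$ (i, i) = 1" if i: "i < n" for i
  proof -
    have "(A * B) $$ (i, i) = (\<Sum>k\<in>{0..<n}. if k = i then 1 else 0)"
      unfolding ab[OF i i]
    proof (intro sum.cong refl)
      fix k assume "k \<in> {0..<n}"
      then show "A $$ (i, k) * B $$ (k, i) = (if k = i then 1 else 0)"
        using A B i by (cases k i rule: linorder_cases) (auto simp: Ustar_iff)
    qed
    then show ?thesis using i by simp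
  qed
  ultimately show ?thesis using A B by (auto simp: Ustar_iff)
qed

text \<open>In \<open>A * B = 1\<^sub>m n\<close> row \<open>i\<close> of \<open>A\<close> involves
  only the rows \<open>k \<ge> i\<close> of \<open>B\<close>. Working upwards from the last row, the
  entries of \<open>B\<close> on and below the diagonal are forced.\<close>

lemma Ustar_minv:
  assumes A: "A \<in> Ustar n"
  shows "minv A \<in> Ustar n"
proof -
  have c: "A \<in> carrier_mat n n" using A by (simp add: Ustar_iff)
  have d: "det A \<noteq> 0" using Ustar_det[OF A] by simp
  define B where "B = minv A"
  have B: "B \<in> carrier_mat n n" "A * B = 1\<^sub>m n"
    using minv_carrier[OF c d] minv_right[OF c d] by (simp_all add: B_def)
  have ab: "(\<Sum>k\<in>{0..<n}. A $$ (i, k) * B $$ (k, j)) = (if i = j then 1 else 0)"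
    if "i < n" "j < n" for i j
    using mat_mult_index[OF c B(1) that] that unfolding B(2) by simp
  have "\<forall>j\<le>i. B $$ (i, j) = (if i = j then 1 else 0)" if "i < n" for i
    using that
  proof (induct "n - i" arbitrary: i rule: less_induct)
    case less
    show ?case
    proof (intro allI impI)
      fix j assume j: "j \<le> i"
      have "A $$ (i, k) * B $$ (k, j) = (if k = i then B $$ (i, j) else 0)" if "k \<in> {0..<n}" for k
      proof (cases k i rule: linorder_cases)
        case less
        then show ?thesis using A that \<open>i < n\<close> by (simp add: Ustar_iff)
      next
        case equal
        then show ?thesis using A that by (simp add: Ustar_iff)
      next
        case greater
        then have "B $$ (k, j) = 0" using less(1)[of k] j that by auto
        then show ?thesis using greater by simp
      qed
      then have "(\<Sum>k\<in>{0..<n}. A $$ (i, k) * B $$ (k, j)) = B $$ (i, j)"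
        using less(2) by simp
      then show "B $$ (i, j) = (if i = j then 1 else 0)" using ab[of i j] less(2) j by simp
    qed
  qed
  then show ?thesis using B unfolding B_def[symmetric] Ustar_iff by fastforce
qed

section \<open>The cyclic permutation matrix and the group \<open>InU n\<close>\<close>

context
  fixes n :: nat
  assumes n: "n \<ge> 1"
begin

lemma wdot_carrier [simp]: "wdot n \<in> carrier_mat n n"
  by (simp add: wdot_def)

text \<open>The conditional is the cyclic successor of the column index modulo \<open>n\<close>. The
  variant \<open>wdot_index'\<close> uses the cyclic predecessor of the row index.\<close>

lemma wdot_index: "i < n \<Longrightarrow> j < n \<Longrightarrow>
   wdot n $$ (i, j) = (if i = (if j = n - 1 then 0 else j + 1) then 1 else 0)"
  using n by (auto simp: wdot_def)

lemma wdot_index': "i < n \<Longrightarrow> j < n \<Longrightarrow>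
   wdot n $$ (i, j) = (if j = (if i = 0 then n - 1 else i - 1) then 1 else 0)"
  using n by (auto simp: wdot_def)

lemma mult_wdot_index:
  assumes "A \<in> carrier_mat n n" "i < n" "j < n"
  shows "(A * wdot n) $$ (i, j) = (A :: 'k::field mat) $$ (i, if j = n - 1 then 0 else j + 1)"
proof -
  have "(A * wdot n) $$ (i, j) = (\<Sum>k\<in>{0..<n}. A $$ (i, k) * wdot n $$ (k, j))"
    using assms by (intro mat_mult_index) simp_all
  also have "\<dots> = (\<Sum>k\<in>{0..<n}. if k = (if j = n - 1 then 0 else j + 1) then A $$ (i, k) else 0)"
    using assms by (intro sum.cong) (auto simp: wdot_index)
  also have "\<dots> = A $$ (i, if j = n - 1 then 0 else j + 1)"
    using n assms by (subst sum.delta) auto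
  finally show ?thesis .
qed

lemma wdot_mult_index:
  assumes "A \<in> carrier_mat n n" "i < n" "j < n"
  shows "(wdot n * A) $$ (i, j) = (A :: 'k::field mat) $$ (if i = 0 then n - 1 else i - 1, j)"
proof -
  have "(wdot n * A) $$ (i, j) = (\<Sum>k\<in>{0..<n}. wdot n $$ (i, k) * A $$ (k, j))"
    using assms by (intro mat_mult_index) simp_all
  also have "\<dots> = (\<Sum>k\<in>{0..<n}. if k = (if i = 0 then n - 1 else i - 1) then A $$ (k, j) else 0)"
    using assms by (intro sum.cong) (auto simp: wdot_index')
  also have "\<dots> = A $$ (if i = 0 then n - 1 else i - 1, j)"
    using n assms by (subst sum.delta) auto
  finally show ?thesis .
qed

lemma det_wdot: "det (wdot n :: 'k::field mat) = (-1) ^ (n - 1)"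
proof -
  have "mat_delete (wdot n) 0 (n - 1) = (1\<^sub>m (n - 1) :: 'k mat)"
    by (rule eq_matI) (auto simp: mat_delete_def wdot_def)
  then have c: "cofactor (wdot n :: 'k mat) 0 (n - 1) = (-1) ^ (n - 1)"
    by (simp add: cofactor_def)
  have "det (wdot n :: 'k mat) = (\<Sum>j<n. wdot n $$ (0, j) * cofactor (wdot n) 0 j)"
    using n by (intro laplace_expansion_row wdot_carrier) auto
  also have "\<dots> = (\<Sum>j<n. if j = n - 1 then cofactor (wdot n) 0 j else 0)"
    using n by (intro sum.cong) (auto simp: wdot_index')
  finally show ?thesis using n c by simp
qed

lemma det_wdot_nz [simp]: "det (wdot n :: 'k::field mat) \<noteq> 0"
  by (simp add: det_wdot)

lemmas minv_wdot_carrier [simp] = minv_carrier[OF wdot_carrier det_wdot_nz]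

lemma minv_wdot_mult_index:
  assumes A: "A \<in> carrier_mat n n" and "i < n" "j < n"
  shows "(minv (wdot n) * A) $$ (i, j) = (A :: 'k::field mat) $$ (if i = n - 1 then 0 else i + 1, j)"
proof -
  define B where "B = minv (wdot n) * A"
  have B: "B \<in> carrier_mat n n" using A by (simp add: B_def)
  have "A = wdot n * B" unfolding B_def using mult_minv_cancel(1)[OF wdot_carrier det_wdot_nz A] by simp
  then have "A $$ (if i = n - 1 then 0 else i + 1, j) = B $$ (i, j)"
    using wdot_mult_index[OF B, of "if i = n - 1 then 0 else i + 1" j] assms by auto
  then show ?thesis by (simp add: B_def)
qed

lemma ad_minv_wdot: "A \<in> carrier_mat n n \<Longrightarrow> ad (minv (wdot n)) A = minv (wdot n) * A * wdot n"
  by (simp add: ad_def minv_minv[OF wdot_carrier det_wdot_nz])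

lemma ad_minv_wdot_carrier: "A \<in> carrier_mat n n \<Longrightarrow> ad (minv (wdot n)) A \<in> carrier_mat n n"
  by (simp add: ad_minv_wdot)

text \<open>Conjugation shifts both indices cyclically by one, so it turns a block matrix
  \<open>1 \<oplus> a\<close> into \<open>a \<oplus> 1\<close>.\<close>

lemma ad_minv_wdot_index:
  assumes A: "A \<in> carrier_mat n n" and ij: "i < n" "j < n"
  shows "ad (minv (wdot n)) A $$ (i, j) =
    (A :: 'k::field mat) $$ (if i = n - 1 then 0 else i + 1, if j = n - 1 then 0 else j + 1)"
proof -
  have "minv (wdot n) * A \<in> carrier_mat n n" using A by simp
  then show ?thesis
    unfolding ad_minv_wdot[OF A] using ij by (simp only: mult_wdot_index) (subst minv_wdot_mult_index[OF A]; auto)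
qed

lemma ad_minv_wdot_mult:
  assumes "A \<in> carrier_mat n n" "B \<in> carrier_mat n n"
  shows "ad (minv (wdot n)) (A * B) = ad (minv (wdot n)) A * ad (minv (wdot n)) (B :: 'k::field mat)"
proof -
  note c = assms
  have "minv (wdot n) * A * wdot n * (minv (wdot n) * B * wdot n) =
    minv (wdot n) * A * (wdot n * (minv (wdot n) * (B * wdot n)))"
    using c by (simp add: assoc_mult_mat[of _ n n _ n _ n])
  also have "\<dots> = minv (wdot n) * (A * B) * wdot n"
    using c mult_minv_cancel(1)[OF wdot_carrier det_wdot_nz, of "B * wdot n" n]
    by (simp add: assoc_mult_mat[of _ n n _ n _ n])
  finally show ?thesis using assms by (simp add: ad_minv_wdot)
qed

text \<open>The cyclic shift carries the first row of \<open>u\<close> to the last row of its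
  conjugate, and triangularity there kills all entries but the diagonal one. So \<open>InU n\<close>
  consists of the matrices \<open>1 \<oplus> a\<close> with \<open>a\<close> upper unitriangular of
  size \<open>n - 1\<close>.\<close>

lemma InU_iff: "u \<in> InU n \<longleftrightarrow> u \<in> Ustar n \<and> (\<forall>j<n. 0 < j \<longrightarrow> (u :: 'k::field mat) $$ (0, j) = 0)"
proof
  assume u: "u \<in> InU n"
  then obtain v where v: "v \<in> Ustar n" "u = ad (wdot n) v" unfolding InU_def by blast
  have vc: "v \<in> carrier_mat n n" using v by (simp add: Ustar_iff)
  have uc: "u \<in> carrier_mat n n" using u by (simp add: InU_def Ustar_iff)
  have "minv (wdot n) * u * wdot n = minv (wdot n) * (wdot n * (v * (minv (wdot n) * wdot n)))"
    unfolding v(2) ad_def using vc 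
    by (simp add: assoc_mult_mat[of _ n n _ n _ n])
  also have "\<dots> = v"
    using vc mult_minv_cancel(2)[OF wdot_carrier det_wdot_nz vc] by (simp add: minv_left[OF wdot_carrier det_wdot_nz])
  finally have "ad (minv (wdot n)) u = v" using ad_minv_wdot[OF uc] by simp
  then have "u $$ (0, j) = 0" if j: "j < n" "0 < j" for j
  proof -
    obtain k where k: "j = Suc k" using j by (cases j) auto
    then have "v $$ (n - 1, k) = 0" using v(1) j by (simp add: Ustar_iff)
    then show ?thesis
      using \<open>ad (minv (wdot n)) u = v\<close> ad_minv_wdot_index[OF uc, of "n - 1" k] j k
      by (simp split: if_splits)
  qed
  then show "u \<in> Ustar n \<and> (\<forall>j<n. 0 < j \<longrightarrow> u $$ (0, j) = 0)" using u by (simp add: InU_def)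
next
  assume u: "u \<in> Ustar n \<and> (\<forall>j<n. 0 < j \<longrightarrow> u $$ (0, j) = 0)"
  have uc: "u \<in> carrier_mat n n" using u by (simp add: Ustar_iff)
  define v where "v = ad (minv (wdot n)) u"
  have "v \<in> Ustar n"
    unfolding Ustar_iff v_def using ad_minv_wdot_carrier[OF uc] ad_minv_wdot_index[OF uc] u
    by (auto simp: Ustar_iff)
  moreover have "u = ad (wdot n) v"
  proof -
    have "ad (wdot n) v = wdot n * (minv (wdot n) * (u * (wdot n * minv (wdot n))))"
      unfolding v_def ad_minv_wdot[OF uc] unfolding ad_def using uc 
      by (simp add: assoc_mult_mat[of _ n n _ n _ n])
    then show ?thesis
      using uc mult_minv_cancel(1)[OF wdot_carrier det_wdot_nz uc] by (simp add: minv_right[OF wdot_carrier det_wdot_nz])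
  qed
  ultimately show "u \<in> InU n" using u by (auto simp: InU_def)
qed

lemma InU_Ustar: "u \<in> InU n \<Longrightarrow> u \<in> Ustar n"
  by (simp add: InU_def)

lemma InU_one: "1\<^sub>m n \<in> InU n"
  unfolding InU_iff Ustar_iff by auto

lemma InU_mult:
  assumes "u \<in> InU n" "v \<in> InU n"
  shows "u * v \<in> InU n"
proof -
  have u: "u \<in> Ustar n" "\<forall>j<n. 0 < j \<longrightarrow> u $$ (0, j) = 0" "u \<in> carrier_mat n n"
   and v: "v \<in> Ustar n" "\<forall>j<n. 0 < j \<longrightarrow> v $$ (0, j) = 0" "v \<in> carrier_mat n n"
    using assms by (auto simp: InU_iff Ustar_iff)
  have "(u * v) $$ (0, j) = 0" if "j < n" "0 < j" for j
  proof -
    have "(u * v) $$ (0, j) = (\<Sum>k\<in>{0..<n}. u $$ (0, k) * v $$ (k, j))"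
      using that u v by (intro mat_mult_index[of _ n n _ n]) auto
    also have "\<dots> = 0"
    proof (intro sum.neutral ballI)
      fix k assume "k \<in> {0..<n}"
      then show "u $$ (0, k) * v $$ (k, j) = 0" using u(2) v(2) that by (cases "k = 0") auto
    qed
    finally show ?thesis .
  qed
  then show ?thesis using Ustar_mult[OF u(1) v(1)] by (simp add: InU_iff)
qed

lemma InU_minv:
  assumes "u \<in> InU n"
  shows "minv u \<in> InU n"
proof -
  have u: "u \<in> Ustar n" "\<forall>j<n. 0 < j \<longrightarrow> u $$ (0, j) = 0" "u \<in> carrier_mat n n"
    using assms by (auto simp: InU_iff Ustar_iff)
  have d: "det u \<noteq> 0" using Ustar_det[OF u(1)] by simp
  note m = minv_carrier[OF u(3) d]
  have "minv u $$ (0, j) = 0" if j: "j < n" "0 < j" for j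
  proof -
    have "(\<Sum>k\<in>{0..<n}. u $$ (0, k) * minv u $$ (k, j)) = (u * minv u) $$ (0, j)"
      using j u m by (intro mat_mult_index[of _ n n _ n, symmetric]) auto
    also have "\<dots> = 0" unfolding minv_right[OF u(3) d] using j by simp
    also have "(\<Sum>k\<in>{0..<n}. u $$ (0, k) * minv u $$ (k, j)) =
      (\<Sum>k\<in>{0..<n}. if k = 0 then minv u $$ (0, j) else 0)"
      using u by (intro sum.cong) (auto simp: Ustar_iff)
    finally show ?thesis using j by simp
  qed
  then show ?thesis using Ustar_minv[OF u(1)] by (simp add: InU_iff)
qed

end

text \<open>Rows start at 0, hence \<open>c (i + 1)\<close> in row \<open>i\<close>. The diagonal
  takes precedence in the corner, so the matrix depends on \<open>c 1, ..., c (n - 1)\<close>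
  alone.\<close>

definition unicol :: "nat \<Rightarrow> (nat \<Rightarrow> 'k::field) \<Rightarrow> 'k mat" where
  "unicol n c = mat n n (\<lambda>(i, j). if i = j then 1 else if j = n - 1 then - c (i + 1) else 0)"

lemma unicol_carrier [simp]: "unicol n c \<in> carrier_mat n n"
  by (simp add: unicol_def)

lemma unicol_Ustar: "unicol n c \<in> Ustar n"
  by (auto simp: Ustar_iff unicol_def)

lemma unicol_cong: "(\<And>i. i \<in> {1..n - 1} \<Longrightarrow> c i = d i) \<Longrightarrow> unicol n c = unicol n d"
  unfolding unicol_def by (rule eq_matI) auto

lemma unicol_inj:
  assumes "unicol n c = unicol n d" "i \<in> {1..n - 1}"
  shows "c i = d i"
proof -
  obtain j where j: "i = Suc j" "j < n - 1" using assms(2) by (cases i) auto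
  have "unicol n a $$ (j, n - 1) = - a i" for a :: "nat \<Rightarrow> 'a"
    using j by (simp add: unicol_def)
  then show ?thesis using assms(1) by (metis neg_equal_iff_equal)
qed

lemma unicol_mult_index:
  assumes "A \<in> carrier_mat n n" "i < n" "j < n"
  shows "(unicol n c * A) $$ (i, j) = A $$ (i, j) + (if i = n - 1 then 0 else - c (i + 1) * A $$ (n - 1, j))"
proof -
  have "(unicol n c * A) $$ (i, j) = (\<Sum>k\<in>{0..<n}. unicol n c $$ (i, k) * A $$ (k, j))"
    using assms by (intro mat_mult_index) simp_all
  also have "\<dots> = (\<Sum>k\<in>{0..<n}. (if k = i then A $$ (k, j) else 0) +
      (if k = n - 1 then if i = n - 1 then 0 else - c (i + 1) * A $$ (k, j) else 0))"
    using assms by (intro sum.cong) (auto simp: unicol_def)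
  finally show ?thesis using assms by (simp add: sum.distrib)
qed

lemma mult_unicol_index:
  assumes "A \<in> carrier_mat n n" "i < n" "j < n"
  shows "(A * unicol n c) $$ (i, j) = (if j = n - 1 then A $$ (i, n - 1) - (\<Sum>k<n - 1. c (k + 1) * A $$ (i, k))
     else A $$ (i, j))"
proof -
  have e: "(A * unicol n c) $$ (i, j) = (\<Sum>k<n. A $$ (i, k) * unicol n c $$ (k, j))"
    using assms unfolding lessThan_atLeast0 by (intro mat_mult_index) simp_all
  show ?thesis
  proof (cases "j = n - 1")
    case True
    obtain m where m: "n = Suc m" using assms by (cases n) auto
    have "(\<Sum>k<n. A $$ (i, k) * unicol n c $$ (k, j)) =
       A $$ (i, m) + (\<Sum>k<m. A $$ (i, k) * unicol n c $$ (k, j))"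
      using True unfolding m by (simp add: unicol_def)
    also have "(\<Sum>k<m. A $$ (i, k) * unicol n c $$ (k, j)) = (\<Sum>k<m. - (c (k + 1) * A $$ (i, k)))"
      using True m by (intro sum.cong) (auto simp: unicol_def)
    finally show ?thesis using True m e by (simp add: sum_negf)
  next
    case False
    have "(\<Sum>k<n. A $$ (i, k) * unicol n c $$ (k, j)) = (\<Sum>k<n. if k = j then A $$ (i, k) else 0)"
      using False assms by (intro sum.cong) (auto simp: unicol_def)
    then show ?thesis using e False assms by simp
  qed
qed

text \<open>Composition is only asked to be the action of some element \<open>k\<close> of the
  carrier. This covers right multiplication, where products occur in reversed order, along with left
  multiplication and \<open>\<rho>\<close>.\<close>

lemma orbit_eq_iff:
  assumes one: "e \<in> carrier G" "\<And>x. x \<in> E \<Longrightarrow> \<phi> e x = x"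
    and comp: "\<And>g h x. g \<in> carrier G \<Longrightarrow> h \<in> carrier G \<Longrightarrow> x \<in> E \<Longrightarrow> \<exists>k\<in>carrier G. \<phi> g (\<phi> h x) = \<phi> k x"
    and inv: "\<And>g x. g \<in> carrier G \<Longrightarrow> x \<in> E \<Longrightarrow> \<exists>h\<in>carrier G. \<phi> h (\<phi> g x) = x"
    and xy: "x \<in> E" "y \<in> E"
  shows "orbit G \<phi> x = orbit G \<phi> y \<longleftrightarrow> (\<exists>g\<in>carrier G. y = \<phi> g x)"
proof
  have "y \<in> orbit G \<phi> y" using one xy unfolding orbit_def by force
  then show "orbit G \<phi> x = orbit G \<phi> y \<Longrightarrow> \<exists>g\<in>carrier G. y = \<phi> g x"
    unfolding orbit_def by blast
  have sub: "orbit G \<phi> (\<phi> g x) \<subseteq> orbit G \<phi> x" if "g \<in> carrier G" "x \<in> E" for g x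
  proof
    fix z assume "z \<in> orbit G \<phi> (\<phi> g x)"
    then obtain h where h: "h \<in> carrier G" "z = \<phi> h (\<phi> g x)" unfolding orbit_def by blast
    then show "z \<in> orbit G \<phi> x" using comp[OF h(1) that] unfolding orbit_def by auto
  qed
  assume "\<exists>g\<in>carrier G. y = \<phi> g x"
  then obtain g where g: "g \<in> carrier G" "y = \<phi> g x" by blast
  obtain h where h: "h \<in> carrier G" "\<phi> h y = x" using inv[OF g(1) xy(1)] g(2) by blast
  show "orbit G \<phi> x = orbit G \<phi> y"
    using sub[OF g(1) xy(1)] sub[OF h(1) xy(2)] g(2) h(2) by simp
qed

section \<open>Normal forms for the action \<open>\<rho>\<close>\<close>

text \<open>For \<open>u = 1 \<oplus> a\<close> in \<open>InU\<close>, the matrix \<open>\<rho> u v\<close> differs from the identity only in its last column iff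
  the entries of \<open>a\<close> satisfy this recursion.\<close>

function alpha :: "nat \<Rightarrow> 'k::field mat \<Rightarrow> nat \<Rightarrow> nat \<Rightarrow> 'k" where
  "alpha q v i j = (if j < i then 0 else if i = j then 1 else
     (if i = 0 then 0 else alpha q v (i - 1) (j - 1) ^ q) - (\<Sum>l\<in>{i..<j}. alpha q v i l * v $$ (l, j)))"
  by pat_completeness auto
termination by (relation "measure (\<lambda>(q, v, i, j). j)") auto

declare alpha.simps [simp del]

definition mat_entry :: "'k mat \<Rightarrow> nat \<times> nat \<Rightarrow> 'k" where
  "mat_entry A ij = A $$ ij"

abbreviation matfun :: "nat \<Rightarrow> 'k::field mat set \<Rightarrow> ('k mat \<Rightarrow> 'k) set" where
  "matfun n S \<equiv> polyfun S mat_entry ({..<n} \<times> {..<n})"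

lemma matfun_entry: "i < n \<Longrightarrow> j < n \<Longrightarrow> (\<lambda>A. A $$ (i, j)) \<in> matfun n S"
  using polyfun_coord[of "(i, j)" "{..<n} \<times> {..<n}" mat_entry S] by (simp add: mat_entry_def)

text \<open>The recursion expresses an entry in column \<open>j\<close> polynomially through entries
  of earlier columns and of \<open>v\<close>.\<close>

lemma matfun_alpha: "j < n \<Longrightarrow> (\<lambda>v. alpha q v i j) \<in> matfun n S"
proof (induct j arbitrary: i rule: less_induct)
  case (less j)
  consider "j < i" | "i = j" | "i < j" by linarith
  then show ?case
  proof cases
    case 3
    have "(\<lambda>v. (if i = 0 then 0 else alpha q v (i - 1) (j - 1) ^ q) -
        (\<Sum>l\<in>{i..<j}. alpha q v i l * v $$ (l, j))) \<in> matfun n S"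
    proof (intro polyfun_diff polyfun_sum polyfun_mult)
      show "(\<lambda>v. if i = 0 then 0 else alpha q v (i - 1) (j - 1) ^ q) \<in> matfun n S"
        using less 3 by (cases "i = 0") (simp_all add: polyfun_const polyfun_power)
    next
      fix l assume "l \<in> {i..<j}"
      then show "(\<lambda>v. alpha q v i l) \<in> matfun n S" "(\<lambda>v. v $$ (l, j)) \<in> matfun n S"
        using less by (auto intro: matfun_entry)
    qed
    then show ?thesis using 3 by (subst alpha.simps) simp
  qed (subst alpha.simps, simp add: polyfun_const)+
qed

section \<open>Frobenius on matrices and orbits of \<open>\<rho>\<close>\<close>

context frob_field
begin

lemma n_pos [simp]: "0 < n" "n - Suc 0 < n" "Suc 0 \<le> n"
  using n by auto

abbreviation w :: "'k mat" where "w \<equiv> wdot n"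

lemma frob_carrier [simp]: "A \<in> carrier_mat n m \<Longrightarrow> frob q A \<in> carrier_mat n m"
  by (simp add: frob_def)

lemma frob_index: "A \<in> carrier_mat n n \<Longrightarrow> i < n \<Longrightarrow> j < n \<Longrightarrow> frob q A $$ (i, j) = A $$ (i, j) ^ q"
  by (simp add: frob_def)

lemma frob_mult: "A \<in> carrier_mat n n \<Longrightarrow> B \<in> carrier_mat n n \<Longrightarrow>
    frob q (A * B) = frob q A * frob q (B :: 'k mat)"
  unfolding frob_def by (rule frob.mat_hom_mult)

lemma frob_one: "frob q (1\<^sub>m n) = (1\<^sub>m n :: 'k mat)"
  unfolding frob_def by (rule frob.mat_hom_one)

lemma frob_det: "det (frob q A) = det (A :: 'k mat) ^ q"
  unfolding frob_def by (rule frob.hom_det)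

lemma frob_minv:
  assumes A: "A \<in> carrier_mat n n" "det A \<noteq> (0 :: 'k)"
  shows "frob q (minv A) = minv (frob q A)"
  using minv_eqI[of "frob q A" n "frob q (minv A)"] A minv_carrier[OF A] minv_right[OF A]
  by (simp add: frob_mult[symmetric] frob_one)

lemma frob_Ustar: "A \<in> Ustar n \<Longrightarrow> frob q (A :: 'k mat) \<in> Ustar n"
  unfolding Ustar_iff by (simp add: frob_index)

lemma Ustar_carrier: "A \<in> Ustar n \<Longrightarrow> A \<in> carrier_mat n n"
  by (simp add: Ustar_iff)

lemma Ustar_det_nz: "A \<in> Ustar n \<Longrightarrow> det A \<noteq> (0 :: 'k)"
  by (simp add: Ustar_det)

abbreviation adw :: "'k mat \<Rightarrow> 'k mat" where "adw \<equiv> ad (minv w)"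

lemmas adw_carrier [simp] = ad_minv_wdot_carrier[OF n]

lemma rho_mult:
  fixes u u' v :: "'k mat"
  assumes u: "u \<in> InU n" and u': "u' \<in> InU n" and v: "v \<in> Ustar n"
  shows "rho q n u (rho q n u' v) = rho q n (u * u') v"
proof -
  note U = InU_Ustar[OF n u] InU_Ustar[OF n u']
  note c = Ustar_carrier[OF U(1)] Ustar_carrier[OF U(2)] Ustar_carrier[OF v]
    Ustar_carrier[OF Ustar_minv[OF U(1)]] Ustar_carrier[OF Ustar_minv[OF U(2)]]
  have "minv (u * u') = minv u' * minv u"
    using minv_mult[OF c(1) Ustar_det_nz[OF U(1)] c(2) Ustar_det_nz[OF U(2)]] .
  then show ?thesis
    unfolding rho_def ad_minv_wdot_mult[OF n c(1,2)] using c
    by (simp add: frob_mult assoc_mult_mat[of _ n n _ n _ n])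
qed

lemma rho_one: "v \<in> Ustar n \<Longrightarrow> rho q n (1\<^sub>m n) v = (v :: 'k mat)"
  using Ustar_carrier[of v] by (simp add: rho_def ad_minv_wdot[OF n] minv_one frob_one
      minv_left[OF wdot_carrier[OF n] det_wdot_nz[OF n]] right_mult_one_mat[OF minv_wdot_carrier[OF n]])

lemma rho_minv:
  fixes u v :: "'k mat"
  assumes u: "u \<in> InU n" and v: "v \<in> Ustar n"
  shows "rho q n (minv u) (rho q n u v) = v"
  using rho_mult[OF InU_minv[OF n u] u v] rho_one[OF v]
    minv_left[OF Ustar_carrier[OF InU_Ustar[OF n u]] Ustar_det_nz[OF InU_Ustar[OF n u]]] by simp

lemma rho_orbit_eq_iff:
  fixes v v' :: "'k mat"
  assumes "v \<in> Ustar n" "v' \<in> Ustar n"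
  shows "rho_orbit q n v = rho_orbit q n v' \<longleftrightarrow> (\<exists>u\<in>InU n. v' = rho q n u (v :: 'k mat))"
proof -
  have car: "carrier (matrix_group n (InU n)) = InU n" by (simp add: matrix_group_def)
  show ?thesis
    unfolding rho_orbit_def
  proof (rule orbit_eq_iff[where E = "Ustar n" and e = "1\<^sub>m n" and \<phi> = "rho q n" and G = "matrix_group n (InU n)", unfolded car])
    fix g h :: "'k mat" and x :: "'k mat"
    assume g: "g \<in> InU n" and x: "x \<in> Ustar n"
    show "\<exists>h\<in>InU n. rho q n h (rho q n g x) = x"
      using rho_minv[OF g x] InU_minv[OF n g] by blast
    assume h: "h \<in> InU n"
    show "\<exists>k\<in>InU n. rho q n g (rho q n h x) = rho q n k x"
      using rho_mult[OF g h x] InU_mult[OF n g h] by blast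
  qed (simp_all add: assms InU_one[OF n] rho_one)
qed

text \<open>Multiplying by \<open>frob q u\<close> removes the inverse and leaves an equation that
  can be compared entry by entry.\<close>

lemma rho_eq_iff:
  fixes u v v' :: "'k mat"
  assumes u: "u \<in> InU n" and v: "v \<in> Ustar n" and v': "v' \<in> carrier_mat n n"
  shows "rho q n u v = v' \<longleftrightarrow> adw u * v = v' * frob q u"
proof -
  note U = InU_Ustar[OF n u]
  note c = Ustar_carrier[OF U] Ustar_carrier[OF v] v'
  note F = Ustar_carrier[OF frob_Ustar[OF U]] Ustar_det_nz[OF frob_Ustar[OF U]]
  note Fm = minv_carrier[OF F] minv_left[OF F] minv_right[OF F]
  have e: "rho q n u v = adw u * v * minv (frob q u)"
    unfolding rho_def frob_minv[OF c(1) Ustar_det_nz[OF U]] ..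
  show ?thesis
  proof
    assume "rho q n u v = v'"
    then have "v' * frob q u = adw u * v * minv (frob q u) * frob q u" using e by simp
    also have "\<dots> = adw u * v" using c F Fm by (simp add: assoc_mult_mat[of _ n n _ n _ n])
    finally show "adw u * v = v' * frob q u" ..
  next
    assume "adw u * v = v' * frob q u"
    then have "rho q n u v = v' * frob q u * minv (frob q u)" using e by simp
    also have "\<dots> = v'" using c F Fm by (simp add: assoc_mult_mat[of _ n n _ n _ n])
    finally show "rho q n u v = v'" .
  qed
qed

text \<open>Away from the last row and column both sides of \<open>rho_eq_iff\<close> reduce to one
  entry, giving \<open>u $$ (i + 1, j + 1) = u $$ (i, j) ^ q\<close>. The first row of
  \<open>u\<close> vanishes off the diagonal, and this propagates along the diagonals.\<close>

lemma rho_unicol_imp_one: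
  fixes u :: "'k mat"
  assumes u: "u \<in> InU n" and e: "rho q n u (unicol n c) = unicol n d"
  shows "u = 1\<^sub>m n"
proof -
  have U: "u \<in> Ustar n" and row0: "\<And>j. j < n \<Longrightarrow> 0 < j \<Longrightarrow> u $$ (0, j) = 0"
    using u by (auto simp: InU_iff[OF n])
  note uc = Ustar_carrier[OF U]
  have e': "adw u * unicol n c = unicol n d * frob q u"
    using e rho_eq_iff[OF u unicol_Ustar unicol_carrier] by simp
  have step: "u $$ (i + 1, j + 1) = u $$ (i, j) ^ q" if ij: "i < n - 1" "j < n - 1" for i j
  proof -
    have "(adw u * unicol n c) $$ (i, j) = u $$ (i + 1, j + 1)"
      using ij uc by (subst mult_unicol_index) (auto simp: ad_minv_wdot_index)
    moreover have "(unicol n d * frob q u) $$ (i, j) = u $$ (i, j) ^ q"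
      using ij uc U by (subst unicol_mult_index) (auto simp: frob_index Ustar_iff)
    ultimately show ?thesis using e' by simp
  qed
  have zero: "u $$ (i, j) = 0" if "i < j" "j < n" for i j
    using that
  proof (induct i arbitrary: j)
    case 0
    then show ?case using row0 by simp
  next
    case (Suc i)
    then obtain k where k: "j = Suc k" by (cases j) auto
    then show ?case using step[of i k] Suc by auto
  qed
  show ?thesis
  proof (rule eq_matI)
    fix i j assume "i < dim_row (1\<^sub>m n :: 'k mat)" "j < dim_col (1\<^sub>m n :: 'k mat)"
    then show "u $$ (i, j) = 1\<^sub>m n $$ (i, j)"
      using zero U by (cases i j rule: linorder_cases) (auto simp: Ustar_iff)
  qed (use uc in auto)
qed

lemma rho_unicol_unique:
  fixes u :: "'k mat"
  assumes u: "u \<in> InU n" and e: "rho q n u (unicol n c) = unicol n d"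
  shows "unicol n c = (unicol n d :: 'k mat)"
  using e rho_one[OF unicol_Ustar] unfolding rho_unicol_imp_one[OF u e] by simp

text \<open>The block matrix \<open>1 \<oplus> a\<close>, where \<open>a\<close> has size
  \<open>n - 1\<close> and entries \<open>alpha q v i j\<close>.\<close>

definition ucorr :: "'k mat \<Rightarrow> 'k mat" where
  "ucorr v = mat n n (\<lambda>(i, j). if i = 0 \<or> j = 0 then (if i = j then 1 else 0) else alpha q v (i - 1) (j - 1))"

lemma alpha_below [simp]: "j < i \<Longrightarrow> alpha q v i j = 0" and alpha_diag [simp]: "alpha q v i i = 1"
  by (subst alpha.simps, simp)+

lemma ucorr_InU: "ucorr v \<in> InU n"
  unfolding InU_iff[OF n] Ustar_iff by (auto simp: ucorr_def)

lemma ucorr_carrier [simp]: "ucorr v \<in> carrier_mat n n"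
  by (simp add: ucorr_def)

text \<open>Obtained by solving the last column of \<open>adw u * v = unicol n c * frob q u\<close>,
  with \<open>u = ucorr v\<close>, for \<open>c\<close>. The parameter with index \<open>i\<close>
  sits in row \<open>i - 1\<close>.\<close>

definition nfc :: "'k mat \<Rightarrow> nat \<Rightarrow> 'k" where
  "nfc v i = frob q (ucorr v) $$ (i - 1, n - 1) - (adw (ucorr v) * v) $$ (i - 1, n - 1)"

lemma adw_ucorr_index:
  assumes "i < n" "j < n"
  shows "adw (ucorr v) $$ (i, j) = (if i = n - 1 \<or> j = n - 1 then (if i = j then 1 else 0) else alpha q v i j)"
  using assms by (subst ad_minv_wdot_index) (auto simp: ucorr_def)

text \<open>In the equation of \<open>rho_eq_iff\<close> the last row is trivial, the last column
  holds by the choice of \<open>nfc\<close>, and the remaining entries are the recursion for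
  \<open>alpha\<close>.\<close>

lemma rho_ucorr:
  fixes v :: "'k mat"
  assumes v: "v \<in> Ustar n"
  shows "rho q n (ucorr v) v = unicol n (nfc v)"
  unfolding rho_eq_iff[OF ucorr_InU v unicol_carrier]
proof (rule eq_matI)
  note vc = Ustar_carrier[OF v]
  have dims: "adw (ucorr v) * v \<in> carrier_mat n n" "unicol n (nfc v) * frob q (ucorr v) \<in> carrier_mat n n"
    using vc by simp_all
  show "dim_row (adw (ucorr v) * v) = dim_row (unicol n (nfc v) * frob q (ucorr v))"
    "dim_col (adw (ucorr v) * v) = dim_col (unicol n (nfc v) * frob q (ucorr v))"
    using dims by (metis carrier_matD)+
  fix i j assume "i < dim_row (unicol n (nfc v) * frob q (ucorr v))"
    "j < dim_col (unicol n (nfc v) * frob q (ucorr v))"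
  then have ij: "i < n" "j < n" unfolding carrier_matD[OF dims(2)] by auto
  have last: "frob q (ucorr v) $$ (n - 1, j) = (if j = n - 1 then 1 else 0)"
    using frob_Ustar[OF InU_Ustar[OF n ucorr_InU[of v]]] ij n unfolding Ustar_iff by fastforce
  have L: "(adw (ucorr v) * v) $$ (i, j) = (\<Sum>k\<in>{0..<n}. adw (ucorr v) $$ (i, k) * v $$ (k, j))"
    using ij vc by (intro mat_mult_index) auto
  have R: "(unicol n (nfc v) * frob q (ucorr v)) $$ (i, j) = frob q (ucorr v) $$ (i, j) +
      (if i = n - 1 then 0 else - nfc v (i + 1) * (if j = n - 1 then 1 else 0))"
    using unicol_mult_index[of "frob q (ucorr v)" n i j "nfc v"] ij unfolding last by simp
  show "(adw (ucorr v) * v) $$ (i, j) = (unicol n (nfc v) * frob q (ucorr v)) $$ (i, j)"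
  proof (cases "i = n - 1")
    case True
    have "(adw (ucorr v) * v) $$ (i, j) = (\<Sum>k\<in>{0..<n}. if k = n - 1 then v $$ (n - 1, j) else 0)"
      unfolding L using ij True by (intro sum.cong) (auto simp: adw_ucorr_index)
    also have "\<dots> = (if j = n - 1 then 1 else 0)"
      using v ij by (auto simp: Ustar_iff)
    finally show ?thesis using True R last by simp
  next
    case i: False
    show ?thesis
    proof (cases "j = n - 1")
      case True
      then show ?thesis using R i by (simp add: nfc_def)
    next
      case j: False
      have fu: "frob q (ucorr v) $$ (i, j) =
        (if i = 0 then if j = 0 then 1 else 0 else if j = 0 then 0 else alpha q v (i - 1) (j - 1) ^ q)"
        using ij by (subst frob_index) (auto simp: ucorr_def)
      have "(adw (ucorr v) * v) $$ (i, j) = (\<Sum>k\<in>{i..j}. alpha q v i k * v $$ (k, j))"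
        unfolding L
      proof (rule sum.mono_neutral_cong_right)
        show "\<forall>k\<in>{0..<n} - {i..j}. adw (ucorr v) $$ (i, k) * v $$ (k, j) = 0"
        proof
          fix k assume k: "k \<in> {0..<n} - {i..j}"
          show "adw (ucorr v) $$ (i, k) * v $$ (k, j) = 0"
          proof (cases "k < i")
            case True
            then show ?thesis using ij i k by (simp add: adw_ucorr_index)
          next
            case False
            then show ?thesis using v k by (simp add: Ustar_iff)
          qed
        qed
      qed (use ij j i in \<open>auto simp: adw_ucorr_index\<close>)
      also have "\<dots> = frob q (ucorr v) $$ (i, j)"
      proof (cases i j rule: linorder_cases)
        case less
        \<comment> \<open>The last term of the sum is \<open>alpha q v i j\<close> itself, as
          \<open>v\<close> has unit diagonal; the recursion is this equation solved for that
          term.\<close>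
        have "{i..j} = insert j {i..<j}" using less by auto
        then have "(\<Sum>k\<in>{i..j}. alpha q v i k * v $$ (k, j)) =
            alpha q v i j + (\<Sum>k\<in>{i..<j}. alpha q v i k * v $$ (k, j))"
          using v ij by (simp add: Ustar_iff)
        also have "\<dots> = (if i = 0 then 0 else alpha q v (i - 1) (j - 1) ^ q)"
          using less by (subst alpha.simps) simp
        finally show ?thesis using less fu by auto
      next
        case equal
        then show ?thesis using fu v ij by (auto simp: Ustar_iff)
      next
        case greater
        then show ?thesis using fu by auto
      qed
      finally show ?thesis using R j by simp
    qed
  qed
qed

text \<open>Every orbit meets the matrices \<open>unicol n c\<close> by \<open>rho_ucorr\<close>,
  and in only one matrix by \<open>rho_unicol_unique\<close>.\<close>

lemma rho_orbit_eq_iff_nfc: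
  fixes v v' :: "'k mat"
  assumes v: "v \<in> Ustar n" and v': "v' \<in> Ustar n"
  shows "rho_orbit q n v = rho_orbit q n v' \<longleftrightarrow> unicol n (nfc v) = unicol n (nfc v')"
proof -
  have o: "rho_orbit q n v = rho_orbit q n (unicol n (nfc v))" if "v \<in> Ustar n" for v
    using rho_orbit_eq_iff[OF that unicol_Ustar] rho_ucorr[OF that] ucorr_InU by metis
  have "rho_orbit q n (unicol n (nfc v)) = rho_orbit q n (unicol n (nfc v')) \<longleftrightarrow>
      unicol n (nfc v) = unicol n (nfc v')"
    using rho_orbit_eq_iff[OF unicol_Ustar unicol_Ustar] rho_unicol_unique by metis
  then show ?thesis using o[OF v] o[OF v'] by simp
qed

lemma nfc_unicol: "unicol n (nfc (unicol n c)) = unicol n c"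
  using rho_unicol_unique[OF ucorr_InU rho_ucorr[OF unicol_Ustar]] by simp

lemma matfun_ucorr:
  assumes "i < n" "j < n"
  shows "(\<lambda>v. ucorr v $$ (i, j)) \<in> matfun n S"
proof (rule polyfun_cong)
  show "(\<lambda>v. if i = 0 \<or> j = 0 then (if i = j then 1 else 0) else alpha q v (i - 1) (j - 1)) \<in> matfun n S"
    using assms by (cases "i = 0 \<or> j = 0") (auto intro: polyfun_const matfun_alpha)
qed (use assms in \<open>simp add: ucorr_def\<close>)

lemma matfun_nfc:
  assumes i: "i \<in> {1..n - 1}"
  shows "(\<lambda>v. nfc v i) \<in> matfun n (Ustar n)"
proof -
  have i': "i - 1 < n" using i by auto
  show "(\<lambda>v. nfc v i) \<in> matfun n (Ustar n)"
  proof (rule polyfun_cong)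
    show "(\<lambda>v. ucorr v $$ (i - 1, n - 1) ^ q - (\<Sum>k\<in>{0..<n}.
        (ucorr v $$ (if i - 1 = n - 1 then 0 else i - 1 + 1, if k = n - 1 then 0 else k + 1)) * v $$ (k, n - 1)))
       \<in> matfun n (Ustar n)"
      using i i' by (intro polyfun_diff polyfun_power polyfun_sum polyfun_mult matfun_ucorr matfun_entry) auto
    fix v :: "'k mat" assume v: "v \<in> Ustar n"
    have "(adw (ucorr v) * v) $$ (i - 1, n - 1) =
       (\<Sum>k\<in>{0..<n}. adw (ucorr v) $$ (i - 1, k) * v $$ (k, n - 1))"
      using i' Ustar_carrier[OF v] by (intro mat_mult_index) auto
    then show "nfc v i = ucorr v $$ (i - 1, n - 1) ^ q - (\<Sum>k\<in>{0..<n}.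
        (ucorr v $$ (if i - 1 = n - 1 then 0 else i - 1 + 1, if k = n - 1 then 0 else k + 1)) * v $$ (k, n - 1))"
      unfolding nfc_def using i' by (simp add: frob_index ad_minv_wdot_index)
  qed
qed

end

section \<open>The variety \<open>Q'\<close> and the Lang map\<close>

context frob_field
begin

section \<open>Moore matrices and Dickson elements\<close>

definition Moore :: "(nat \<Rightarrow> 'k) \<Rightarrow> 'k mat" where
  "Moore x = moore q (vec n x)"

lemma Moore_carrier [simp]: "Moore x \<in> carrier_mat n n"
  by (simp add: Moore_def moore_def)

lemma Moore_index: "i < n \<Longrightarrow> j < n \<Longrightarrow> Moore x $$ (i, j) = x i ^ (q ^ j)"
  by (simp add: Moore_def moore_def)

lemma col_Moore: "col (Moore x) 0 = vec n x"
  by (rule eq_vecI) (simp_all add: Moore_def moore_def)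

lemma moore_eq_Moore: "x \<in> carrier_vec n \<Longrightarrow> moore q x = Moore (\<lambda>i. x $ i)"
  unfolding Moore_def by (rule arg_cong[of _ _ "moore q"]) auto

text \<open>A relation among the \<open>x i\<close> over \<open>F\<close> persists under
  \<open>q\<close>-th powers and becomes a relation among the rows. Conversely, a relation among the
  columns is a nonzero additive polynomial of degree at most \<open>q ^ (n - 1)\<close> vanishing on
  the span, which has \<open>q ^ n\<close> elements if the \<open>x i\<close> are
  independent.\<close>

lemma det_Moore_iff: "det (Moore x) \<noteq> 0 \<longleftrightarrow> inj_on (lin n x) (scalars n)"
proof
  assume d: "det (Moore x) \<noteq> 0"
  show "inj_on (lin n x) (scalars n)"
  proof (rule inj_linI)
    fix l assume l: "l \<in> scalars n" "lin n x l = 0"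
    have T: "(Moore x)\<^sup>T \<in> carrier_mat n n" by simp
    have "(Moore x)\<^sup>T *\<^sub>v vec n l = 0\<^sub>v n"
    proof (rule eq_vecI)
      fix j assume j: "j < dim_vec (0\<^sub>v n :: 'k vec)"
      have "((Moore x)\<^sup>T *\<^sub>v vec n l) $ j = (\<Sum>i\<in>{0..<n}. x i ^ (q ^ j) * l i)"
        using j carrier_matD[OF Moore_carrier[of x]] by (simp add: scalar_prod_def Moore_index)
      also have "\<dots> = lin n x l ^ (q ^ j)"
        using lin_qpow[OF l(1), of x j] by (simp add: lin_def lessThan_atLeast0 mult.commute)
      finally show "((Moore x)\<^sup>T *\<^sub>v vec n l) $ j = 0\<^sub>v n $ j" using l j by simp
    qed (use carrier_matD[OF Moore_carrier[of x]] in simp)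
    then have "vec n l = 0\<^sub>v n"
      using d det_0_iff_vec_prod_zero_field[OF T] det_transpose[OF Moore_carrier[of x]] vec_carrier[of n l]
      by metis
    then show "\<forall>i<n. l i = 0" by (metis index_vec index_zero_vec(1))
  qed
next
  assume inj: "inj_on (lin n x) (scalars n)"
  show "det (Moore x) \<noteq> 0"
  proof
    assume "det (Moore x) = 0"
    then obtain v where v: "v \<in> carrier_vec n" "v \<noteq> 0\<^sub>v n" "Moore x *\<^sub>v v = 0\<^sub>v n"
      using det_0_iff_vec_prod_zero_field[OF Moore_carrier[of x]] by blast
    have vx: "(\<Sum>j<n. v $ j * x i ^ (q ^ j)) = 0" if i: "i < n" for i
    proof -
      have "(Moore x *\<^sub>v v) $ i = (\<Sum>j\<in>{0..<n}. x i ^ (q ^ j) * v $ j)"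
        using i v(1) carrier_matD[OF Moore_carrier[of x]] by (simp add: scalar_prod_def Moore_index)
      then show ?thesis using v(3) i by (simp add: lessThan_atLeast0 mult.commute)
    qed
    define R where "R = (\<Sum>j<n. Polynomial.monom (v $ j) (q ^ j))"
    have R0: "R \<noteq> 0"
    proof
      assume R: "R = 0"
      have "v $ j = 0" if "j < n" for j
      proof -
        have "coeff R (q ^ j) = v $ j" using that by (simp add: R_def coeff_sum qpow_eq)
        then show ?thesis using R by simp
      qed
      then have "v = 0\<^sub>v n" using v(1) by (intro eq_vecI) auto
      then show False using v(2) by simp
    qed
    have "degree R \<le> q ^ (n - 1)"
      unfolding R_def
    proof (intro degree_sum_le)
      fix j assume "j \<in> {..<n}"
      then have "q ^ j \<le> q ^ (n - 1)" using q by (intro power_increasing) auto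
      then show "degree (Polynomial.monom (v $ j) (q ^ j)) \<le> q ^ (n - 1)"
        using degree_monom_le order_trans by blast
    qed simp
    then have dR: "degree R < q ^ n" using qpow_less[of "n - 1" n] by simp
    have "poly R (lin n x l) = 0" if l: "l \<in> scalars n" for l
    proof -
      have "poly R (lin n x l) = (\<Sum>j<n. v $ j * lin n (\<lambda>i. x i ^ (q ^ j)) l)"
        by (simp add: R_def poly_sum poly_monom lin_qpow[OF l])
      also have "\<dots> = 0" unfolding lin_combine using vx by (simp add: lin_def)
      finally show ?thesis .
    qed
    then have "lin n x ` scalars n \<subseteq> {t. poly R t = 0}" by auto
    then have "card (lin n x ` scalars n) \<le> card {t. poly R t = 0}"
      by (intro card_mono poly_roots_finite R0)
    also have "\<dots> \<le> degree R" by (rule card_poly_roots_bound[OF R0])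
    finally show False using dR card_image[OF inj] card_scalars by simp
  qed
qed

text \<open>An additive polynomial vanishing at the \<open>x i\<close> vanishes on their span. Being
  monic of degree \<open>q ^ n\<close>, it is the Dickson product, and coefficients can be
  compared.\<close>

lemma dickson_eq:
  assumes d: "det (Moore x) \<noteq> 0" and v: "\<And>i. i < n \<Longrightarrow> poly (addpoly n v) (x i) = 0" and i: "i < n"
  shows "dickson q n i (vec n x) = - v i"
proof -
  have inj: "inj_on (lin n x) (scalars n)" using d det_Moore_iff by simp
  have set: "{l \<in> carrier_vec n. \<forall>r<n. l $ r \<in> Fq q} = vec n ` scalars n"
  proof
    show "{l \<in> carrier_vec n. \<forall>r<n. l $ r \<in> Fq q} \<subseteq> vec n ` scalars n"
    proof
      fix l :: "'k vec" assume l: "l \<in> {l \<in> carrier_vec n. \<forall>r<n. l $ r \<in> Fq q}"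
      have "l = vec n (restrict (\<lambda>i. l $ i) {..<n})" using l by (intro eq_vecI) auto
      moreover have "restrict (\<lambda>i. l $ i) {..<n} \<in> scalars n"
        using l by (intro restrict_scalars) (auto simp: F_def)
      ultimately show "l \<in> vec n ` scalars n" by blast
    qed
    show "vec n ` scalars n \<subseteq> {l \<in> carrier_vec n. \<forall>r<n. l $ r \<in> Fq q}"
      using scalarsD by (auto simp: F_def)
  qed
  have dot: "vec n l \<bullet> vec n x = lin n x l" for l
    by (simp add: scalar_prod_def lin_def lessThan_atLeast0)
  have injv: "inj_on (vec n) (scalars n)"
  proof
    fix l l' assume l: "l \<in> scalars n" "l' \<in> scalars n" "vec n l = vec n l'"
    have "lin n x l = lin n x l'" unfolding dot[symmetric] l(3) ..
    then show "l = l'" using inj l by (meson inj_onD)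
  qed
  \<comment> \<open>The Dickson factors are \<open>X + \<lambda> x\<close>, so their roots are the
    negatives of the linear combinations.\<close>
  let ?S = "(\<lambda>l. - lin n x l) ` scalars n"
  have injm: "inj_on (\<lambda>l. - lin n x l) (scalars n)" using inj by (simp add: inj_on_def)
  have "addpoly n v = (\<Prod>s\<in>?S. [:-s, 1:])"
  proof (rule monic_eq_prod_roots)
    show "degree (addpoly n v) = card ?S" using card_image[OF injm] by (simp add: degree_addpoly card_scalars)
    fix s assume "s \<in> ?S"
    then obtain l where l: "l \<in> scalars n" "s = - lin n x l" by blast
    have "poly (addpoly n v) (lin n x l) = 0"
      unfolding poly_addpoly_lin[OF l(1)] using v by (simp add: lin_def)
    then show "poly (addpoly n v) s = 0"
      by (simp add: l(2) poly_addpoly qpow_uminus sum_negf)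
  qed (simp_all add: finite_scalars degree_addpoly coeff_addpoly_top)
  also have "\<dots> = (\<Prod>l\<in>scalars n. [:lin n x l, 1:])"
    by (subst prod.reindex[OF injm]) simp
  also have "\<dots> = (\<Prod>l\<in>{l \<in> carrier_vec n. \<forall>r<n. l $ r \<in> Fq q}. [:l \<bullet> vec n x, 1:])"
    unfolding set prod.reindex[OF injv] by (simp add: dot)
  finally show ?thesis using coeff_addpoly[OF i, of v] by (simp add: dickson_def)
qed

lemma lang_eq_iff:
  assumes A: "A \<in> carrier_mat n n" "det A \<noteq> 0" and L: "L \<in> carrier_mat n n"
  shows "lang q n A = L \<longleftrightarrow> frob q A = A * (w * (L :: 'k mat))"
proof -
  note W = wdot_carrier[OF n, where ?'a = 'k] det_wdot_nz[OF n, where ?'k = 'k]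
  note c = A(1) L minv_carrier[OF A] minv_wdot_carrier[OF n, where ?'a = 'k] W(1)
  have e: "lang q n A = minv w * (minv A * frob q A)"
    unfolding lang_def using c by (simp add: assoc_mult_mat[of _ n n _ n _ n])
  have f: "minv A * frob q A \<in> carrier_mat n n" using c by simp
  show ?thesis
  proof
    assume "lang q n A = L"
    then have "A * (w * L) = A * (w * (minv w * (minv A * frob q A)))" using e by simp
    also have "\<dots> = frob q A"
      using mult_minv_cancel(1)[OF W f] mult_minv_cancel(1)[OF A, of "frob q A" n] c by simp
    finally show "frob q A = A * (w * L)" ..
  next
    assume "frob q A = A * (w * L)"
    then have "lang q n A = minv w * (minv A * (A * (w * L)))" using e by simp
    also have "\<dots> = L"
      using mult_minv_cancel(2)[OF A, of "w * L" n] mult_minv_cancel(2)[OF W L] c by simp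
    finally show "lang q n A = L" .
  qed
qed

lemma lang_carrier: "A \<in> carrier_mat n n \<Longrightarrow> det A \<noteq> 0 \<Longrightarrow> lang q n A \<in> carrier_mat n n"
  for A :: "'k mat"
  by (simp add: lang_def minv_carrier)

text \<open>Take determinants in \<open>frob q A = A * (w * lang q n A)\<close>, where
  \<open>w\<close> contributes the sign. The condition defining \<open>Q'\<close> thus says that the
  Lang map has determinant 1.\<close>

lemma det_power_iff:
  assumes A: "A \<in> carrier_mat n n" "det A \<noteq> 0"
  shows "det (lang q n A) = 1 \<longleftrightarrow> (-1) ^ (n - 1) * det (A :: 'k mat) ^ (q - 1) = 1"
proof -
  note L = lang_carrier[OF A]
  have "frob q A = A * (w * lang q n A)" using lang_eq_iff[OF A L] by simp
  then have "det A ^ q = det A * ((-1) ^ (n - 1) * det (lang q n A))"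
    using frob_det[of A] det_mult[OF A(1), of "w * lang q n A"] det_mult[OF wdot_carrier[OF n] L] L
    by (simp add: det_wdot)
  moreover have "det A ^ q = det A * det A ^ (q - 1)"
    using q by (cases q) auto
  ultimately have e: "det A ^ (q - 1) = (-1) ^ (n - 1) * det (lang q n A)" using A(2) by simp
  have "(-1 :: 'k) ^ (n - 1) * (-1) ^ (n - 1) = 1"
    by (simp flip: power_mult_distrib)
  then have "(-1) ^ (n - 1) * det A ^ (q - 1) = det (lang q n A)"
    unfolding e by (simp flip: mult.assoc)
  then show ?thesis by simp
qed

text \<open>The factor \<open>w * unicol n c\<close> is the companion matrix of the additive
  polynomial: its first columns shift the powers \<open>x i ^ (q ^ j)\<close>, and its last column
  expresses \<open>x i ^ (q ^ n)\<close> by lower ones.\<close>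

lemma frob_Moore:
  assumes x: "\<And>i. i < n \<Longrightarrow> x i \<in> V c"
  shows "frob q (Moore x) = Moore x * (w * unicol n c)"
proof -
  have "frob q (Moore x) = Moore x * w * unicol n c"
  proof (rule eq_matI)
    fix i j assume "i < dim_row (Moore x * w * unicol n c)" "j < dim_col (Moore x * w * unicol n c)"
    then have ij: "i < n" "j < n"
      using carrier_matD[OF Moore_carrier[of x]] carrier_matD[OF unicol_carrier[of n c]] by simp_all
    have l: "frob q (Moore x) $$ (i, j) = x i ^ (q ^ Suc j)"
      using ij by (simp add: frob_index Moore_index power_mult mult.commute[of q])
    have Mw: "(Moore x * w) $$ (i, k) = (if k = n - 1 then x i else x i ^ (q ^ Suc k))" if "k < n" for k
      using mult_wdot_index[OF n Moore_carrier ij(1) that, of x] ij that by (auto simp: Moore_index)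
    show "frob q (Moore x) $$ (i, j) = (Moore x * w * unicol n c) $$ (i, j)"
    proof (cases "j = n - 1")
      case True
      have "(Moore x * w * unicol n c) $$ (i, j) = x i - (\<Sum>k<n - 1. c (k + 1) * x i ^ (q ^ Suc k))"
      proof -
        have "(\<Sum>k<n - 1. c (k + 1) * (Moore x * w) $$ (i, k)) = (\<Sum>k<n - 1. c (k + 1) * x i ^ (q ^ Suc k))"
          by (intro sum.cong) (auto simp: Mw)
        then show ?thesis
          using mult_unicol_index[of "Moore x * w" n i j c] ij True by (simp add: Mw)
      qed
      also have "\<dots> = x i ^ (q ^ n)"
      proof -
        obtain m where m: "n = Suc m" using n by (cases n) auto
        have "x i ^ (q ^ n) = (\<Sum>j<n. vc c j * x i ^ (q ^ j))"
          using x[OF ij(1)] by (simp add: V_def poly_addpoly)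
        also have "\<dots> = x i - (\<Sum>k<n - 1. c (k + 1) * x i ^ (q ^ Suc k))"
          unfolding m by (subst sum.lessThan_Suc_shift) (simp add: vc_def sum_negf)
        finally show ?thesis ..
      qed
      finally show ?thesis using l True by simp
    next
      case False
      then show ?thesis using mult_unicol_index[of "Moore x * w" n i j c] ij by (simp add: Mw l)
    qed
  qed (use carrier_matD[OF Moore_carrier[of x]] carrier_matD[OF unicol_carrier[of n c]] in \<open>simp_all add: frob_def\<close>)
  then show ?thesis by (simp add: assoc_mult_mat[of _ n n _ n _ n])
qed

definition dick :: "'k mat \<Rightarrow> nat \<Rightarrow> 'k" where
  "dick A i = dickson q n i (col A 0)"

lemma Qprime_iff: "A \<in> Qprime q n \<longleftrightarrow> (\<exists>x. A = Moore x) \<and> det A \<noteq> 0 \<and> det (lang q n A) = 1"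
proof -
  have "(\<exists>x\<in>carrier_vec n. A = moore q x) \<longleftrightarrow> (\<exists>x. A = Moore x)"
  proof
    assume "\<exists>x\<in>carrier_vec n. A = moore q x"
    then show "\<exists>x. A = Moore x" using moore_eq_Moore by metis
  next
    assume "\<exists>x. A = Moore x"
    then show "\<exists>x\<in>carrier_vec n. A = moore q x" unfolding Moore_def by (metis vec_carrier)
  qed
  moreover have "(-1) ^ (n - 1) * det (Moore x) ^ (q - 1) = 1 \<longleftrightarrow> det (lang q n (Moore x)) = 1"
    if "det (Moore x) \<noteq> 0" for x
    using det_power_iff[OF Moore_carrier that] by simp
  ultimately show ?thesis unfolding Qprime_def GL_iff by auto
qed

lemma Moore_Qprime:
  assumes x: "\<And>i. i < n \<Longrightarrow> x i \<in> V c" and d: "det (Moore x) \<noteq> 0"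
  shows "Moore x \<in> Qprime q n" "lang q n (Moore x) = unicol n c"
proof -
  show "lang q n (Moore x) = unicol n c"
    using frob_Moore[OF x] lang_eq_iff[OF Moore_carrier d unicol_carrier] by simp
  then show "Moore x \<in> Qprime q n"
    unfolding Qprime_iff using d Ustar_det[OF unicol_Ustar[of n c]] by auto
qed

text \<open>Frobenius moves column \<open>j\<close> of a Moore matrix to column
  \<open>j + 1\<close>, so all columns of the inverse of \<open>A\<close> times
  \<open>frob q A\<close> but the last are unit vectors. The last column \<open>y\<close> gives an
  additive polynomial vanishing at every \<open>x i\<close>, and \<open>dickson_eq\<close>
  identifies its coefficients.\<close>

lemma Qprime_lang:
  assumes A: "A \<in> Qprime q n"
  obtains x where "A = Moore x" "\<And>i. i < n \<Longrightarrow> x i \<in> V (dick A)" "det (Moore x) \<noteq> 0"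
    "lang q n A = unicol n (dick A)"
proof -
  obtain x where x: "A = Moore x" "det (Moore x) \<noteq> 0" "det (lang q n A) = 1"
    using A unfolding Qprime_iff by auto
  define L where "L = lang q n A"
  have Lc: "L \<in> carrier_mat n n" unfolding L_def x(1) by (rule lang_carrier[OF Moore_carrier x(2)])
  have wL: "w * L \<in> carrier_mat n n" using Lc by simp
  have fr: "frob q A = A * (w * L)"
    using lang_eq_iff[OF Moore_carrier x(2) Lc] x(1) by (simp add: L_def)
  have col0: "(w * L) $$ (i, j) = (if i = j + 1 then 1 else 0)" if ij: "i < n" "j < n - 1" for i j
  proof -
    have "minv A * frob q A = w * L"
      using mult_minv_cancel(2)[OF Moore_carrier x(2) wL] fr x(1) by simp
    then have "(w * L) $$ (i, j) = (\<Sum>k\<in>{0..<n}. minv A $$ (i, k) * frob q A $$ (k, j))"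
      using mat_mult_index[of "minv A" n n "frob q A" n i j] ij minv_carrier[OF Moore_carrier x(2)] x(1)
      by simp
    also have "\<dots> = (\<Sum>k\<in>{0..<n}. minv A $$ (i, k) * A $$ (k, j + 1))"
      using ij unfolding x(1)
      by (intro sum.cong) (auto simp: frob_index Moore_index power_mult mult.commute[of q])
    also have "\<dots> = (minv A * A) $$ (i, j + 1)"
      using ij minv_carrier[OF Moore_carrier x(2)] unfolding x(1)
      by (intro mat_mult_index[of _ n n _ n, symmetric]) auto
    also have "\<dots> = (if i = j + 1 then 1 else 0)"
      unfolding x(1) minv_left[OF Moore_carrier x(2)] using ij by simp
    finally show ?thesis .
  qed
  have wi: "(w * L) $$ (i, j) = L $$ (if i = 0 then n - 1 else i - 1, j)" if "i < n" "j < n" for i j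
    using wdot_mult_index[OF n Lc that] .
  \<comment> \<open>In the last column of \<open>w * L\<close> the coefficients appear in natural
    order; in \<open>L\<close> they are shifted cyclically, with \<open>y 0\<close> in the bottom
    corner.\<close>
  define y where "y i = (w * L) $$ (i, n - 1)" for i
  have Lij: "L $$ (i, j) = (if i = j then 1 else 0)" if ij: "i < n" "j < n - 1" for i j
  proof (cases "i = n - 1")
    case True
    then show ?thesis using wi[of 0 j] col0[of 0 j] ij by simp
  next
    case False
    then show ?thesis using wi[of "i + 1" j] col0[of "i + 1" j] ij by simp
  qed
  have Ly: "L $$ (i, n - 1) = y (if i = n - 1 then 0 else i + 1)" if "i < n" for i
    using wi[of "if i = n - 1 then 0 else i + 1" "n - 1"] that by (auto simp: y_def)
  have root: "poly (addpoly n y) (x i) = 0" if i: "i < n" for i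
  proof -
    have "x i ^ (q ^ n) = frob q A $$ (i, n - 1)"
    proof -
      have "x i ^ (q ^ n) = (x i ^ (q ^ (n - 1))) ^ q"
        using n by (metis One_nat_def Suc_pred' n_pos(1) power_Suc2 power_mult)
      then show ?thesis using i x(1) by (simp add: frob_index Moore_index)
    qed
    also have "\<dots> = (\<Sum>k\<in>{0..<n}. A $$ (i, k) * (w * L) $$ (k, n - 1))"
      unfolding fr using i x(1) wL by (intro mat_mult_index) auto
    also have "\<dots> = (\<Sum>k<n. y k * x i ^ (q ^ k))"
      unfolding lessThan_atLeast0 y_def using i x(1) by (intro sum.cong) (auto simp: Moore_index)
    finally show ?thesis by (simp add: poly_addpoly)
  qed
  have dy: "dick A i = - y i" if "i < n" for i
    using dickson_eq[OF x(2) root that] by (simp add: dick_def x(1) col_Moore)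
  \<comment> \<open>The corner entry \<open>y 0\<close> is the only diagonal entry of
    \<open>L\<close> not yet known to be 1, so \<open>det L = 1\<close> forces
    \<open>y 0 = 1\<close>.\<close>
  have "upper_triangular L"
  proof
    fix i j assume "i < dim_row L" "j < i"
    then show "L $$ (i, j) = 0" using Lij[of i j] Lc by auto
  qed
  then have "det L = prod_list (diag_mat L)" using det_upper_triangular Lc by blast
  also have "\<dots> = (\<Prod>i\<in>{0..<n}. L $$ (i, i))"
    using Lc by (simp add: prod_list_diag_prod)
  also have "\<dots> = (\<Prod>i\<in>{0..<n}. if i = n - 1 then y 0 else 1)"
    using Lij Ly by (intro prod.cong) auto
  finally have y0: "y 0 = 1" using x(3) by (simp add: L_def)
  have LU: "lang q n A = unicol n (dick A)"
    unfolding L_def[symmetric]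
  proof (rule eq_matI)
    fix i j assume "i < dim_row (unicol n (dick A))" "j < dim_col (unicol n (dick A))"
    then have ij: "i < n" "j < n" by (simp_all add: unicol_def)
    show "L $$ (i, j) = unicol n (dick A) $$ (i, j)"
    proof (cases "j = n - 1")
      case True
      then show ?thesis using ij Ly[of i] y0 dy[of "i + 1"] by (simp add: unicol_def)
    next
      case False
      then show ?thesis using ij Lij[of i j] by (simp add: unicol_def)
    qed
  qed (use Lc in \<open>simp_all add: unicol_def\<close>)
  have "x i \<in> V (dick A)" if i: "i < n" for i
  proof -
    have "poly (addpoly n (vc (dick A))) (x i) = poly (addpoly n y) (x i)"
      unfolding poly_addpoly vc_def using dy y0 by (intro arg_cong2[where f = "(-)"] sum.cong) auto
    then show ?thesis using root[OF i] by (simp add: V_def)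
  qed
  then show thesis using that x LU by blast
qed

lemma Qprime_carrier: "A \<in> Qprime q n \<Longrightarrow> A \<in> carrier_mat n n" for A :: "'k mat"
  unfolding Qprime_iff by auto

lemma Qprime_det: "A \<in> Qprime q n \<Longrightarrow> det A \<noteq> 0" for A :: "'k mat"
  unfolding Qprime_iff by auto

lemma lang_Qprime: "A \<in> Qprime q n \<Longrightarrow> lang q n A = unicol n (dick A)"
  by (rule Qprime_lang)

text \<open>Parameter families are total functions on the naturals; this is equality of the points
  of affine space with coordinates 1 to \<open>n - 1\<close> that they represent.\<close>

definition agree :: "(nat \<Rightarrow> 'k) \<Rightarrow> (nat \<Rightarrow> 'k) \<Rightarrow> bool" where
  "agree c d \<longleftrightarrow> (\<forall>i\<in>{1..n - 1}. c i = d i)"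

lemma unicol_eq_iff: "unicol n c = unicol n d \<longleftrightarrow> agree c d"
  unfolding agree_def using unicol_cong[of n c d] unicol_inj[of n c d] by blast

text \<open>A basis of the root space \<open>V c\<close> has an invertible Moore matrix, and its
  Lang image has the prescribed parameters.\<close>

lemma Qprime_surj: "\<exists>A\<in>Qprime q n. lang q n A = unicol n c" for c :: "nat \<Rightarrow> 'k"
proof -
  obtain x where "\<forall>i<n. x i \<in> V c" "inj_on (lin n x) (scalars n)"
    using V_basis[of n c] by auto
  then show ?thesis using Moore_Qprime[of x c] det_Moore_iff by blast
qed

section \<open>Fibres of the Lang map as orbits of the finite group\<close>

lemma GL_Fq_iff: "g \<in> GL_Fq q n \<longleftrightarrow> g \<in> GL n \<and> frob q g = (g :: 'k mat)"
proof -
  have "elements_mat g \<subseteq> Fq q \<longleftrightarrow> frob q g = g" if g: "g \<in> carrier_mat n n"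
  proof -
    have "elements_mat g \<subseteq> Fq q \<longleftrightarrow> (\<forall>i<n. \<forall>j<n. g $$ (i, j) ^ q = g $$ (i, j))"
      using g by (fastforce simp: elements_mat_def Fq_def)
    also have "\<dots> \<longleftrightarrow> frob q g = g"
    proof
      assume h: "\<forall>i<n. \<forall>j<n. g $$ (i, j) ^ q = g $$ (i, j)"
      show "frob q g = g" by (rule eq_matI) (use h g in \<open>auto simp: frob_def\<close>)
    next
      assume "frob q g = g"
      then show "\<forall>i<n. \<forall>j<n. g $$ (i, j) ^ q = g $$ (i, j)" using frob_index[OF g] by simp
    qed
    finally show ?thesis .
  qed
  then show ?thesis unfolding GL_Fq_def GL_iff by auto
qed

lemma GL_Fq_minv: "g \<in> GL_Fq q n \<Longrightarrow> minv g \<in> GL_Fq q n" for g :: "'k mat"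
  unfolding GL_Fq_iff using GL_minv[of g n] frob_minv[of g] by (simp add: GL_iff)

lemma GL_Fq_mult: "g \<in> GL_Fq q n \<Longrightarrow> h \<in> GL_Fq q n \<Longrightarrow> g * h \<in> GL_Fq q n" for g :: "'k mat"
  unfolding GL_Fq_iff using GL_mult[of g n h] frob_mult[of g h] by (simp add: GL_iff)

lemma lang_left_mult:
  assumes g: "g \<in> GL_Fq q n" and A: "A \<in> carrier_mat n n" "det A \<noteq> (0 :: 'k)"
  shows "lang q n (g * A) = lang q n A"
proof -
  have g': "g \<in> carrier_mat n n" "det g \<noteq> 0" "frob q g = g" using g by (auto simp: GL_Fq_iff GL_iff)
  note L = lang_carrier[OF A]
  have "frob q A = A * (w * lang q n A)" using lang_eq_iff[OF A L] by simp
  then have "frob q (g * A) = g * A * (w * lang q n A)"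
    using g' A L by (simp add: frob_mult assoc_mult_mat[of _ n n _ n _ n])
  moreover have "det (g * A) \<noteq> 0" using det_mult[OF g'(1) A(1)] g' A by simp
  ultimately show ?thesis using lang_eq_iff[of "g * A" "lang q n A"] g' A L by simp
qed

text \<open>Frobenius multiplies both \<open>A\<close> and \<open>B\<close> on the right by the same
  matrix \<open>w * lang q n A\<close>, which cancels in \<open>B * minv A\<close>.\<close>

lemma lang_eq_imp:
  assumes A: "A \<in> carrier_mat n n" "det A \<noteq> 0" and B: "B \<in> carrier_mat n n" "det B \<noteq> (0 :: 'k)"
    and e: "lang q n A = lang q n B"
  shows "\<exists>g\<in>GL_Fq q n. B = g * A"
proof
  note L = lang_carrier[OF A]
  note m = minv_carrier[OF A] det_minv_nz[OF A]
  have wL: "w * lang q n A \<in> carrier_mat n n" using L by simp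
  have fA: "frob q A = A * (w * lang q n A)" and fB: "frob q B = B * (w * lang q n A)"
    using lang_eq_iff[OF A L] lang_eq_iff[OF B L] e by simp_all
  have "det (frob q A) \<noteq> 0" using frob_det[of A] A(2) by simp
  then have d: "det (w * lang q n A) \<noteq> 0" using det_mult[OF A(1) wL] fA by auto
  have "frob q (B * minv A) = frob q B * minv (frob q A)"
    using A B m by (simp add: frob_mult frob_minv)
  also have "\<dots> = B * (w * lang q n A * (minv (w * lang q n A) * minv A))"
    unfolding fA fB minv_mult[OF A wL d] using A B m minv_carrier[OF wL d] wL
    by (simp add: assoc_mult_mat[of _ n n _ n _ n])
  also have "w * lang q n A * (minv (w * lang q n A) * minv A) = minv A"
    by (rule mult_minv_cancel(1)[OF wL d m(1)])
  finally show "B * minv A \<in> GL_Fq q n"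
    unfolding GL_Fq_iff GL_iff using A B m det_mult[OF B(1) m(1)] by simp
  show "B = B * minv A * A" using A B m minv_left[OF A] by (simp add: assoc_mult_mat[of _ n n _ n _ n])
qed

lemma Qprime_orbit_eq_iff:
  assumes A: "A \<in> Qprime q n" and B: "B \<in> Qprime q n"
  shows "Qprime_orbit q n A = Qprime_orbit q n B \<longleftrightarrow> agree (dick A) (dick B)"
proof -
  have car: "carrier (matrix_group n (GL_Fq q n)) = GL_Fq q n" by (simp add: matrix_group_def)
  have c: "A \<in> carrier_mat n n" "det A \<noteq> 0" "B \<in> carrier_mat n n" "det B \<noteq> 0"
    using Qprime_carrier[OF A] Qprime_det[OF A] Qprime_carrier[OF B] Qprime_det[OF B] by auto
  have "Qprime_orbit q n A = Qprime_orbit q n B \<longleftrightarrow> (\<exists>g\<in>GL_Fq q n. B = g * A)"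
    unfolding Qprime_orbit_def
  proof (rule orbit_eq_iff[where E = "carrier_mat n n" and e = "1\<^sub>m n" and \<phi> = "(*)" and
        G = "matrix_group n (GL_Fq q n)", unfolded car])
    show "(1\<^sub>m n :: 'k mat) \<in> GL_Fq q n" unfolding GL_Fq_iff GL_iff by (simp add: frob_one)
    fix g h x :: "'k mat"
    assume g: "g \<in> GL_Fq q n" and x: "x \<in> carrier_mat n n"
    have gc: "g \<in> carrier_mat n n" "det g \<noteq> 0" using g by (auto simp: GL_Fq_iff GL_iff)
    show "\<exists>h\<in>GL_Fq q n. h * (g * x) = x"
      using mult_minv_cancel(2)[OF gc x] GL_Fq_minv[OF g] by blast
    assume h: "h \<in> GL_Fq q n"
    then have "h \<in> carrier_mat n n" by (auto simp: GL_Fq_iff GL_iff)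
    then show "\<exists>k\<in>GL_Fq q n. g * (h * x) = k * x"
      using GL_Fq_mult[OF g h] gc x by (intro bexI[of _ "g * h"]) (auto simp: assoc_mult_mat[of _ n n _ n _ n])
  qed (use c in auto)
  also have "\<dots> \<longleftrightarrow> lang q n A = lang q n B"
    using lang_left_mult[OF _ c(1,2)] lang_eq_imp[OF c] by metis
  finally show ?thesis unfolding lang_Qprime[OF A] lang_Qprime[OF B] unicol_eq_iff .
qed

end

section \<open>Polynomial matrix functions\<close>

definition polymat :: "nat \<Rightarrow> 'a set \<Rightarrow> ('a \<Rightarrow> 'v \<Rightarrow> 'k::field) \<Rightarrow> 'v set \<Rightarrow> ('a \<Rightarrow> 'k mat) \<Rightarrow> bool" where
  "polymat m S X I G \<longleftrightarrow> (\<forall>x\<in>S. G x \<in> carrier_mat m m) \<and>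
     (\<forall>i<m. \<forall>j<m. (\<lambda>x. G x $$ (i, j)) \<in> polyfun S X I)"

lemma polymat_index: "polymat m S X I G \<Longrightarrow> i < m \<Longrightarrow> j < m \<Longrightarrow> (\<lambda>x. G x $$ (i, j)) \<in> polyfun S X I"
  unfolding polymat_def by blast

lemma polymat_carrier: "polymat m S X I G \<Longrightarrow> x \<in> S \<Longrightarrow> G x \<in> carrier_mat m m"
  unfolding polymat_def by blast

lemma polymat_const: "A \<in> carrier_mat m m \<Longrightarrow> polymat m S X I (\<lambda>x. A)"
  unfolding polymat_def by (simp add: polyfun_const)

lemma polymat_id: "S \<subseteq> carrier_mat n n \<Longrightarrow> polymat n S mat_entry ({..<n} \<times> {..<n}) (\<lambda>A. A)"
  unfolding polymat_def by (auto intro: matfun_entry)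

lemma polymat_mult:
  assumes G: "polymat m S X I G" and H: "polymat m S X I H"
  shows "polymat m S X I (\<lambda>x. G x * H x)"
  unfolding polymat_def
proof (intro conjI allI impI ballI)
  show "G x * H x \<in> carrier_mat m m" if "x \<in> S" for x
    using polymat_carrier[OF G that] polymat_carrier[OF H that] by simp
  fix i j assume ij: "i < m" "j < m"
  show "(\<lambda>x. (G x * H x) $$ (i, j)) \<in> polyfun S X I"
  proof (rule polyfun_cong)
    show "(\<lambda>x. \<Sum>k\<in>{0..<m}. G x $$ (i, k) * H x $$ (k, j)) \<in> polyfun S X I"
      using ij by (intro polyfun_sum polyfun_mult polymat_index[OF G] polymat_index[OF H]) auto
    show "(G x * H x) $$ (i, j) = (\<Sum>k\<in>{0..<m}. G x $$ (i, k) * H x $$ (k, j))" if "x \<in> S" for x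
      using polymat_carrier[OF G that] polymat_carrier[OF H that] ij by (rule mat_mult_index)
  qed
qed

lemma polymat_frob:
  assumes G: "polymat m S X I G"
  shows "polymat m S X I (\<lambda>x. frob q (G x))"
  unfolding polymat_def
proof (intro conjI allI impI ballI)
  show "frob q (G x) \<in> carrier_mat m m" if "x \<in> S" for x
    using polymat_carrier[OF G that] by (simp add: frob_def)
  fix i j assume ij: "i < m" "j < m"
  show "(\<lambda>x. frob q (G x) $$ (i, j)) \<in> polyfun S X I"
  proof (rule polyfun_cong)
    show "(\<lambda>x. G x $$ (i, j) ^ q) \<in> polyfun S X I"
      using ij by (intro polyfun_power polymat_index[OF G]) auto
    show "frob q (G x) $$ (i, j) = G x $$ (i, j) ^ q" if "x \<in> S" for x
      using polymat_carrier[OF G that] ij by (simp add: frob_def)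
  qed
qed

lemma polymat_det:
  assumes G: "polymat m S X I G"
  shows "(\<lambda>x. det (G x)) \<in> polyfun S X I"
proof (rule polyfun_cong)
  show "(\<lambda>x. \<Sum>p\<in>{p. p permutes {0..<m}}. signof p * (\<Prod>i\<in>{0..<m}. G x $$ (i, p i))) \<in> polyfun S X I"
  proof (intro polyfun_sum polyfun_mult polyfun_const polyfun_prod polymat_index[OF G])
    fix p i assume "p \<in> {p. p permutes {0..<m}}" "i \<in> {0..<m}"
    then show "i < m" "p i < m" using permutes_in_image[of p "{0..<m}" i] by auto
  qed
  show "det (G x) = (\<Sum>p\<in>{p. p permutes {0..<m}}. signof p * (\<Prod>i\<in>{0..<m}. G x $$ (i, p i)))"
    if "x \<in> S" for x
    using det_def'[OF polymat_carrier[OF G that]] .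
qed

lemma polymat_cofactor:
  assumes G: "polymat m S X I G" and ij: "i < m" "j < m"
  shows "(\<lambda>x. cofactor (G x) i j) \<in> polyfun S X I"
  unfolding cofactor_def
proof (intro polyfun_mult polyfun_const polymat_det[of "m - 1"])
  show "polymat (m - 1) S X I (\<lambda>x. mat_delete (G x) i j)"
    unfolding polymat_def
  proof (intro conjI allI impI ballI)
    show "mat_delete (G x) i j \<in> carrier_mat (m - 1) (m - 1)" if "x \<in> S" for x
      using mat_delete_carrier[OF polymat_carrier[OF G that]] .
    fix k l assume kl: "k < m - 1" "l < m - 1"
    show "(\<lambda>x. mat_delete (G x) i j $$ (k, l)) \<in> polyfun S X I"
    proof (rule polyfun_cong)
      show "(\<lambda>x. G x $$ (if k < i then k else Suc k, if l < j then l else Suc l)) \<in> polyfun S X I"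
        using kl by (intro polymat_index[OF G]) auto
      show "mat_delete (G x) i j $$ (k, l) = G x $$ (if k < i then k else Suc k, if l < j then l else Suc l)"
        if "x \<in> S" for x
        using polymat_carrier[OF G that] kl by (simp add: mat_delete_def)
    qed
  qed
qed

text \<open>Cramer's rule, with the polynomial function \<open>d\<close> in place of division by the
  determinant.\<close>

lemma polymat_minv:
  assumes G: "polymat m S X I G" and d: "d \<in> polyfun S X I"
    and inv: "\<And>x. x \<in> S \<Longrightarrow> d x * det (G x) = 1"
  shows "polymat m S X I (\<lambda>x. minv (G x))"
proof -
  have m: "minv (G x) = d x \<cdot>\<^sub>m adj_mat (G x)" if x: "x \<in> S" for x
  proof (rule minv_eqI)
    note c = polymat_carrier[OF G x]
    show "G x * (d x \<cdot>\<^sub>m adj_mat (G x)) = 1\<^sub>m m"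
      unfolding mult_smult_distrib[OF c adj_mat(1)[OF c]] adj_mat(2)[OF c]
      using inv[OF x] by (intro eq_matI) auto
    show "d x \<cdot>\<^sub>m adj_mat (G x) \<in> carrier_mat m m" using adj_mat(1)[OF c] by simp
  qed (rule polymat_carrier[OF G x])
  show ?thesis
    unfolding polymat_def
  proof (intro conjI allI impI ballI)
    show "minv (G x) \<in> carrier_mat m m" if "x \<in> S" for x
      unfolding m[OF that] using adj_mat(1)[OF polymat_carrier[OF G that]] by simp
    fix i j assume ij: "i < m" "j < m"
    show "(\<lambda>x. minv (G x) $$ (i, j)) \<in> polyfun S X I"
    proof (rule polyfun_cong)
      show "(\<lambda>x. d x * cofactor (G x) j i) \<in> polyfun S X I"
        using ij by (intro polyfun_mult d polymat_cofactor[OF G])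
      show "minv (G x) $$ (i, j) = d x * cofactor (G x) j i" if "x \<in> S" for x
        unfolding m[OF that] using polymat_carrier[OF G that] ij by (simp add: adj_mat_def)
    qed
  qed
qed

text \<open>The algebra that defines \<open>matrix_fspace\<close>. Its members are polynomials on
  all matrices, whereas \<open>matfun\<close> constrains only the values on \<open>S\<close>;
  \<open>matfun_iff\<close> translates between the two.\<close>

definition matalg :: "nat \<Rightarrow> ('k::field mat \<Rightarrow> 'k) set" where
  "matalg n = {(\<lambda>A. mpoly_eval P (mat_entry A)) | P. mpoly_vars P \<subseteq> {..<n} \<times> {..<n}}"

lemma matalgI: "mpoly_vars P \<subseteq> {..<n} \<times> {..<n} \<Longrightarrow> (\<lambda>A. mpoly_eval P (mat_entry A)) \<in> matalg n"
  unfolding matalg_def by blast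

lemma matrix_fspace_eq: "matrix_fspace n S = fspace_of S (matalg n)"
proof -
  have "(\<lambda>ij. A $$ ij) = mat_entry A" for A :: "'a mat" by (simp add: mat_entry_def fun_eq_iff)
  then show ?thesis by (simp add: matrix_fspace_def matalg_def)
qed

lemma mult_stable_matalg: "mult_stable S (matalg n)"
  unfolding mult_stable_def
proof (intro conjI ballI)
  have "(\<lambda>A. mpoly_eval (mpoly_const 1) (mat_entry A)) \<in> matalg n"
    by (rule matalgI) simp
  then show "\<exists>c\<in>matalg n. \<forall>x\<in>S. c x = 1" by force
  fix a b :: "'a mat \<Rightarrow> 'a" assume "a \<in> matalg n" "b \<in> matalg n"
  then obtain P Q where P: "a = (\<lambda>A. mpoly_eval P (mat_entry A))" "mpoly_vars P \<subseteq> {..<n} \<times> {..<n}"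
    and Q: "b = (\<lambda>A. mpoly_eval Q (mat_entry A))" "mpoly_vars Q \<subseteq> {..<n} \<times> {..<n}"
    unfolding matalg_def by blast
  have "(\<lambda>A. mpoly_eval (P * Q) (mat_entry A)) \<in> matalg n"
    using P(2) Q(2) mpoly_vars_mult[of P Q] by (intro matalgI) blast
  then show "\<exists>c\<in>matalg n. \<forall>x\<in>S. c x = a x * b x"
    using P Q by (intro bexI) (simp_all add: mpoly_eval_mult)
qed

lemma matfun_iff: "f \<in> matfun n S \<longleftrightarrow> (\<exists>a\<in>matalg n. \<forall>x\<in>S. a x = f x)"
  unfolding polyfun_def matalg_def by force

lemma matalg_matfun: "a \<in> matalg n \<Longrightarrow> a \<in> matfun n S"
  unfolding matfun_iff by blast

lemma mpoly_eval_prod: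
  fixes f :: "'a \<Rightarrow> ('v \<Rightarrow>\<^sub>0 nat) \<Rightarrow>\<^sub>0 'k::comm_semiring_1"
  shows "mpoly_eval (\<Prod>i\<in>I. f i) a = (\<Prod>i\<in>I. mpoly_eval (f i) a)"
  using mpoly_eval_const[of 1 a, unfolded mpoly_const_def]
  by (induct I rule: infinite_finite_induct) (simp_all add: mpoly_eval_mult)

lemma mpoly_eval_power:
  fixes P :: "('v \<Rightarrow>\<^sub>0 nat) \<Rightarrow>\<^sub>0 'k::comm_semiring_1"
  shows "mpoly_eval (P ^ k) a = mpoly_eval P a ^ k"
  using mpoly_eval_prod[of "\<lambda>_. P" "{..<k}" a] by simp

section \<open>The trace\<close>

context frob_field
begin

abbreviation Qp :: "'k mat set" where "Qp \<equiv> Qprime q n"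

lemma V_agree:
  assumes "agree c d"
  shows "V c = V d"
proof -
  have "vc c j = vc d j" if "j < n" for j
    using assms that by (auto simp: vc_def agree_def)
  then show ?thesis unfolding V_def poly_addpoly by simp
qed

lemma agree_refl [simp]: "agree c c" and agree_sym: "agree c d \<Longrightarrow> agree d c"
  and agree_trans: "agree c d \<Longrightarrow> agree d e \<Longrightarrow> agree c e"
  by (auto simp: agree_def)

lemma mpoly_eval_agree: "mpoly_vars P \<subseteq> {1..n - 1} \<Longrightarrow> agree c d \<Longrightarrow> mpoly_eval P c = mpoly_eval P d"
  by (rule mpoly_eval_cong) (auto simp: agree_def)

definition fib :: "'k mat \<Rightarrow> 'k mat set" where
  "fib A = {z \<in> Qp. agree (dick z) (dick A)}"

lemma Moore_cong: "(\<And>i. i < n \<Longrightarrow> x i = y i) \<Longrightarrow> Moore x = Moore y"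
  unfolding Moore_def by (rule arg_cong[of _ _ "moore q"]) auto

text \<open>The Dickson parameters determine the root space, so the points of a fibre correspond to
  the ordered bases of \<open>V (dick A)\<close> over \<open>F\<close>.\<close>

lemma fib_bij:
  assumes A: "A \<in> Qp"
  shows "bij_betw Moore {x \<in> {..<n} \<rightarrow>\<^sub>E V (dick A). det (Moore x) \<noteq> 0} (fib A)"
  unfolding bij_betw_def
proof (intro conjI equalityI subsetI)
  let ?X = "{x \<in> {..<n} \<rightarrow>\<^sub>E V (dick A). det (Moore x) \<noteq> 0}"
  show "inj_on Moore ?X"
  proof
    fix x y assume xy: "x \<in> ?X" "y \<in> ?X" "Moore x = Moore y"
    have "x i = y i" if "i < n" for i
      using arg_cong[OF xy(3), of "\<lambda>M. M $$ (i, 0)"] that by (simp add: Moore_index)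
    then show "x = y" using xy(1,2) by (intro PiE_ext[of x "{..<n}" "\<lambda>_. V (dick A)" y]) auto
  qed
  fix z assume "z \<in> Moore ` ?X"
  then obtain x where x: "z = Moore x" "det (Moore x) \<noteq> 0" "x \<in> {..<n} \<rightarrow>\<^sub>E V (dick A)" by blast
  have xV: "x i \<in> V (dick A)" if "i < n" for i
    using PiE_mem[OF x(3), of i] that by simp
  note M = Moore_Qprime[OF xV x(2)]
  then have "agree (dick z) (dick A)"
    using lang_Qprime[of z] x(1) unicol_eq_iff by metis
  then show "z \<in> fib A" using M x(1) by (simp add: fib_def)
next
  fix z assume "z \<in> fib A"
  then have z: "z \<in> Qp" "agree (dick z) (dick A)" by (auto simp: fib_def)
  obtain x where x: "z = Moore x" "\<And>i. i < n \<Longrightarrow> x i \<in> V (dick z)" "det (Moore x) \<noteq> 0"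
    using Qprime_lang[OF z(1)] by metis
  have "Moore (restrict x {..<n}) = z" using x(1) by (simp add: Moore_cong[of "restrict x {..<n}" x])
  moreover have "restrict x {..<n} \<in> {..<n} \<rightarrow>\<^sub>E V (dick A)"
    using x(2) V_agree[OF z(2)] by simp
  ultimately show "z \<in> Moore ` {x \<in> {..<n} \<rightarrow>\<^sub>E V (dick A). det (Moore x) \<noteq> 0}"
    using x(1,3) by (intro image_eqI[of _ _ "restrict x {..<n}"]) simp_all
qed

lemma finite_fib: "A \<in> Qp \<Longrightarrow> finite (fib A)"
  using bij_betw_finite[OF fib_bij] by (simp add: finite_V finite_PiE)

text \<open>On tuples in \<open>V c\<close>, \<open>(-1)\<^bsup>n-1\<^esup> det\<^bsup>q-1\<^esup>\<close> is the indicator function of linear independence, so that the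
  sum over a fibre becomes a sum over all tuples.\<close>

lemma trace_polyfun:
  assumes f: "f \<in> matfun n Qp"
  shows "\<exists>P. mpoly_vars P \<subseteq> {1..n - 1} \<and> (\<forall>A\<in>Qp. mpoly_eval P (dick A) = (\<Sum>z\<in>fib A. f z))"
proof -
  obtain P0 where P0: "mpoly_vars P0 \<subseteq> {..<n} \<times> {..<n}" "\<forall>A\<in>Qp. f A = mpoly_eval P0 (mat_entry A)"
    using f by (rule polyfunE)
  have "(\<lambda>A. (-1) ^ (n - 1) * det A ^ (q - 1)) \<in> matfun n (carrier_mat n n)"
    by (intro polyfun_mult polyfun_const polyfun_power polymat_det[of n] polymat_id) simp
  then obtain P1 where P1: "mpoly_vars P1 \<subseteq> {..<n} \<times> {..<n}"
    "\<forall>A\<in>carrier_mat n n. (-1) ^ (n - 1) * det A ^ (q - 1) = mpoly_eval P1 (mat_entry (A :: 'k mat))"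
    by (rule polyfunE)
  have vars: "mpoly_vars (P0 * P1) \<subseteq> {..<n} \<times> {..<n}"
    using P0(1) P1(1) mpoly_vars_mult[of P0 P1] by blast
  obtain P where P: "mpoly_vars P \<subseteq> {1..n - 1}"
    "\<forall>c\<in>UNIV. (\<Sum>x\<in>{..<n} \<rightarrow>\<^sub>E V c. mpoly_eval (P0 * P1) (\<lambda>(i, j). x i ^ (q ^ j))) = mpoly_eval P c"
    using sum_tuples_polyfun[OF vars] by (rule polyfunE)
  have "mpoly_eval P (dick A) = (\<Sum>z\<in>fib A. f z)" if A: "A \<in> Qp" for A
  proof -
    let ?T = "{..<n} \<rightarrow>\<^sub>E V (dick A)"
    have fin: "finite ?T" by (simp add: finite_V finite_PiE)
    have e: "mpoly_eval (P0 * P1) (\<lambda>(i, j). x i ^ (q ^ j)) = (if det (Moore x) \<noteq> 0 then f (Moore x) else 0)"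
      if x: "x \<in> ?T" for x
    proof -
      have xV: "x i \<in> V (dick A)" if "i < n" for i
        using PiE_mem[OF x, of i] that by simp
      have "mpoly_eval (P0 * P1) (\<lambda>(i, j). x i ^ (q ^ j)) = mpoly_eval (P0 * P1) (mat_entry (Moore x))"
        by (rule mpoly_eval_cong[OF vars]) (auto simp: mat_entry_def Moore_index)
      also have "\<dots> = mpoly_eval P0 (mat_entry (Moore x)) * ((-1) ^ (n - 1) * det (Moore x) ^ (q - 1))"
        using P1(2) by (simp add: mpoly_eval_mult)
      also have "\<dots> = (if det (Moore x) \<noteq> 0 then f (Moore x) else 0)"
      proof (cases "det (Moore x) = 0")
        case True
        then show ?thesis using q by simp
      next
        case False
        note M = Moore_Qprime[OF xV False]
        have "(-1) ^ (n - 1) * det (Moore x) ^ (q - 1) = 1" using M(1) by (simp add: Qprime_def)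
        then show ?thesis using False P0(2) M(1) by simp
      qed
      finally show ?thesis .
    qed
    have "mpoly_eval P (dick A) = (\<Sum>x\<in>?T. if det (Moore x) \<noteq> 0 then f (Moore x) else 0)"
      unfolding bspec[OF P(2) UNIV_I, symmetric] by (rule sum.cong[OF refl e])
    also have "\<dots> = (\<Sum>x\<in>{x \<in> ?T. det (Moore x) \<noteq> 0}. f (Moore x))"
      using fin by (simp add: sum.inter_filter)
    also have "\<dots> = (\<Sum>z\<in>fib A. f z)"
      by (rule sum.reindex_bij_betw[OF fib_bij[OF A]])
    finally show ?thesis .
  qed
  then show ?thesis using P(1) by blast
qed

section \<open>The points of the Dickson algebra\<close>

abbreviation ds :: "((nat \<Rightarrow>\<^sub>0 nat) \<Rightarrow>\<^sub>0 'k) \<Rightarrow> 'k mat \<Rightarrow> 'k" where "ds \<equiv> dickson_subst q n"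

abbreviation DA :: "('k mat \<Rightarrow> 'k) set" where "DA \<equiv> dickson_algebra q n"

abbreviation PS :: "((nat \<Rightarrow>\<^sub>0 nat) \<Rightarrow>\<^sub>0 'k) set" where "PS \<equiv> {P. mpoly_vars P \<subseteq> {1..n - 1}}"

abbreviation pts :: "(('k mat \<Rightarrow> 'k) \<Rightarrow> 'k) set" where "pts \<equiv> algebra_points Qp DA"

lemma ds_eq: "ds P = (\<lambda>A\<in>Qp. mpoly_eval P (dick A))"
proof -
  have "(\<lambda>i. dickson q n i (col A 0)) = dick A" for A by (simp add: dick_def fun_eq_iff)
  then show ?thesis unfolding dickson_subst_def by simp
qed

lemma ds_DA: "P \<in> PS \<Longrightarrow> ds P \<in> DA"
  unfolding dickson_algebra_def by blast

lemma DA_E: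
  assumes "a \<in> DA"
  obtains P where "P \<in> PS" "a = ds P"
  using assms unfolding dickson_algebra_def by blast

lemma PS_mult: "P \<in> PS \<Longrightarrow> Q \<in> PS \<Longrightarrow> P * Q \<in> PS"
  and PS_add: "P \<in> PS \<Longrightarrow> Q \<in> PS \<Longrightarrow> P + Q \<in> PS"
  and PS_const: "mpoly_const c \<in> PS"
  and PS_var: "i \<in> {1..n - 1} \<Longrightarrow> mpoly_var i \<in> PS"
  using mpoly_vars_mult[of P Q] mpoly_vars_add[of P Q] mpoly_vars_var[of i] by auto

lemma ds_add: "(\<lambda>x\<in>Qp. ds P x + ds Q x) = ds (P + Q)"
  and ds_mult: "(\<lambda>x\<in>Qp. ds P x * ds Q x) = ds (P * Q)"
  and ds_const: "(\<lambda>x\<in>Qp. t) = ds (mpoly_const t)"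
  by (auto simp: ds_eq mpoly_eval_add mpoly_eval_mult fun_eq_iff)

text \<open>The point of the spectrum belonging to \<open>A\<close>. Restriction to
  \<open>DA\<close> matches the extensionality demanded by \<open>algebra_points\<close>.\<close>

definition ev :: "'k mat \<Rightarrow> ('k mat \<Rightarrow> 'k) \<Rightarrow> 'k" where
  "ev A = (\<lambda>a\<in>DA. a A)"

lemma ev_ds: "P \<in> PS \<Longrightarrow> A \<in> Qp \<Longrightarrow> ev A (ds P) = mpoly_eval P (dick A)"
  using ds_DA by (simp add: ev_def ds_eq)

lemma ev_pts:
  assumes A: "A \<in> Qp"
  shows "ev A \<in> pts"
  unfolding algebra_points_def
proof (intro CollectI conjI allI ballI)
  show "ev A \<in> extensional DA" by (simp add: ev_def)
  show "ev A (\<lambda>x\<in>Qp. t) = t" for t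
    unfolding ds_const ev_ds[OF PS_const A] by simp
  fix a b assume "a \<in> DA" "b \<in> DA"
  then obtain P Q where P: "P \<in> PS" "a = ds P" and Q: "Q \<in> PS" "b = ds Q"
    using DA_E by metis
  show "ev A (\<lambda>x\<in>Qp. a x + b x) = ev A a + ev A b"
    unfolding P(2) Q(2) ds_add ev_ds[OF PS_add[OF P(1) Q(1)] A] ev_ds[OF P(1) A] ev_ds[OF Q(1) A]
    by (rule mpoly_eval_add)
  show "ev A (\<lambda>x\<in>Qp. a x * b x) = ev A a * ev A b"
    unfolding P(2) Q(2) ds_mult ev_ds[OF PS_mult[OF P(1) Q(1)] A] ev_ds[OF P(1) A] ev_ds[OF Q(1) A]
    by (rule mpoly_eval_mult)
qed

lemma ev_eq_iff:
  assumes A: "A \<in> Qp" and B: "B \<in> Qp"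
  shows "ev A = ev B \<longleftrightarrow> agree (dick A) (dick B)"
proof
  assume e: "ev A = ev B"
  show "agree (dick A) (dick B)"
    unfolding agree_def
  proof
    fix i assume i: "i \<in> {1..n - 1}"
    show "dick A i = dick B i"
      using ev_ds[OF PS_var[OF i] A] ev_ds[OF PS_var[OF i] B] e by simp
  qed
next
  assume ag: "agree (dick A) (dick B)"
  have "a A = a B" if "a \<in> DA" for a
  proof -
    obtain P where P: "P \<in> PS" "a = ds P" using DA_E[OF \<open>a \<in> DA\<close>] .
    then show ?thesis using mpoly_eval_agree[OF _ ag, of P] A B by (simp add: ds_eq)
  qed
  then show "ev A = ev B" by (auto simp: ev_def fun_eq_iff)
qed

lemma Qprime_dick_surj: "\<exists>A\<in>Qp. agree (dick A) c"
  using Qprime_surj[of c] lang_Qprime unicol_eq_iff by metis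

text \<open>Over an infinite field it suffices to compare values.\<close>

lemma mpoly_monomial_eq:
  "Poly_Mapping.single m c = (mpoly_const c *
     (\<Prod>v\<in>Poly_Mapping.keys m. mpoly_var v ^ Poly_Mapping.lookup m v) :: (nat \<Rightarrow>\<^sub>0 nat) \<Rightarrow>\<^sub>0 'k)"
  by (rule mpoly_eq_iff_eval[OF infinite_field])
     (simp add: mpoly_eval_single mpoly_eval_mult mpoly_eval_prod mpoly_eval_power)

text \<open>A character is determined by its values \<open>\<tau> i\<close> on the generators, and
  the Dickson map is surjective, so some \<open>A\<close> in \<open>Q'\<close> has these values as
  parameters.\<close>

lemma pts_ev:
  assumes \<chi>: "\<chi> \<in> pts"
  shows "\<exists>A\<in>Qp. \<chi> = ev A"
proof -
  define \<tau> where "\<tau> i = \<chi> (ds (mpoly_var i))" for i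
  have ext: "\<chi> \<in> extensional DA" and c: "\<chi> (ds (mpoly_const t)) = t"
    and plus: "\<And>P Q. P \<in> PS \<Longrightarrow> Q \<in> PS \<Longrightarrow> \<chi> (ds (P + Q)) = \<chi> (ds P) + \<chi> (ds Q)"
    and mult: "\<And>P Q. P \<in> PS \<Longrightarrow> Q \<in> PS \<Longrightarrow> \<chi> (ds (P * Q)) = \<chi> (ds P) * \<chi> (ds Q)" for t
    using \<chi> ds_DA unfolding algebra_points_def ds_const[symmetric] ds_add[symmetric] ds_mult[symmetric]
    by auto
  have one: "(1 :: (nat \<Rightarrow>\<^sub>0 nat) \<Rightarrow>\<^sub>0 'k) = mpoly_const 1" by (simp add: mpoly_const_def)
  have pow: "P ^ k \<in> PS \<and> \<chi> (ds (P ^ k)) = \<chi> (ds P) ^ k" if "P \<in> PS" for P k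
  proof (induct k)
    case 0
    then show ?case using c[of 1] PS_const[of 1] by (simp add: one[symmetric])
  next
    case (Suc k)
    then show ?case using PS_mult[OF that, of "P ^ k"] mult[OF that, of "P ^ k"] by simp
  qed
  have pr: "(\<Prod>v\<in>I. f v) \<in> PS \<and> \<chi> (ds (\<Prod>v\<in>I. f v)) = (\<Prod>v\<in>I. \<chi> (ds (f v)))"
    if "finite I" "\<And>v. v \<in> I \<Longrightarrow> f v \<in> PS" for I :: "nat set" and f
    using that
  proof (induct I)
    case empty
    then show ?case using c[of 1] PS_const[of 1] by (simp add: one[symmetric])
  next
    case (insert v I)
    then show ?case using PS_mult[of "f v" "\<Prod>v\<in>I. f v"] mult[of "f v" "\<Prod>v\<in>I. f v"] by simp
  qed
  have main: "P \<in> PS \<and> \<chi> (ds P) = mpoly_eval P \<tau>" if "P \<in> PS" for P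
  proof -
    have "Poly_Mapping.keys P \<subseteq> {m. Poly_Mapping.keys m \<subseteq> {1..n - 1}}"
      using that by (auto simp: mpoly_vars_def)
    then show ?thesis
    proof (induct P rule: mpoly_induct)
      case (monomial m a)
      define Q :: "(nat \<Rightarrow>\<^sub>0 nat) \<Rightarrow>\<^sub>0 'k" where "Q = (\<Prod>v\<in>Poly_Mapping.keys m. mpoly_var v ^ Poly_Mapping.lookup m v)"
      have v: "mpoly_var v \<in> PS" if "v \<in> Poly_Mapping.keys m" for v
        using monomial that by (intro PS_var) auto
      have Q: "Q \<in> PS" "\<chi> (ds Q) = (\<Prod>v\<in>Poly_Mapping.keys m. \<tau> v ^ Poly_Mapping.lookup m v)"
        using pr[of "Poly_Mapping.keys m" "\<lambda>v. mpoly_var v ^ Poly_Mapping.lookup m v"] pow[OF v]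
        unfolding Q_def \<tau>_def by simp_all
      show ?case
        unfolding mpoly_monomial_eq[of m a, folded Q_def]
        using PS_mult[OF PS_const Q(1)] mult[OF PS_const Q(1)] c Q(2)
        by (simp add: mpoly_eval_mult) (simp add: Q_def mpoly_eval_prod mpoly_eval_power)
    next
      case zero
      then show ?case using c[of 0] PS_const[of 0] by (simp add: mpoly_const_def)
    next
      case (add P Q)
      then show ?case using PS_add[of P Q] plus[of P Q] by (simp add: mpoly_eval_add)
    qed
  qed
  obtain A where A: "A \<in> Qp" "agree (dick A) \<tau>" using Qprime_dick_surj by blast
  have "\<chi> a = ev A a" for a
  proof (cases "a \<in> DA")
    case True
    then obtain P where P: "P \<in> PS" "a = ds P" by (rule DA_E)
    show ?thesis
      using main[OF P(1)] ev_ds[OF P(1) A(1)] mpoly_eval_agree[OF _ A(2), of P] P by simp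
  next
    case False
    then show ?thesis using ext by (simp add: ev_def extensional_def)
  qed
  then show ?thesis using A(1) by blast
qed

end

section \<open>The isomorphisms\<close>

context frob_field
begin

section \<open>The quotient of \<open>Q'\<close> by the finite group\<close>

definition salg :: "((('k mat \<Rightarrow> 'k) \<Rightarrow> 'k) \<Rightarrow> 'k) set" where
  "salg = (\<lambda>a \<chi>. \<chi> a) ` DA"

lemma salgI: "P \<in> PS \<Longrightarrow> (\<lambda>\<chi>. \<chi> (ds P)) \<in> salg"
  unfolding salg_def using ds_DA by blast

lemma salgE:
  assumes "a \<in> salg"
  obtains P where "P \<in> PS" "a = (\<lambda>\<chi>. \<chi> (ds P))"
  using assms unfolding salg_def by (auto elim: DA_E)

lemma fspace_spec_eq: "fspace_spec Qp DA = fspace_of pts salg"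
  by (simp add: fspace_spec_def salg_def)

lemma mult_stable_salg: "mult_stable pts salg"
  unfolding mult_stable_def
proof (intro conjI ballI)
  have "\<chi> (ds (mpoly_const 1)) = 1" if "\<chi> \<in> pts" for \<chi>
  proof -
    have "\<chi> (\<lambda>x\<in>Qp. 1) = 1" using that by (simp add: algebra_points_def)
    then show ?thesis unfolding ds_const .
  qed
  then show "\<exists>c\<in>salg. \<forall>\<chi>\<in>pts. c \<chi> = 1"
    by (intro bexI[OF _ salgI[OF PS_const[of 1]]]) simp
  fix a b assume "a \<in> salg" "b \<in> salg"
  obtain P where P: "P \<in> PS" "a = (\<lambda>\<chi>. \<chi> (ds P))" using \<open>a \<in> salg\<close> by (rule salgE)
  obtain Q where Q: "Q \<in> PS" "b = (\<lambda>\<chi>. \<chi> (ds Q))" using \<open>b \<in> salg\<close> by (rule salgE)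
  have "\<chi> (ds (P * Q)) = \<chi> (ds P) * \<chi> (ds Q)" if "\<chi> \<in> pts" for \<chi>
    using that ds_DA[OF P(1)] ds_DA[OF Q(1)] ds_mult[of P Q, symmetric] by (simp add: algebra_points_def)
  then show "\<exists>c\<in>salg. \<forall>\<chi>\<in>pts. c \<chi> = a \<chi> * b \<chi>"
    using P Q by (intro bexI[OF _ salgI[OF PS_mult[OF P(1) Q(1)]]]) simp
qed

definition DL :: "'k mat set" where
  "DL = {g \<in> GL n. minv g * frob q g \<in> (\<lambda>u. w * u) ` Ustar n}"

lemma DL_iff: "g \<in> DL \<longleftrightarrow> g \<in> carrier_mat n n \<and> det g \<noteq> 0 \<and> lang q n g \<in> Ustar n"
proof -
  have "minv g * frob q g \<in> (\<lambda>u. w * u) ` Ustar n \<longleftrightarrow> lang q n g \<in> Ustar n"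
    if g: "g \<in> carrier_mat n n" "det g \<noteq> 0"
  proof -
    note m = minv_carrier[OF g]
    have e: "lang q n g = minv w * (minv g * frob q g)"
      unfolding lang_def using g(1) m by (simp add: assoc_mult_mat[of _ n n _ n _ n])
    have f: "minv g * frob q g \<in> carrier_mat n n" using g m by simp
    show ?thesis
    proof
      assume "minv g * frob q g \<in> (\<lambda>u. w * u) ` Ustar n"
      then obtain u where u: "u \<in> Ustar n" "minv g * frob q g = w * u" by blast
      then have "lang q n g = u"
        unfolding e using mult_minv_cancel(2)[OF wdot_carrier[OF n] det_wdot_nz[OF n] Ustar_carrier[OF u(1)]]
        by simp
      then show "lang q n g \<in> Ustar n" using u by simp
    next
      assume "lang q n g \<in> Ustar n"
      moreover have "minv g * frob q g = w * lang q n g"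
        unfolding e using mult_minv_cancel(1)[OF wdot_carrier[OF n] det_wdot_nz[OF n] f] by simp
      ultimately show "minv g * frob q g \<in> (\<lambda>u. w * u) ` Ustar n" by blast
    qed
  qed
  then show ?thesis unfolding DL_def GL_iff by auto
qed

lemma Qprime_DL: "A \<in> Qp \<Longrightarrow> A \<in> DL"
  unfolding DL_iff using Qprime_carrier[of A] Qprime_det[of A] lang_Qprime[of A] unicol_Ustar by simp

text \<open>Where the Lang image is unitriangular, \<open>det_power_iff\<close> gives
  \<open>(-1) ^ (n - 1) * det A ^ (q - 1) = 1\<close>. So a signed \<open>det A ^ (q - 2)\<close>
  inverts the determinant and matrix inversion is polynomial.\<close>

lemma polymat_lang: "polymat n DL mat_entry ({..<n} \<times> {..<n}) (lang q n)"
proof -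
  have id: "polymat n DL mat_entry ({..<n} \<times> {..<n}) (\<lambda>A. A)"
    by (rule polymat_id) (auto simp: DL_iff)
  have "polymat n DL mat_entry ({..<n} \<times> {..<n}) minv"
  proof (rule polymat_minv[OF id])
    show "(\<lambda>A. (-1) ^ (n - 1) * det A ^ (q - 2)) \<in> matfun n DL"
      by (intro polyfun_mult polyfun_const polyfun_power polymat_det[OF id])
    fix A assume A: "A \<in> DL"
    then have "(-1) ^ (n - 1) * det A ^ (q - 1) = 1"
      using det_power_iff[of A] by (simp add: DL_iff Ustar_det[of "lang q n A" n])
    moreover have "q - 1 = Suc (q - 2)" using q by simp
    ultimately show "(-1) ^ (n - 1) * det A ^ (q - 2) * det A = 1" by (simp add: mult_ac)
  qed
  then have "polymat n DL mat_entry ({..<n} \<times> {..<n}) (\<lambda>A. minv w * minv A * frob q A)"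
    by (intro polymat_mult polymat_const polymat_frob id) simp_all
  then show ?thesis by (simp add: lang_def[abs_def])
qed

lemma polyfun_subset: "f \<in> polyfun S X I \<Longrightarrow> T \<subseteq> S \<Longrightarrow> f \<in> polyfun T X I"
  unfolding polyfun_def by blast

text \<open>The Dickson elements are read off the last column of the polynomial Lang map, not
  expanded from their defining product.\<close>

lemma matfun_dick:
  assumes i: "i \<in> {1..n - 1}"
  shows "(\<lambda>A. dick A i) \<in> matfun n Qp"
proof (rule polyfun_cong)
  have i': "i - 1 < n" "i - 1 \<noteq> n - 1" "i - 1 + 1 = i" using i by auto
  have "(\<lambda>A. lang q n A $$ (i - 1, n - 1)) \<in> matfun n DL"
    using i' by (intro polymat_index[OF polymat_lang]) auto
  then show "(\<lambda>A. - (lang q n A $$ (i - 1, n - 1))) \<in> matfun n Qp"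
    using Qprime_DL by (intro polyfun_uminus) (rule polyfun_subset, auto)
  show "dick A i = - (lang q n A $$ (i - 1, n - 1))" if "A \<in> Qp" for A
    unfolding lang_Qprime[OF that] using i' by (simp add: unicol_def)
qed

text \<open>The descended functions are the traces of \<open>m a\<close> and \<open>m b\<close>. The
  multiplier \<open>m\<close> leaves a single nonzero summand in the fibre of \<open>A\<close>;
  without it the trace of \<open>b\<close> could vanish there.\<close>

lemma Qprime_descends:
  assumes A: "A \<in> Qp"
  shows "descends Qp (matalg n) pts salg ev A (ev A)"
  unfolding descends_def
proof (intro ballI impI)
  fix a b :: "'k mat \<Rightarrow> 'k"
  assume a: "a \<in> matalg n" and b: "b \<in> matalg n" and bA: "b A \<noteq> 0"
  have fibc: "z \<in> carrier_mat n n" if "z \<in> fib A" for z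
    using that Qprime_carrier by (simp add: fib_def)
  have "\<exists>ij\<in>{..<n} \<times> {..<n}. y $$ ij \<noteq> A $$ ij" if "y \<in> fib A - {A}" for y
  proof (rule ccontr)
    assume "\<not> ?thesis"
    then have "y = A" using fibc[of y] Qprime_carrier[OF A] that by (intro eq_matI) auto
    then show False using that by simp
  qed
  then obtain ij where ij: "\<And>y. y \<in> fib A - {A} \<Longrightarrow> ij y \<in> {..<n} \<times> {..<n} \<and> y $$ ij y \<noteq> A $$ ij y"
    by metis
  \<comment> \<open>For every other point \<open>y\<close> of the fibre, \<open>ij y\<close> is a
    position where \<open>y\<close> differs from \<open>A\<close>; the corresponding factor vanishes
    at \<open>y\<close> but not at \<open>A\<close>.\<close>
  define m where "m z = (\<Prod>y\<in>fib A - {A}. z $$ ij y - y $$ ij y)" for z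
  have mpoly: "m \<in> matfun n Qp"
    unfolding m_def[abs_def]
  proof (intro polyfun_prod polyfun_diff polyfun_const)
    fix y assume "y \<in> fib A - {A}"
    then have "ij y \<in> {..<n} \<times> {..<n}" using ij by blast
    then show "(\<lambda>z. z $$ ij y) \<in> matfun n Qp"
      using polyfun_coord[of "ij y" "{..<n} \<times> {..<n}" mat_entry Qp] by (simp add: mat_entry_def)
  qed
  have fin: "finite (fib A)" by (rule finite_fib[OF A])
  have "A $$ ij y - y $$ ij y \<noteq> 0" if "y \<in> fib A - {A}" for y
    using ij[OF that] by auto
  then have mA: "m A \<noteq> 0" unfolding m_def by (simp add: fin)
  have m0: "m y = 0" if "y \<in> fib A - {A}" for y
    unfolding m_def using fin that by (intro prod_zero) auto
  obtain Pa where Pa: "Pa \<in> PS" "\<forall>B\<in>Qp. mpoly_eval Pa (dick B) = (\<Sum>z\<in>fib B. m z * a z)"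
    using trace_polyfun[OF polyfun_mult[OF mpoly matalg_matfun[OF a]]] by blast
  obtain Pb where Pb: "Pb \<in> PS" "\<forall>B\<in>Qp. mpoly_eval Pb (dick B) = (\<Sum>z\<in>fib B. m z * b z)"
    using trace_polyfun[OF polyfun_mult[OF mpoly matalg_matfun[OF b]]] by blast
  have ea: "ev B (ds Pa) = (\<Sum>z\<in>fib B. m z * a z)" and eb: "ev B (ds Pb) = (\<Sum>z\<in>fib B. m z * b z)"
    if "B \<in> Qp" for B
    using ev_ds[OF Pa(1) that] ev_ds[OF Pb(1) that] Pa(2) Pb(2) that by simp_all
  have fibev: "z \<in> fib B \<longleftrightarrow> z \<in> Qp \<and> ev z = ev B" if "B \<in> Qp" for z B
    using ev_eq_iff[of z B] that by (auto simp: fib_def)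
  show "\<exists>a'\<in>salg. \<exists>b'\<in>salg. b' (ev A) \<noteq> 0 \<and>
      (\<forall>y'\<in>pts. b' y' \<noteq> 0 \<longrightarrow> (\<exists>z\<in>Qp. ev z = y' \<and> b z \<noteq> 0)) \<and>
      (\<forall>y'\<in>pts. \<forall>h. (\<forall>z\<in>Qp. ev z = y' \<longrightarrow> a z = h * b z) \<longrightarrow> a' y' = h * b' y')"
  proof (rule bexI[OF _ salgI[OF Pa(1)]], rule bexI[OF _ salgI[OF Pb(1)]], intro conjI ballI impI allI)
    have "(\<Sum>z\<in>fib A. m z * b z) = m A * b A + (\<Sum>z\<in>fib A - {A}. m z * b z)"
      using fin A by (intro sum.remove) (auto simp: fib_def)
    also have "(\<Sum>z\<in>fib A - {A}. m z * b z) = 0" using m0 by (intro sum.neutral) simp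
    finally show "ev A (ds Pb) \<noteq> 0" using eb[OF A] mA bA by simp
  next
    fix y assume y: "y \<in> pts" "y (ds Pb) \<noteq> 0"
    obtain B where B: "B \<in> Qp" "y = ev B" using pts_ev[OF y(1)] by blast
    then obtain z where "z \<in> fib B" "m z * b z \<noteq> 0"
      using eb[OF B(1)] y(2) by (metis (no_types, lifting) sum.neutral)
    then show "\<exists>z\<in>Qp. ev z = y \<and> b z \<noteq> 0" using fibev[OF B(1)] B(2) by auto
  next
    fix y h assume y: "y \<in> pts" "\<forall>z\<in>Qp. ev z = y \<longrightarrow> a z = h * b z"
    obtain B where B: "B \<in> Qp" "y = ev B" using pts_ev[OF y(1)] by blast
    have "(\<Sum>z\<in>fib B. m z * a z) = (\<Sum>z\<in>fib B. h * (m z * b z))"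
      using y(2) fibev[OF B(1)] B(2) by (intro sum.cong) auto
    then show "y (ds Pa) = h * y (ds Pb)"
      unfolding B(2) ea[OF B(1)] eb[OF B(1)] by (simp add: sum_distrib_left)
  qed
qed

lemma ev_image: "ev ` Qp = pts"
  using ev_pts pts_ev by blast

lemma G_mod_Qprime_iso:
  assumes \<rho>: "\<And>A. A \<in> Qp \<Longrightarrow> \<rho> (Qprime_orbit q n A) = ev A"
  shows "fspace_iso \<rho> (G_mod_Qprime q n) (fspace_spec Qp DA)"
  unfolding G_mod_Qprime_def matrix_fspace_eq fspace_spec_eq
proof (rule fspace_quotient_iso[where r = ev])
  show "\<exists>a\<in>matalg n. \<forall>A\<in>Qp. a A = a' (ev A)" if a': "a' \<in> salg" for a'
  proof -
    obtain P where P: "P \<in> PS" "a' = (\<lambda>\<chi>. \<chi> (ds P))" using a' by (rule salgE)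
    have "(\<lambda>A. mpoly_eval P (dick A)) \<in> matfun n Qp"
      using P(1) by (intro polyfun_eval[of P "{1..n - 1}"] matfun_dick) auto
    then show ?thesis unfolding matfun_iff using ev_ds[OF P(1)] P(2) by simp
  qed
  show "\<exists>A\<in>Qp. ev A = y \<and> descends Qp (matalg n) pts salg ev A y" if y: "y \<in> pts" for y
    using pts_ev[OF y] Qprime_descends by blast
qed (simp_all add: mult_stable_matalg mult_stable_salg ev_image Qprime_orbit_eq_iff ev_eq_iff \<rho>)

section \<open>The quotient of \<open>Ustar n\<close> by \<open>\<rho>\<close>\<close>

definition qpt :: "(nat \<Rightarrow> 'k) \<Rightarrow> 'k mat" where
  "qpt c = (SOME A. A \<in> Qp \<and> agree (dick A) c)"

lemma qpt: "qpt c \<in> Qp" "agree (dick (qpt c)) c"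
  using someI_ex[of "\<lambda>A. A \<in> Qp \<and> agree (dick A) c"] Qprime_dick_surj[of c]
  unfolding qpt_def by blast+

text \<open>The point of the spectrum with the coordinates \<open>nfc v\<close>. It is obtained by
  evaluation at a chosen point of \<open>Q'\<close>, and depends on the choice only through these
  coordinates.\<close>

definition uev :: "'k mat \<Rightarrow> ('k mat \<Rightarrow> 'k) \<Rightarrow> 'k" where
  "uev v = ev (qpt (nfc v))"

lemma uev_unicol:
  assumes A: "A \<in> Qp" and e: "agree (dick A) c"
  shows "uev (unicol n c) = ev A"
proof -
  have "agree (nfc (unicol n c)) c" using nfc_unicol[of c] unicol_eq_iff by blast
  then have "agree (dick (qpt (nfc (unicol n c)))) (dick A)"
    using qpt(2) e agree_trans agree_sym by blast
  then show ?thesis unfolding uev_def using ev_eq_iff[OF qpt(1) A] by blast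
qed

lemma uev_eq_iff: "uev v = uev v' \<longleftrightarrow> agree (nfc v) (nfc v')"
  unfolding uev_def ev_eq_iff[OF qpt(1) qpt(1)]
  using qpt(2)[of "nfc v"] qpt(2)[of "nfc v'"] agree_trans agree_sym by blast

lemma uev_lang: "A \<in> Qp \<Longrightarrow> uev (lang q n A) = ev A"
  unfolding lang_Qprime by (rule uev_unicol) auto

text \<open>The matrices \<open>unicol n c\<close> form a section, so numerator and denominator
  descend by restriction to it, as polynomials in \<open>c\<close>.\<close>

lemma uev_descends:
  assumes A: "A \<in> Qp"
  shows "descends (Ustar n) (matalg n) pts salg uev (unicol n (dick A)) (ev A)"
  unfolding descends_def
proof (intro ballI impI)
  fix a b :: "'k mat \<Rightarrow> 'k"
  assume a: "a \<in> matalg n" and b: "b \<in> matalg n" and bA: "b (unicol n (dick A)) \<noteq> 0"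
  have pol: "(\<lambda>c. a (unicol n c)) \<in> polyfun UNIV (\<lambda>c. c) {1..n - 1}" if a: "a \<in> matalg n" for a :: "'k mat \<Rightarrow> 'k"
  proof (rule polyfun_comp[OF matalg_matfun[OF a, of UNIV]])
    fix ij assume "ij \<in> {..<n} \<times> {..<n}"
    then obtain i j where ij: "ij = (i, j)" "i < n" "j < n" by auto
    consider "i = j" | "i \<noteq> j" "j = n - 1" | "i \<noteq> j" "j \<noteq> n - 1" by blast
    then show "(\<lambda>c. mat_entry (unicol n c) ij) \<in> polyfun UNIV (\<lambda>c. c) {1..n - 1}"
    proof cases
      case 2
      then have "(\<lambda>c. - c (i + 1)) \<in> polyfun UNIV (\<lambda>c. c) {1..n - 1}"
        using ij by (intro polyfun_uminus polyfun_coord) auto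
      then show ?thesis using 2 ij by (simp add: mat_entry_def unicol_def)
    qed (use ij in \<open>simp_all add: mat_entry_def unicol_def polyfun_const\<close>)
  qed simp
  obtain Pa where Pa: "mpoly_vars Pa \<subseteq> {1..n - 1}" "\<forall>c\<in>UNIV. a (unicol n c) = mpoly_eval Pa c"
    using pol[OF a] by (rule polyfunE)
  obtain Pb where Pb: "mpoly_vars Pb \<subseteq> {1..n - 1}" "\<forall>c\<in>UNIV. b (unicol n c) = mpoly_eval Pb c"
    using pol[OF b] by (rule polyfunE)
  have PS: "Pa \<in> PS" "Pb \<in> PS" using Pa Pb by auto
  have e: "ev B (ds Pa) = a (unicol n (dick B))" "ev B (ds Pb) = b (unicol n (dick B))" if "B \<in> Qp" for B
    using ev_ds[OF PS(1) that] ev_ds[OF PS(2) that] Pa(2) Pb(2) by simp_all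
  have u: "uev (unicol n (dick B)) = ev B" if "B \<in> Qp" for B
    using uev_unicol[OF that] by simp
  show "\<exists>a'\<in>salg. \<exists>b'\<in>salg. b' (ev A) \<noteq> 0 \<and>
      (\<forall>y'\<in>pts. b' y' \<noteq> 0 \<longrightarrow> (\<exists>z\<in>Ustar n. uev z = y' \<and> b z \<noteq> 0)) \<and>
      (\<forall>y'\<in>pts. \<forall>h. (\<forall>z\<in>Ustar n. uev z = y' \<longrightarrow> a z = h * b z) \<longrightarrow> a' y' = h * b' y')"
  proof (rule bexI[OF _ salgI[OF PS(1)]], rule bexI[OF _ salgI[OF PS(2)]], intro conjI ballI impI allI)
    show "ev A (ds Pb) \<noteq> 0" using e(2)[OF A] bA by simp
  next
    fix y assume y: "y \<in> pts" "y (ds Pb) \<noteq> 0"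
    obtain B where B: "B \<in> Qp" "y = ev B" using pts_ev[OF y(1)] by blast
    then show "\<exists>z\<in>Ustar n. uev z = y \<and> b z \<noteq> 0"
      using e(2)[OF B(1)] y(2) u[OF B(1)] by (intro bexI[OF _ unicol_Ustar[of n "dick B"]]) auto
  next
    fix y h assume y: "y \<in> pts" "\<forall>z\<in>Ustar n. uev z = y \<longrightarrow> a z = h * b z"
    obtain B where B: "B \<in> Qp" "y = ev B" using pts_ev[OF y(1)] by blast
    then show "y (ds Pa) = h * y (ds Pb)"
      using y(2) e[OF B(1)] u[OF B(1)] unicol_Ustar[of n "dick B"] by simp
  qed
qed

lemma rho_orbit_eq_iff_uev:
  "v \<in> Ustar n \<Longrightarrow> v' \<in> Ustar n \<Longrightarrow> rho_orbit q n v = rho_orbit q n v' \<longleftrightarrow> uev v = uev v'"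
  unfolding rho_orbit_eq_iff_nfc uev_eq_iff unicol_eq_iff ..

lemma Ustar_mod_rho_iso:
  assumes \<rho>: "\<And>v. v \<in> Ustar n \<Longrightarrow> \<rho> (rho_orbit q n v) = uev v"
  shows "fspace_iso \<rho> (Ustar_mod_rho q n) (fspace_spec Qp DA)"
  unfolding Ustar_mod_rho_def matrix_fspace_eq fspace_spec_eq
proof (rule fspace_quotient_iso[where r = uev])
  show "uev ` Ustar n = pts"
  proof (intro equalityI subsetI)
    fix y assume "y \<in> uev ` Ustar n"
    then show "y \<in> pts" using ev_pts[OF qpt(1)] by (auto simp: uev_def)
  next
    fix y assume "y \<in> pts"
    then obtain A where A: "A \<in> Qp" "y = ev A" using pts_ev by blast
    have "uev (unicol n (dick A)) \<in> uev ` Ustar n" by (rule imageI[OF unicol_Ustar])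
    then show "y \<in> uev ` Ustar n" unfolding uev_unicol[OF A(1) agree_refl] A(2) .
  qed
  show "\<exists>a\<in>matalg n. \<forall>v\<in>Ustar n. a v = a' (uev v)" if a': "a' \<in> salg" for a'
  proof -
    obtain P where P: "P \<in> PS" "a' = (\<lambda>\<chi>. \<chi> (ds P))" using a' by (rule salgE)
    have "(\<lambda>v. mpoly_eval P (nfc v)) \<in> matfun n (Ustar n)"
      using P(1) by (intro polyfun_eval[of P "{1..n - 1}"] matfun_nfc) auto
    moreover have "a' (uev v) = mpoly_eval P (nfc v)" for v
      unfolding P(2) uev_def ev_ds[OF P(1) qpt(1)]
      using P(1) by (intro mpoly_eval_agree[OF _ qpt(2)]) simp
    ultimately show ?thesis unfolding matfun_iff by simp
  qed
  show "\<exists>v\<in>Ustar n. uev v = y \<and> descends (Ustar n) (matalg n) pts salg uev v y" if y: "y \<in> pts" for y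
  proof -
    obtain A where A: "A \<in> Qp" "y = ev A" using pts_ev[OF y] by blast
    then show ?thesis using uev_descends[OF A(1)] uev_unicol[OF A(1) agree_refl] unicol_Ustar[of n "dick A"] by blast
  qed
qed (simp_all add: mult_stable_matalg mult_stable_salg rho_orbit_eq_iff_uev \<rho>)

section \<open>The Deligne--Lusztig variety\<close>

lemma lang_right_mult:
  assumes g: "g \<in> carrier_mat n n" "det g \<noteq> (0 :: 'k)" and u: "u \<in> InU n"
  shows "det (g * minv u) \<noteq> 0" "lang q n (g * minv u) = rho q n u (lang q n g)"
proof -
  note U = InU_Ustar[OF n u]
  note uc = Ustar_carrier[OF U] Ustar_det_nz[OF U]
  note m = minv_carrier[OF uc] det_minv_nz[OF uc]
  note mg = minv_carrier[OF g]
  show "det (g * minv u) \<noteq> 0" using det_mult[OF g(1) m(1)] g m by simp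
  have W: "w * (minv w * X) = X" if "X \<in> carrier_mat n n" for X
    using mult_minv_cancel(1)[OF wdot_carrier[OF n] det_wdot_nz[OF n] that] .
  have "minv (g * minv u) = u * minv g"
    using minv_mult[OF g m] minv_minv[OF uc] by simp
  then show "lang q n (g * minv u) = rho q n u (lang q n g)"
    unfolding lang_def rho_def ad_minv_wdot[OF n uc(1)] using g uc m mg
    by (simp add: frob_mult assoc_mult_mat[of _ n n _ n _ n] W)
qed

text \<open>All columns of \<open>w * unicol n c\<close> except the last are shifted unit vectors,
  so each column of \<open>h\<close> is the \<open>q\<close>-th power of the preceding one.\<close>

lemma Moore_of_frob:
  assumes h: "h \<in> carrier_mat n n" and f: "frob q h = h * (w * unicol n c)"
  shows "h = Moore (\<lambda>i. h $$ (i, 0))"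
proof (rule eq_matI)
  have f': "frob q h = h * w * unicol n c" using h f by (simp add: assoc_mult_mat[of _ n n _ n _ n])
  have hw: "h * w \<in> carrier_mat n n" using h by simp
  fix i j assume "i < dim_row (Moore (\<lambda>i. h $$ (i, 0)))" "j < dim_col (Moore (\<lambda>i. h $$ (i, 0)))"
  then have ij: "i < n" "j < n" using carrier_matD[OF Moore_carrier] by auto
  have step: "h $$ (i, Suc j) = h $$ (i, j) ^ q" if j: "Suc j < n" for j
  proof -
    have "h $$ (i, j) ^ q = (h * w * unicol n c) $$ (i, j)"
      using frob_index[OF h ij(1), of j] j unfolding f' by simp
    also have "\<dots> = (h * w) $$ (i, j)"
      using mult_unicol_index[OF hw ij(1), of j c] j by simp
    also have "\<dots> = h $$ (i, Suc j)"
      using mult_wdot_index[OF n h ij(1), of j] j by auto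
    finally show ?thesis ..
  qed
  have "h $$ (i, j) = h $$ (i, 0) ^ (q ^ j)"
    using ij(2)
  proof (induct j)
    case (Suc j)
    then show ?case using step[of j] by (simp add: power_mult mult.commute[of q])
  qed simp
  then show "h $$ (i, j) = Moore (\<lambda>i. h $$ (i, 0)) $$ (i, j)" using ij by (simp add: Moore_index)
qed (use h carrier_matD[OF Moore_carrier] in auto)

text \<open>The representative in \<open>Q'\<close> of the coset of \<open>g\<close>: right
  multiplication by the inverse of \<open>u\<close> acts on the Lang image as \<open>\<rho>\<close>
  by \<open>u\<close>, and \<open>ucorr\<close> brings that image into normal form.\<close>

definition qrep :: "'k mat \<Rightarrow> 'k mat" where
  "qrep g = g * minv (ucorr (lang q n g))"

lemma qrep:
  assumes g: "g \<in> DL"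
  shows "qrep g \<in> Qp" "\<exists>u\<in>InU n. qrep g = g * u" "lang q n (qrep g) = unicol n (nfc (lang q n g))"
proof -
  have g': "g \<in> carrier_mat n n" "det g \<noteq> 0" "lang q n g \<in> Ustar n" using g by (auto simp: DL_iff)
  show "\<exists>u\<in>InU n. qrep g = g * u"
    unfolding qrep_def using InU_minv[OF n ucorr_InU] by blast
  note L = lang_right_mult[OF g'(1,2) ucorr_InU, of "lang q n g", folded qrep_def]
  show l: "lang q n (qrep g) = unicol n (nfc (lang q n g))"
    using L(2) rho_ucorr[OF g'(3)] by simp
  have c: "qrep g \<in> carrier_mat n n"
    unfolding qrep_def using g'(1) minv_carrier[OF ucorr_carrier Ustar_det_nz[OF InU_Ustar[OF n ucorr_InU]]] by simp
  have "qrep g = Moore (\<lambda>i. qrep g $$ (i, 0))"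
    using Moore_of_frob[OF c] lang_eq_iff[OF c L(1) unicol_carrier] l by blast
  then show "qrep g \<in> Qp"
    unfolding Qprime_iff l using L(1) Ustar_det[OF unicol_Ustar] by blast
qed

lemma qrep_id:
  assumes A: "A \<in> Qp"
  shows "qrep A = A"
proof -
  have "ucorr (lang q n A) = 1\<^sub>m n"
    using rho_unicol_imp_one[OF ucorr_InU rho_ucorr[OF unicol_Ustar]] lang_Qprime[OF A] by simp
  then show ?thesis using Qprime_carrier[OF A] by (simp add: qrep_def minv_one)
qed

text \<open>Both Lang images are of the form \<open>unicol n c\<close>, so the element of
  \<open>InU n\<close> relating them is trivial by \<open>rho_unicol_imp_one\<close>.\<close>

lemma Qprime_mult_InU:
  assumes A: "A \<in> Qp" and u: "u \<in> InU n" and B: "A * u \<in> Qp"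
  shows "A * u = A"
proof -
  have uc: "u \<in> carrier_mat n n" "det u \<noteq> 0"
    using Ustar_carrier[OF InU_Ustar[OF n u]] Ustar_det_nz[OF InU_Ustar[OF n u]] .
  have "rho q n (minv u) (lang q n A) = lang q n (A * u)"
    using lang_right_mult(2)[OF Qprime_carrier[OF A] Qprime_det[OF A] InU_minv[OF n u]] minv_minv[OF uc] by simp
  then have "minv u = 1\<^sub>m n"
    using rho_unicol_imp_one[OF InU_minv[OF n u]] lang_Qprime[OF A] lang_Qprime[OF B] by metis
  then have "u = 1\<^sub>m n" using minv_minv[OF uc] minv_one[of n] by metis
  then show ?thesis using Qprime_carrier[OF A] by simp
qed

lemma InU_coset_eq_iff:
  assumes "g \<in> carrier_mat n n" "h \<in> carrier_mat n n"
  shows "InU_coset n g = InU_coset n h \<longleftrightarrow> (\<exists>u\<in>InU n. h = g * (u :: 'k mat))"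
proof -
  have car: "carrier (matrix_group n (InU n)) = InU n" by (simp add: matrix_group_def)
  show ?thesis
    unfolding InU_coset_def
  proof (rule orbit_eq_iff[where E = "carrier_mat n n" and e = "1\<^sub>m n" and \<phi> = "\<lambda>u g. g * u" and
        G = "matrix_group n (InU n)", unfolded car])
    fix u u' x :: "'k mat" assume u: "u \<in> InU n" and x: "x \<in> carrier_mat n n"
    have uc: "u \<in> carrier_mat n n" "det u \<noteq> 0"
      using Ustar_carrier[OF InU_Ustar[OF n u]] Ustar_det_nz[OF InU_Ustar[OF n u]] .
    show "\<exists>h\<in>InU n. x * u * h = x"
      using x uc minv_carrier[OF uc] minv_right[OF uc]
      by (intro bexI[OF _ InU_minv[OF n u]]) (simp add: assoc_mult_mat[of _ n n _ n _ n])
    assume u': "u' \<in> InU n"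
    have "u' \<in> carrier_mat n n" using Ustar_carrier[OF InU_Ustar[OF n u']] .
    then show "\<exists>k\<in>InU n. x * u' * u = x * k"
      using x uc by (intro bexI[OF _ InU_mult[OF n u' u]]) (simp add: assoc_mult_mat[of _ n n _ n _ n])
  qed (use assms InU_one[OF n] in auto)
qed

lemma InU_coset_qrep:
  assumes g: "g \<in> DL"
  shows "InU_coset n g = InU_coset n (qrep g)"
  using qrep(2)[OF g] InU_coset_eq_iff[of g "qrep g"] Qprime_carrier[OF qrep(1)[OF g]] g
  by (simp add: DL_iff)

lemma InU_coset_eq_iff_qrep:
  assumes g: "g \<in> DL" and h: "h \<in> DL"
  shows "InU_coset n g = InU_coset n h \<longleftrightarrow> qrep g = qrep h"
proof
  assume "InU_coset n g = InU_coset n h"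
  then have "InU_coset n (qrep g) = InU_coset n (qrep h)" using InU_coset_qrep[OF g] InU_coset_qrep[OF h] by simp
  then obtain u where u: "u \<in> InU n" "qrep h = qrep g * u"
    using InU_coset_eq_iff Qprime_carrier[OF qrep(1)[OF g]] Qprime_carrier[OF qrep(1)[OF h]] by blast
  then show "qrep g = qrep h" using Qprime_mult_InU[OF qrep(1)[OF g] u(1)] qrep(1)[OF h] by simp
qed (use InU_coset_qrep[OF g] InU_coset_qrep[OF h] in simp)

lemma polymat_qrep: "polymat n DL mat_entry ({..<n} \<times> {..<n}) qrep"
proof -
  have id: "polymat n DL mat_entry ({..<n} \<times> {..<n}) (\<lambda>A. A)"
    by (rule polymat_id) (auto simp: DL_iff)
  have "polymat n DL mat_entry ({..<n} \<times> {..<n}) (\<lambda>g. ucorr (lang q n g))"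
    unfolding polymat_def
  proof (intro conjI allI impI ballI)
    fix i j assume ij: "i < n" "j < n"
    show "(\<lambda>g. ucorr (lang q n g) $$ (i, j)) \<in> matfun n DL"
    proof (rule polyfun_comp[OF matfun_ucorr[OF ij, of UNIV]])
      fix kl assume "kl \<in> {..<n} \<times> {..<n}"
      then show "(\<lambda>g. mat_entry (lang q n g) kl) \<in> matfun n DL"
        using polymat_index[OF polymat_lang] by (auto simp: mat_entry_def)
    qed simp
  qed simp
  then have "polymat n DL mat_entry ({..<n} \<times> {..<n}) (\<lambda>g. minv (ucorr (lang q n g)))"
    by (rule polymat_minv[OF _ polyfun_const[of 1]])
       (simp add: Ustar_det[OF InU_Ustar[OF n ucorr_InU]])
  then show ?thesis unfolding qrep_def[abs_def] by (intro polymat_mult id)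
qed

text \<open>Here \<open>Q'\<close> lies inside the set being divided and \<open>qrep\<close> is a
  polynomial retraction onto it, so every fraction descends by plain restriction.\<close>

lemma DL_variety_iso:
  assumes \<rho>: "\<And>g. g \<in> DL \<Longrightarrow> \<rho> (InU_coset n g) = qrep g"
  shows "fspace_iso \<rho> (DL_variety q n) (matrix_fspace n Qp)"
  unfolding DL_variety_def DL_def[symmetric] matrix_fspace_eq
proof (rule fspace_quotient_iso[where r = qrep])
  show "qrep ` DL = Qp"
    using qrep(1) qrep_id Qprime_DL by force
  show "\<exists>a\<in>matalg n. \<forall>g\<in>DL. a g = a' (qrep g)" if a': "a' \<in> matalg n" for a'
    unfolding matfun_iff[symmetric]
  proof (rule polyfun_comp[OF matalg_matfun[OF a', of UNIV]])
    fix kl assume "kl \<in> {..<n} \<times> {..<n}"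
    then show "(\<lambda>g. mat_entry (qrep g) kl) \<in> matfun n DL"
      using polymat_index[OF polymat_qrep] by (auto simp: mat_entry_def)
  qed simp
  show "\<exists>g\<in>DL. qrep g = A \<and> descends DL (matalg n) Qp (matalg n) qrep g A" if A: "A \<in> Qp" for A
  proof (intro bexI[of _ A] conjI)
    show "descends DL (matalg n) Qp (matalg n) qrep A A"
      unfolding descends_def using Qprime_DL qrep_id by blast
  qed (use A Qprime_DL qrep_id in auto)
qed (simp_all add: mult_stable_matalg InU_coset_eq_iff_qrep \<rho>)

section \<open>The induced maps between the orbit spaces\<close>

lemma lang_Qprime_Ustar: "A \<in> Qp \<Longrightarrow> lang q n A \<in> Ustar n"
  unfolding lang_Qprime by (rule unicol_Ustar)

lemma lang_Qprime_dickson: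
  assumes "A \<in> Qp"
  shows "lang q n A = mat n n (\<lambda>(i, j). if i = j then 1
      else if j = n - 1 then - dickson q n (i + 1) (col A 0) else 0)"
  unfolding lang_Qprime[OF assms] unicol_def dick_def ..

lemma fspace_local_matrix_quotient:
  "fspace_local (fspace_quotient (matrix_fspace n S) \<pi>)" for S :: "'k mat set"
  unfolding matrix_fspace_eq by (intro fspace_local_quotient fspace_local_of mult_stable_matalg)

lemma topspace_matrix_quotient:
  "topspace (zariski (fspace_quotient (matrix_fspace n S) \<pi>)) = \<pi> ` S" for S :: "'k mat set"
  unfolding matrix_fspace_eq topspace_fspace_quotient topspace_fspace_of[OF mult_stable_matalg] ..

lemma ex_Ustar_mod_rho_iso:
  "\<exists>\<psi>. (\<forall>v \<in> Ustar n. \<psi> (rho_orbit q n v) = uev v) \<and> fspace_iso \<psi> (Ustar_mod_rho q n) (fspace_spec Qp DA)"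
proof -
  obtain \<psi> where "\<And>v. v \<in> Ustar n \<Longrightarrow> \<psi> (rho_orbit q n v) = uev v"
    using factor_through[of "Ustar n" "rho_orbit q n" uev] rho_orbit_eq_iff_uev by blast
  then show ?thesis using Ustar_mod_rho_iso by blast
qed

text \<open>Both quotients are isomorphic to the spectrum of the Dickson algebra, compatibly with
  the Lang map by \<open>uev_lang\<close>, so the isomorphism between them follows by
  cancellation.\<close>

lemma ex_lang_iso:
  "\<exists>\<phi>. (\<forall>A \<in> Qp. \<phi> (Qprime_orbit q n A) = rho_orbit q n (lang q n A)) \<and>
     fspace_iso \<phi> (G_mod_Qprime q n :: ('k mat set, 'k) fspace) (Ustar_mod_rho q n)"
proof -
  obtain \<psi> where \<psi>: "\<And>v. v \<in> Ustar n \<Longrightarrow> \<psi> (rho_orbit q n v) = uev v"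
    "fspace_iso \<psi> (Ustar_mod_rho q n) (fspace_spec Qp DA)"
    using ex_Ustar_mod_rho_iso by blast
  obtain \<rho> where \<rho>: "\<And>A. A \<in> Qp \<Longrightarrow> \<rho> (Qprime_orbit q n A) = ev A"
    using factor_through[of Qp "Qprime_orbit q n" ev] Qprime_orbit_eq_iff ev_eq_iff by blast
  have "lang q n A = lang q n B" if "A \<in> Qp" "B \<in> Qp" "Qprime_orbit q n A = Qprime_orbit q n B" for A B
    using that Qprime_orbit_eq_iff[OF that(1,2)] lang_Qprime[OF that(1)] lang_Qprime[OF that(2)] unicol_eq_iff
    by simp
  then obtain \<phi> where \<phi>: "\<And>A. A \<in> Qp \<Longrightarrow> \<phi> (Qprime_orbit q n A) = rho_orbit q n (lang q n A)"
    using factor_through[of Qp "Qprime_orbit q n" "\<lambda>A. rho_orbit q n (lang q n A)"] by metis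
  have "fspace_iso \<phi> (G_mod_Qprime q n) (Ustar_mod_rho q n)"
  proof (rule fspace_iso_cancel[OF \<psi>(2) G_mod_Qprime_iso[OF \<rho>]])
    show "fspace_local (Ustar_mod_rho q n :: ('k mat set, 'k) fspace)"
      unfolding Ustar_mod_rho_def by (rule fspace_local_matrix_quotient)
    show "fspace_local (G_mod_Qprime q n :: ('k mat set, 'k) fspace)"
      unfolding G_mod_Qprime_def by (rule fspace_local_matrix_quotient)
    fix t :: "'k mat set" assume "t \<in> topspace (zariski (G_mod_Qprime q n))"
    then obtain A where "A \<in> Qp" "t = Qprime_orbit q n A"
      unfolding G_mod_Qprime_def topspace_matrix_quotient by blast
    then show "\<phi> t \<in> topspace (zariski (Ustar_mod_rho q n)) \<and> \<psi> (\<phi> t) = \<rho> t"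
      unfolding Ustar_mod_rho_def topspace_matrix_quotient
      using \<phi> \<psi>(1) \<rho> lang_Qprime_Ustar uev_lang by simp
  qed auto
  then show ?thesis using \<phi> by blast
qed

text \<open>This says that the Dickson elements are algebraically independent: every parameter tuple
  occurs on \<open>Q'\<close>, and a polynomial over an infinite field is determined by its
  values.\<close>

lemma inj_on_ds: "inj_on ds PS"
proof
  fix P Q assume P: "P \<in> PS" and Q: "Q \<in> PS" and e: "ds P = ds Q"
  have "mpoly_eval P c = mpoly_eval Q c" for c
  proof -
    obtain A where A: "A \<in> Qp" "agree (dick A) c" using Qprime_dick_surj by blast
    have "mpoly_eval P (dick A) = mpoly_eval Q (dick A)"
      using fun_cong[OF e, of A] A(1) by (simp add: ds_eq)
    then show ?thesis
      using mpoly_eval_agree[OF _ A(2), of P] mpoly_eval_agree[OF _ A(2), of Q] P Q by simp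
  qed
  then show "P = Q" by (rule mpoly_eq_iff_eval[OF infinite_field])
qed

text \<open>The coset map on \<open>Q'\<close> is inverse to the map induced by \<open>qrep\<close>,
  so \<open>DL_variety_iso\<close> is cancelled against the identity.\<close>

lemma InU_coset_iso: "fspace_iso (InU_coset n) (matrix_fspace n Qp) (DL_variety q n)"
proof -
  obtain \<rho> where \<rho>: "\<And>g. g \<in> DL \<Longrightarrow> \<rho> (InU_coset n g) = qrep g"
    using factor_through[of DL "InU_coset n" qrep] InU_coset_eq_iff_qrep by blast
  show ?thesis
  proof (rule fspace_iso_cancel[OF DL_variety_iso[OF \<rho>] fspace_iso_id])
    show "fspace_local (DL_variety q n :: ('k mat set, 'k) fspace)"
      unfolding DL_variety_def by (rule fspace_local_matrix_quotient)
    show "fspace_local (matrix_fspace n Qp)"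
      unfolding matrix_fspace_eq by (intro fspace_local_of mult_stable_matalg)
    fix A :: "'k mat" assume "A \<in> topspace (zariski (matrix_fspace n Qp))"
    then have "A \<in> Qp" unfolding matrix_fspace_eq topspace_fspace_of[OF mult_stable_matalg] .
    then show "InU_coset n A \<in> topspace (zariski (DL_variety q n)) \<and> \<rho> (InU_coset n A) = id A"
      unfolding DL_variety_def DL_def[symmetric] topspace_matrix_quotient using Qprime_DL \<rho> qrep_id by simp
  qed auto
qed

end

theorem theorem7p3:
  fixes p s q n :: nat
  assumes "prime p" and "s \<ge> 1" and "q = p ^ s" and "n \<ge> 1"
    and "CHAR('k::alg_closed_field) = p"
    and "\<And>a :: 'k. \<exists>P :: 'k poly. P \<noteq> 0 \<and> (\<forall>i. poly.coeff P i \<in> range of_nat) \<and> poly P a = 0"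
  shows "(\<forall>x \<in> (Qprime q n :: 'k mat set).
           lang q n x \<in> Ustar n \<and>
           lang q n x =
             mat n n (\<lambda>(i, j). if i = j then 1
                              else if j = n - 1 then - dickson q n (i + 1) (col x 0)
                              else 0))
    \<and> (\<exists>\<phi>. (\<forall>x \<in> (Qprime q n :: 'k mat set). \<phi> (Qprime_orbit q n x) = rho_orbit q n (lang q n x)) \<and>
             fspace_iso \<phi> (G_mod_Qprime q n :: ('k mat set, 'k) fspace) (Ustar_mod_rho q n))
    \<and> (\<exists>\<psi>. (\<forall>x \<in> (Qprime q n :: 'k mat set).
                 \<psi> (rho_orbit q n (lang q n x)) = (\<lambda>a\<in>dickson_algebra q n. a x)) \<and>
             fspace_iso \<psi> (Ustar_mod_rho q n :: ('k mat set, 'k) fspace)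
               (fspace_spec (Qprime q n) (dickson_algebra q n)))
    \<and> (inj_on (dickson_subst q n :: _ \<Rightarrow> 'k mat \<Rightarrow> 'k) {P. mpoly_vars P \<subseteq> {1..n - 1}})
    \<and> (fspace_iso (InU_coset n) (matrix_fspace n (Qprime q n :: 'k mat set)) (DL_variety q n))"
proof -
  interpret frob_field q n "TYPE('k)"
  proof
    have "p \<ge> 2" using assms(1) by (rule prime_ge_2_nat)
    then show "q \<ge> 2" using assms(2,3) power_increasing[of 1 s p] by simp
    show "(a + b) ^ q = a ^ q + b ^ q" for a b :: 'k
      by (rule freshmans_dream') (use assms in simp_all)
    have "of_nat p = (0 :: 'k)" using assms(5) of_nat_CHAR by metis
    then show "of_nat q = (0 :: 'k)" using assms(2,3) by (simp add: power_0_left)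
  qed (fact assms(4))
  obtain \<psi> where \<psi>: "\<And>v. v \<in> Ustar n \<Longrightarrow> \<psi> (rho_orbit q n v) = uev v"
    "fspace_iso \<psi> (Ustar_mod_rho q n) (fspace_spec Qp DA)"
    using ex_Ustar_mod_rho_iso by blast
  have "\<psi> (rho_orbit q n (lang q n x)) = (\<lambda>a\<in>DA. a x)" if "x \<in> Qp" for x
    using \<psi>(1)[OF lang_Qprime_Ustar[OF that]] uev_lang[OF that] by (simp add: ev_def)
  then show ?thesis
    using lang_Qprime_Ustar lang_Qprime_dickson ex_lang_iso \<psi>(2) inj_on_ds InU_coset_iso by blast
qed

end
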